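(* Let $f$ be a polynomial in $z$ and $\bar z$ on $\mathbb{C}^N$. Then $f=B(u)$ on $\mathbb{B}_N$ for some $u\in L^1(\mathbb{B}_N)$ if and only if for all $1\le j,\ell\le N$ the derivative $\partial_{z_j}\bar\partial_{z_\ell}f$ has total degree at most $2N-1$. As a consequence, if $w_1,\dots,w_s\in\mathbb{B}_N$ and $Q_1,\dots,Q_s\in\mathbb{C}[z,\bar z]$ have total degrees at most $2N+1$, then there exists $u\in L^1(\mathbb{B}_N)$ with $B(u)=\sum_{j=1}^s Q_j\circ\varphi_{w_j}$.
   Context: $\mathbb{B}_N$ is the unit ball of $\mathbb{C}^N$, $dV$ normalized volume measure, $\langle z,w\rangle=\sum_j z_j\bar w_j$. The Berezin transform of $u\in L^1(\mathbb{B}_N)$ is $B(u)(z)=(1-|z|^2)^{N+1}\int_{\mathbb{B}_N}\frac{u(\xi)}{|1-\langle z,\xi\rangle|^{2(N+1)}}dV(\xi)$. For $w\in\mathbb{B}_N$, $\varphi_w$ is the involutive automorphism $\varphi_w(z)=\frac{w-P_wz-\sqrt{1-|w|^2}\,(z-P_wz)}{1-\langle z,w\rangle}$, with $P_wz=\frac{\langle z,w\rangle}{|w|^2}w$ for $w\neq0$ and $\varphi_0(z)=-z$; $Q\circ\varphi_w(z)$ means $Q$ evaluated at $\varphi_w(z)$ and $\overline{\varphi_w(z)}$. *)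

theory Defs
  imports "HOL-Analysis.Analysis"
begin

text \<open>Points of C^N are vectors complex^'n, with N = CARD('n).
  A polynomial in z and conj z is given by its coefficient function on pairs
  of multi-indices (alpha, beta), with finite support.\<close>

type_synonym 'n zzpoly = "('n \<Rightarrow> nat) \<times> ('n \<Rightarrow> nat) \<Rightarrow> complex"

definition is_zzpoly :: "'n::finite zzpoly \<Rightarrow> bool" where
  "is_zzpoly c \<longleftrightarrow> finite {m. c m \<noteq> 0}"

definition zzmonom :: "('n::finite \<Rightarrow> nat) \<times> ('n \<Rightarrow> nat) \<Rightarrow> complex^'n \<Rightarrow> complex" where
  "zzmonom m z = (\<Prod>j\<in>UNIV. (z$j) ^ (fst m j) * (cnj (z$j)) ^ (snd m j))"

definition zzeval :: "'n::finite zzpoly \<Rightarrow> complex^'n \<Rightarrow> complex" where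
  "zzeval c z = (\<Sum>m\<in>{m. c m \<noteq> 0}. c m * zzmonom m z)"

text \<open>Total degree at most d (the zero polynomial has every degree bound).\<close>
definition tdeg_le :: "'n::finite zzpoly \<Rightarrow> nat \<Rightarrow> bool" where
  "tdeg_le c d \<longleftrightarrow> (\<forall>a b. c (a, b) \<noteq> 0 \<longrightarrow> (\<Sum>j\<in>UNIV. a j) + (\<Sum>j\<in>UNIV. b j) \<le> d)"

definition dz :: "'n::finite \<Rightarrow> 'n zzpoly \<Rightarrow> 'n zzpoly" where
  "dz j c = (\<lambda>(a, b). of_nat (a j + 1) * c (a(j := a j + 1), b))"

definition dzbar :: "'n::finite \<Rightarrow> 'n zzpoly \<Rightarrow> 'n zzpoly" where
  "dzbar l c = (\<lambda>(a, b). of_nat (b l + 1) * c (a, b(l := b l + 1)))"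

definition cinner :: "complex^'n::finite \<Rightarrow> complex^'n \<Rightarrow> complex" where
  "cinner z w = (\<Sum>j\<in>UNIV. z$j * cnj (w$j))"

abbreviation unit_ball :: "(complex^'n::finite) set" where
  "unit_ball \<equiv> ball 0 1"

text \<open>Berezin transform, with dV = Lebesgue measure normalized by the volume of the ball.\<close>
definition berezin :: "(complex^'n::finite \<Rightarrow> complex) \<Rightarrow> complex^'n \<Rightarrow> complex" where
  "berezin u z =
     complex_of_real ((1 - (norm z)\<^sup>2) ^ (CARD('n) + 1) / measure lebesgue (unit_ball :: (complex^'n) set)) *
     set_lebesgue_integral lebesgue unit_ball
       (\<lambda>\<xi>. u \<xi> / complex_of_real ((cmod (1 - cinner z \<xi>)) ^ (2 * (CARD('n) + 1))))"

text \<open>Involutive automorphism phi_w of the ball.\<close>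
definition phi :: "complex^'n::finite \<Rightarrow> complex^'n \<Rightarrow> complex^'n" where
  "phi w z = (if w = 0 then - z else
     (let Pz = (cinner z w / complex_of_real ((norm w)\<^sup>2)) *s w in
      (1 / (1 - cinner z w)) *s (w - Pz - sqrt (1 - (norm w)\<^sup>2) *\<^sub>R (z - Pz))))"

end

theory Submission
  imports Defs "HOL-Probability.Probability"
begin

text \<open>
Expanding the Berezin kernel shows that \<open>f = B(u)\<close> is a system of identities for the moments of \<open>u\<close> against
the monomials in \<open>z\<close> and its conjugate.

Necessity: among the monomials of \<open>f\<close> with both holomorphic and antiholomorphic factors choose a bidegree of
maximal total degree, and let \<open>P = \<Delta>^k f_0 \<noteq> 0\<close> be the harmonic end of the chain
\<open>f_0, \<Delta> f_0, \<dots>\<close> that starts at that component. The moments of \<open>u\<close> against the conjugate of \<open>P\<close> times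
\<open>|z|^{2j}\<close> are values of a rational function of \<open>j\<close>. The Mellin transform of \<open>u\<close> against \<open>P\<close> in
\<open>|z|^2\<close> extends this identity to negative \<open>j\<close>; if the degree is at least \<open>2N + 2\<close> the integral still converges
at \<open>j = k - N - 1\<close>, where the rational function has a pole or takes the wrong value.

Sufficiency: for a single monomial \<open>u\<close> is a finite sum of monomials times powers of \<open>|z|\<close> and of \<open>log |z|\<close>;
the required moments come out by the Chu--Vandermonde identity, and if both kinds of factors occur the singularity at
the origin is integrable as long as the degree is at most \<open>2N + 1\<close>.

Finally \<open>B(u \<circ> \<phi>_w) = B(u) \<circ> \<phi>_w\<close>, because \<open>(1 - |z|^2)^{-(N+1)} dV\<close> is invariant under \<open>\<phi>_w\<close>: in
homogeneous coordinates \<open>\<phi>_w\<close> is a linear involution of \<open>C^{N+1}\<close> preserving \<open>|a|^2 - |z|^2\<close>.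
\<close>

section \<open>Linear substitutions in Lebesgue integrals\<close>

text \<open>The exponent k - N - 1 is where truncation first shows. Write (x)_N for the rising
  factorial. Up to factorials in j, the moment of u against conj(P) |z|^(2j) is the sum over i <= j
  of A_i (j-i+1)_N, where A_i is a multiple of the Fischer pairing of f with |z|^(2i) P. Maximality
  gives A_i = 0 for i > k, and A_k is a nonzero multiple of the Fischer norm of P, so for j >= k the
  sum is a polynomial in j. Since (j-i+1)_N has its roots at j = i-N, ..., i-1, the truncated sum
  and the polynomial still agree down to j = k - N; at j = k - N - 1 the term i = k contributes A_k
  (-N)_N, which is not zero. At this same exponent |P| |z|^(2j) has order d - 2N - 2 at the origin,
  d being the total degree of the chosen component, so d >= 2N + 2 makes it bounded. The degree
  condition concerns mixed monomials only because holomorphic and antiholomorphic monomials are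
  their own Berezin transforms. The preimage of a mixed monomial is suggested by differentiating one
  radial function; its order at the origin gives the converse threshold 2N + 1.\<close>

text \<open>The double integral of \<open>f(x) g(y + x)\<close> is evaluated in both orders, as in Weil's proof of the uniqueness
of Haar measure.\<close>

lemma translation_invariant_nn_integral:
  fixes \<mu> :: "'a::euclidean_space measure" and f g :: "'a \<Rightarrow> ennreal"
  assumes sf: "sigma_finite_measure \<mu>" and sets: "sets \<mu> = sets borel"
    and inv: "\<And>v. distr \<mu> borel ((+) v) = \<mu>"
    and [measurable]: "f \<in> borel_measurable borel" "g \<in> borel_measurable borel"
  shows "(\<integral>\<^sup>+x. f x \<partial>\<mu>) * (\<integral>\<^sup>+y. g y \<partial>lborel) = (\<integral>\<^sup>+x. g x \<partial>\<mu>) * (\<integral>\<^sup>+y. f (- y) \<partial>lborel)"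
proof -
  interpret \<mu>: sigma_finite_measure \<mu> by fact
  interpret pair_sigma_finite \<mu> lborel ..
  have [measurable_cong]: "sets \<mu> = sets borel" by fact
  have tr: "(\<integral>\<^sup>+x. h (v + x) \<partial>\<mu>) = (\<integral>\<^sup>+x. h x \<partial>\<mu>)" if [measurable]: "h \<in> borel_measurable borel" for h v
  proof -
    have "(\<integral>\<^sup>+x. h x \<partial>\<mu>) = (\<integral>\<^sup>+x. h x \<partial>distr \<mu> borel ((+) v))" using inv by simp
    also have "\<dots> = (\<integral>\<^sup>+x. h (v + x) \<partial>\<mu>)" by (subst nn_integral_distr) auto
    finally show ?thesis by simp
  qed
  have tl: "(\<integral>\<^sup>+x. h (x + v) \<partial>lborel) = (\<integral>\<^sup>+x. h x \<partial>lborel)" if [measurable]: "h \<in> borel_measurable borel"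
    for h and v :: 'a
    by (subst (2) lborel_distr_plus[of v, symmetric]) (simp add: nn_integral_distr add.commute)
  have "(\<integral>\<^sup>+x. f x \<partial>\<mu>) * (\<integral>\<^sup>+y. g y \<partial>lborel) = (\<integral>\<^sup>+x. \<integral>\<^sup>+y. f x * g y \<partial>lborel \<partial>\<mu>)"
    by (simp add: nn_integral_cmult nn_integral_multc)
  also have "\<dots> = (\<integral>\<^sup>+x. \<integral>\<^sup>+y. f x * g (y + x) \<partial>lborel \<partial>\<mu>)"
  proof (rule nn_integral_cong)
    fix x :: 'a
    show "(\<integral>\<^sup>+y. f x * g y \<partial>lborel) = (\<integral>\<^sup>+y. f x * g (y + x) \<partial>lborel)"
      using tl[of g x] by (simp add: nn_integral_cmult)
  qed
  also have "\<dots> = (\<integral>\<^sup>+y. \<integral>\<^sup>+x. f x * g (y + x) \<partial>\<mu> \<partial>lborel)"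
    by (rule Fubini'[symmetric]) measurable
  also have "\<dots> = (\<integral>\<^sup>+y. \<integral>\<^sup>+x. f (- y + x) * g x \<partial>\<mu> \<partial>lborel)"
  proof (rule nn_integral_cong)
    fix y :: 'a
    show "(\<integral>\<^sup>+x. f x * g (y + x) \<partial>\<mu>) = (\<integral>\<^sup>+x. f (- y + x) * g x \<partial>\<mu>)"
      using tr[of "\<lambda>x. f (- y + x) * g x" y] by simp
  qed
  also have "\<dots> = (\<integral>\<^sup>+x. \<integral>\<^sup>+y. f (- y + x) * g x \<partial>lborel \<partial>\<mu>)"
    by (rule Fubini') measurable
  also have "\<dots> = (\<integral>\<^sup>+x. (\<integral>\<^sup>+y. f (- y) \<partial>lborel) * g x \<partial>\<mu>)"
  proof (rule nn_integral_cong)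
    fix x :: 'a
    have "(\<integral>\<^sup>+y. f (- y + x) \<partial>lborel) = (\<integral>\<^sup>+y. f (- (y + (- x))) \<partial>lborel)" by (simp add: algebra_simps)
    also have "\<dots> = (\<integral>\<^sup>+y. f (- y) \<partial>lborel)" by (rule tl[of "\<lambda>y. f (- y)"]) simp
    finally show "(\<integral>\<^sup>+y. f (- y + x) * g x \<partial>lborel) = (\<integral>\<^sup>+y. f (- y) \<partial>lborel) * g x"
      by (simp add: nn_integral_multc)
  qed
  also have "\<dots> = (\<integral>\<^sup>+x. g x \<partial>\<mu>) * (\<integral>\<^sup>+y. f (- y) \<partial>lborel)"
    by (subst nn_integral_cmult) (measurable, simp add: mult.commute)
  finally show ?thesis .
qed

text \<open>Take \<open>g\<close> to be the indicator of the unit ball in the product formula; the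
  reflection in its last factor disappears because \<open>lborel\<close> is invariant under
  negation.\<close>

lemma translation_invariant_unique:
  fixes \<mu> :: "'a::euclidean_space measure"
  assumes sf: "sigma_finite_measure \<mu>" and sets: "sets \<mu> = sets borel"
    and inv: "\<And>v. distr \<mu> borel ((+) v) = \<mu>"
    and [measurable]: "f \<in> borel_measurable borel"
  shows "(\<integral>\<^sup>+x. f x \<partial>\<mu>) = emeasure \<mu> (ball 0 1) / emeasure lborel (ball (0::'a) 1) * (\<integral>\<^sup>+x. f x \<partial>lborel)"
proof -
  let ?b = "ball (0::'a) 1"
  have pos: "emeasure lborel ?b \<noteq> 0" "emeasure lborel ?b \<noteq> \<infinity>"
    using emeasure_lborel_ball_finite[of "0::'a" 1] by (auto simp: emeasure_ball ennreal_eq_0_iff not_le)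
  have refl: "(\<integral>\<^sup>+y. f (- y) \<partial>lborel) = (\<integral>\<^sup>+y. f y \<partial>lborel)"
    using lborel_affine[of "-1" "0::'a"] nn_integral_distr[of uminus "lborel :: 'a measure" borel f]
    by (simp add: density_1)
  have "(\<integral>\<^sup>+x. f x \<partial>\<mu>) * emeasure lborel ?b = emeasure \<mu> ?b * (\<integral>\<^sup>+x. f x \<partial>lborel)"
    using translation_invariant_nn_integral[OF sf sets inv, of f "indicator ?b"] refl sets
    by (simp only: nn_integral_indicator sets_lborel borel_open open_ball assms borel_measurable_indicator)
  then have "(\<integral>\<^sup>+x. f x \<partial>\<mu>) * emeasure lborel ?b / emeasure lborel ?b
      = emeasure \<mu> ?b / emeasure lborel ?b * (\<integral>\<^sup>+x. f x \<partial>lborel)"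
    by (metis ennreal_divide_times ennreal_times_divide mult.commute)
  then show ?thesis using pos by (simp add: mult_divide_eq_ennreal)
qed

text \<open>The image of \<open>lborel\<close> under \<open>T\<close> is translation invariant,
  since v + T x = T (inv T v + x). The factor \<open>c\<close> is left as a ratio of volumes: the
  applications determine it by symmetry, so no determinant has to be computed.\<close>

lemma nn_integral_linear_bij:
  fixes T :: "'a::euclidean_space \<Rightarrow> 'a"
  assumes T: "linear T" "bij T"
  obtains c where "\<And>f. f \<in> borel_measurable borel \<Longrightarrow> (\<integral>\<^sup>+x. f (T x) \<partial>lborel) = c * (\<integral>\<^sup>+x. f x \<partial>lborel)"
    and "c = emeasure lborel (T -` ball 0 1) / emeasure lborel (ball (0::'a) 1)"
proof -
  let ?\<mu> = "distr lborel borel T"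
  have cont: "continuous_on UNIV T" using T(1) linear_continuous_on linear_conv_bounded_linear by blast
  have [measurable]: "T \<in> borel_measurable borel" using cont by (rule borel_measurable_continuous_onI)
  have TI: "T (inv T x) = x" "inv T (T x) = x" for x
    using T(2) by (simp_all add: bij_is_surj surj_f_inv_f bij_is_inj)
  have linv: "linear (inv T)"
  proof (rule linearI)
    show "inv T (x + y) = inv T x + inv T y" for x y
      using TI(2)[of "inv T x + inv T y"] linear_add[OF T(1), of "inv T x" "inv T y"] by (simp add: TI)
    show "inv T (r *\<^sub>R x) = r *\<^sub>R inv T x" for r x
      using TI(2)[of "r *\<^sub>R inv T x"] linear_cmul[OF T(1), of r "inv T x"] by (simp add: TI)
  qed
  have [measurable]: "inv T \<in> borel_measurable borel"
    using linv linear_continuous_on linear_conv_bounded_linear borel_measurable_continuous_onI by blast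
  have sets: "sets ?\<mu> = sets borel" by simp
  have inv: "distr ?\<mu> borel ((+) v) = ?\<mu>" for v
  proof -
    have "distr ?\<mu> borel ((+) v) = distr lborel borel (\<lambda>x. v + T x)"
      by (simp add: distr_distr comp_def)
    also have "(\<lambda>x. v + T x) = T \<circ> (\<lambda>x. inv T v + x)"
      using T by (auto simp: linear_add bij_is_surj surj_f_inv_f)
    also have "distr lborel borel (T \<circ> (\<lambda>x. inv T v + x)) = distr (distr lborel borel ((+) (inv T v))) borel T"
      by (subst distr_distr) auto
    also have "\<dots> = ?\<mu>" by (simp add: lborel_distr_plus)
    finally show ?thesis .
  qed
  have sf: "sigma_finite_measure ?\<mu>"
  proof
    let ?A = "range (\<lambda>n::nat. T ` ball 0 (real n))"
    have vim: "T ` ball 0 r = inv T -` ball 0 r" for r using T(2) by (simp add: bij_vimage_eq_inv_image bij_imp_bij_inv inv_inv_eq)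
    have Tb: "T ` ball 0 r \<in> sets borel" for r
      unfolding vim using measurable_sets[of "inv T" borel borel "ball 0 r"] by simp
    show "\<exists>A. countable A \<and> A \<subseteq> sets ?\<mu> \<and> \<Union> A = space ?\<mu> \<and> (\<forall>a\<in>A. emeasure ?\<mu> a \<noteq> \<infinity>)"
    proof (intro exI[of _ ?A] conjI ballI)
      show "countable ?A" by simp
      show "?A \<subseteq> sets ?\<mu>" using Tb by auto
      show "\<Union> ?A = space ?\<mu>"
      proof -
        have "y \<in> \<Union> ?A" for y
        proof -
          obtain n :: nat where "norm (inv T y) < n" using reals_Archimedean2 by blast
          then have "y \<in> T ` ball 0 (real n)" by (intro image_eqI[of _ _ "inv T y"]) (simp_all add: TI)
          then show ?thesis by blast
        qed
        then have "\<Union> ?A = UNIV" by blast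
        then show ?thesis by simp
      qed
      fix a assume "a \<in> ?A"
      then obtain n :: nat where a: "a = T ` ball 0 (real n)" by auto
      have am: "a \<in> sets borel" using Tb a by simp
      have "emeasure ?\<mu> a = emeasure lborel (ball (0::'a) (real n))"
        using am T(2) by (simp add: emeasure_distr) (simp add: a inj_vimage_image_eq bij_is_inj)
      then show "emeasure ?\<mu> a \<noteq> \<infinity>" using emeasure_lborel_ball_finite[of "0::'a" "real n"] by simp
    qed
  qed
  have "(\<integral>\<^sup>+x. f (T x) \<partial>lborel) = emeasure lborel (T -` ball 0 1) / emeasure lborel (ball (0::'a) 1) * (\<integral>\<^sup>+x. f x \<partial>lborel)"
    if [measurable]: "f \<in> borel_measurable borel" for f
    using translation_invariant_unique[OF sf sets inv that] by (simp add: nn_integral_distr emeasure_distr)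
  then show ?thesis by (rule that) auto
qed

text \<open>The preimage of the unit ball is the ball of radius 1/r, which evaluates the factor
  \<open>c\<close>.\<close>

lemma nn_integral_similarity:
  fixes T :: "'a::euclidean_space \<Rightarrow> 'a"
  assumes T: "linear T" and r: "r > 0" "\<And>x. norm (T x) = r * norm x"
    and [measurable]: "f \<in> borel_measurable borel"
  shows "(\<integral>\<^sup>+x. f x \<partial>lborel) = ennreal (r ^ DIM('a)) * (\<integral>\<^sup>+x. f (T x) \<partial>lborel)"
proof -
  have "inj T" using T r by (auto simp: linear_injective_0) (metis mult_eq_0_iff norm_eq_zero less_irrefl)
  then have "bij T" using T linear_injective_imp_surjective by (auto simp: bij_def)
  then obtain c where c: "\<And>f. f \<in> borel_measurable borel \<Longrightarrow> (\<integral>\<^sup>+x. f (T x) \<partial>lborel) = c * (\<integral>\<^sup>+x. f x \<partial>lborel)"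
    and ceq: "c = emeasure lborel (T -` ball 0 1) / emeasure lborel (ball (0::'a) 1)"
    using nn_integral_linear_bij[OF T] by metis
  have pos: "measure lborel (ball (0::'a) 1) > 0" by simp
  have "T -` ball 0 1 = ball 0 (1/r)" using r by (auto simp: field_simps)
  moreover have "emeasure lborel (ball (0::'a) s) = ennreal (s ^ DIM('a)) * ennreal (measure lborel (ball (0::'a) 1))" if "s \<ge> 0" for s
    using content_ball_conv_unit_ball[OF that, of "0::'a"] emeasure_lborel_ball_finite[of "0::'a" s] that
    by (subst emeasure_eq_ennreal_measure) (auto simp: ennreal_mult')
  ultimately have "c = ennreal ((1/r) ^ DIM('a)) * ennreal (measure lborel (ball (0::'a) 1)) / ennreal (measure lborel (ball (0::'a) 1))"
    using r(1) ceq by (simp add: ceq)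
  also have "\<dots> = ennreal ((1/r) ^ DIM('a))" using pos
    by (simp add: mult_divide_eq_ennreal)
  finally have "c = ennreal ((1/r) ^ DIM('a))" .
  then have "ennreal (r ^ DIM('a)) * c = 1" using r(1) by (simp flip: ennreal_mult' add: power_one_over)
  then show ?thesis using c[of f] by (simp flip: mult.assoc)
qed

text \<open>Applying the substitution twice to the indicator of the unit ball gives c * c = 1, and
  \<open>c\<close> is nonnegative.\<close>

lemma nn_integral_linear_involution:
  fixes T :: "'a::euclidean_space \<Rightarrow> 'a"
  assumes T: "linear T" "\<And>x. T (T x) = x" and [measurable]: "f \<in> borel_measurable borel"
  shows "(\<integral>\<^sup>+x. f (T x) \<partial>lborel) = (\<integral>\<^sup>+x. f x \<partial>lborel)"
proof -
  have "bij T" by (rule o_bij[of T]) (auto simp: T)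
  have [measurable]: "T \<in> borel_measurable borel"
    using T(1) linear_continuous_on linear_conv_bounded_linear borel_measurable_continuous_onI by blast
  obtain c where c: "\<And>f. f \<in> borel_measurable borel \<Longrightarrow> (\<integral>\<^sup>+x. f (T x) \<partial>lborel) = c * (\<integral>\<^sup>+x. f x \<partial>lborel)"
    using nn_integral_linear_bij[OF T(1) \<open>bij T\<close>] by metis
  let ?e = "emeasure lborel (ball (0::'a) 1)"
  have pos: "?e \<noteq> 0" "?e \<noteq> \<infinity>"
    using emeasure_lborel_ball_finite[of "0::'a" 1] by (auto simp: emeasure_ball ennreal_eq_0_iff not_le)
  have i1: "(indicator (ball 0 1) :: 'a \<Rightarrow> ennreal) \<in> borel_measurable borel"
    by (rule borel_measurable_indicator) simp
  have i2: "(\<lambda>x. indicator (ball 0 1) (T x) :: ennreal) \<in> borel_measurable borel"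
    using measurable_compose[OF \<open>T \<in> borel_measurable borel\<close> i1] .
  have "?e = (\<integral>\<^sup>+x. indicator (ball 0 1) (T (T x)) \<partial>lborel)" by (simp add: T(2))
  also have "\<dots> = c * (c * ?e)"
    using c[OF i2] c[OF i1] by simp
  finally have "c * c * ?e = 1 * ?e" by (simp add: mult.assoc)
  then have "c * c = 1" using pos mult_divide_eq_ennreal[of ?e "c * c"] mult_divide_eq_ennreal[of ?e 1] by simp
  then have "c = 1"
  proof (cases c)
    case (real r)
    with \<open>c * c = 1\<close> have "r * r = 1" by (simp flip: ennreal_mult')
    with real show ?thesis by (simp flip: power2_eq_square add: power2_eq_1_iff)
  qed (simp add: ennreal_top_mult)
  then show ?thesis using c[of f] by simp
qed

lemma distr_lborel_isometry:
  fixes T :: "'a::euclidean_space \<Rightarrow> 'a"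
  assumes T: "linear T" "\<And>x. norm (T x) = norm x"
  shows "distr lborel borel T = lborel"
proof (rule measure_eqI)
  have [measurable]: "T \<in> borel_measurable borel"
    using T(1) linear_continuous_on linear_conv_bounded_linear borel_measurable_continuous_onI by blast
  fix A :: "'a set" assume "A \<in> sets (distr lborel borel T)"
  then have A[measurable]: "A \<in> sets borel" by simp
  have "emeasure (distr lborel borel T) A = (\<integral>\<^sup>+x. indicator A x \<partial>distr lborel borel T)" by simp
  also have "\<dots> = (\<integral>\<^sup>+x. indicator A (T x) \<partial>lborel)" by (rule nn_integral_distr) measurable
  also have "\<dots> = (\<integral>\<^sup>+x. indicator A x \<partial>lborel)"
    using nn_integral_similarity[OF T(1), of 1 "indicator A"] T(2) by simp
  finally show "emeasure (distr lborel borel T) A = emeasure lborel A" by simp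
qed simp

section \<open>Integration in the logarithmic radius\<close>

text \<open>The variable \<open>- log |x|^2\<close> turns Mellin transforms in \<open>|x|^2\<close> into Laplace transforms on the half
line. Its value at the origin is the junk value 0, hence the almost-everywhere statements below.\<close>

definition logr :: "'a::real_normed_vector \<Rightarrow> real" where "logr x = - ln ((norm x)\<^sup>2)"

lemma logr_measurable [measurable]: "logr \<in> borel_measurable borel"
  unfolding logr_def by measurable

lemma exp_neg_logr: "x \<noteq> 0 \<Longrightarrow> exp (- logr x) = (norm x)\<^sup>2"
  by (simp add: logr_def)

lemma logr_greater_iff: "x \<noteq> 0 \<Longrightarrow> y < logr x \<longleftrightarrow> norm x < exp (- y / 2)"
proof -
  assume "x \<noteq> 0"
  then have "y < logr x \<longleftrightarrow> ln (norm x) < - y / 2" by (simp add: logr_def ln_realpow, arith)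
  also have "\<dots> \<longleftrightarrow> norm x < exp (- y / 2)" using \<open>x \<noteq> 0\<close>
    by (metis exp_less_cancel_iff exp_ln zero_less_norm_iff)
  finally show ?thesis .
qed

lemma AE_lborel_neq: "AE x in lborel. x \<noteq> (c::'a::euclidean_space)"
  by (simp add: AE_iff_measurable[of "{c}"])

lemma ball_borel_measurable [measurable]: "ball (c::'a::metric_space) r \<in> sets borel"
  by simp

lemma logr_pos_iff: "x \<noteq> 0 \<Longrightarrow> 0 < logr x \<longleftrightarrow> x \<in> ball 0 1"
  by (simp add: logr_greater_iff)

lemma nn_integral_exp_tail:
  fixes l y :: real
  assumes l: "l > 0"
  shows "(\<integral>\<^sup>+t. ennreal (l * exp (- l * t)) * indicator {y<..} t \<partial>lborel) = ennreal (exp (- l * y))"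
proof -
  have lim: "((\<lambda>t. - exp (- l * t)) \<longlongrightarrow> 0) at_top"
  proof -
    have "filterlim (\<lambda>t. - (l * t)) at_bot at_top"
      unfolding filterlim_uminus_at_bot minus_minus
      by (rule filterlim_tendsto_pos_mult_at_top[OF tendsto_const l filterlim_ident])
    then have "((\<lambda>t. exp (- (l * t))) \<longlongrightarrow> 0) at_top" by (rule filterlim_compose[OF exp_at_bot])
    from tendsto_minus[OF this] show ?thesis by simp
  qed
  have der: "DERIV (\<lambda>t. - exp (- l * t)) x :> l * exp (- l * x)" for x
    by (auto intro!: derivative_eq_intros)
  have "(\<integral>\<^sup>+t. ennreal (l * exp (- l * t)) * indicator {y<..} t \<partial>lborel)
      = (\<integral>\<^sup>+t. ennreal (l * exp (- l * t)) * indicator {y..} t \<partial>lborel)"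
    using AE_lborel_neq[of y] by (intro nn_integral_cong_AE, eventually_elim) (auto simp: indicator_def)
  also have "\<dots> = ennreal (0 - (- exp (- l * y)))"
    using l by (intro nn_integral_FTC_atLeast der lim) simp_all
  finally show ?thesis by simp
qed

text \<open>Polar coordinates in disguise: scaling fixes the \<open>h\<close>-mass of every centred
  ball from that of the unit ball, so integrals of \<open>h\<close> times a function of |x| reduce
  to one real variable, and a surface measure is not involved.\<close>

locale homogeneous =
  fixes h :: "'a::euclidean_space \<Rightarrow> real" and d :: nat
  assumes h_measurable [measurable]: "h \<in> borel_measurable borel"
    and h_nonneg: "h x \<ge> 0"
    and h_scale: "r > 0 \<Longrightarrow> h (r *\<^sub>R x) = r ^ d * h x"
    and h_finite: "(\<integral>\<^sup>+x. ennreal (h x) * indicator (ball 0 1) x \<partial>lborel) < \<infinity>"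
begin

definition mass :: real where
  "mass = enn2real (\<integral>\<^sup>+x. ennreal (h x) * indicator (ball 0 1) x \<partial>lborel)"

definition rate :: real where "rate = (DIM('a) + d) / 2"

lemma rate_pos: "rate > 0"
  using DIM_positive[where 'a='a] by (simp add: rate_def add_pos_nonneg)

lemma mass_nonneg: "mass \<ge> 0"
  by (simp add: mass_def)

lemma ennreal_mass: "ennreal mass = (\<integral>\<^sup>+x. ennreal (h x) * indicator (ball 0 1) x \<partial>lborel)"
  using h_finite by (simp add: mass_def)

lemma nn_integral_ball:
  assumes "r > 0"
  shows "(\<integral>\<^sup>+x. ennreal (h x) * indicator (ball 0 r) x \<partial>lborel) = ennreal (r ^ (DIM('a) + d) * mass)"
proof -
  have "(\<integral>\<^sup>+x. ennreal (h x) * indicator (ball 0 r) x \<partial>lborel)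
      = ennreal (r ^ DIM('a)) * (\<integral>\<^sup>+x. ennreal (h (r *\<^sub>R x)) * indicator (ball 0 r) (r *\<^sub>R x) \<partial>lborel)"
    using assms by (intro nn_integral_similarity[of "\<lambda>x. r *\<^sub>R x" r]) (auto simp: linear_iff algebra_simps)
  also have "(\<integral>\<^sup>+x. ennreal (h (r *\<^sub>R x)) * indicator (ball 0 r) (r *\<^sub>R x) \<partial>lborel)
     = (\<integral>\<^sup>+x. ennreal (r ^ d) * (ennreal (h x) * indicator (ball 0 1) x) \<partial>lborel)"
    using assms by (intro nn_integral_cong) (auto simp: h_scale ennreal_mult' indicator_def)
  also have "\<dots> = ennreal (r ^ d) * ennreal mass"
    by (subst nn_integral_cmult) (auto simp: ennreal_mass)
  finally show ?thesis using assms mass_nonneg by (simp add: power_add flip: ennreal_mult')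
qed

text \<open>Half lines suffice to identify the measures. Up to the origin, the preimage of {y<..} is
  the ball of radius exp (- y / 2), whose mass is \<open>mass * exp (- rate * y)\<close>: an
  exponential law scaled by \<open>mass\<close>.\<close>

lemma distr_logr:
  "distr (density lborel h) borel logr = density lborel (\<lambda>y. mass * rate * exp (- rate * y))"
proof (rule measure_eqI_lessThan)
  have e1: "emeasure (distr (density lborel h) borel logr) {y<..} = ennreal (mass * exp (- rate * y))" for y
  proof -
    have "emeasure (distr (density lborel h) borel logr) {y<..}
        = (\<integral>\<^sup>+x. ennreal (h x) * indicator {y<..} (logr x) \<partial>lborel)"
    proof -
      have "emeasure (distr (density lborel h) borel logr) {y<..}
        = (\<integral>\<^sup>+t. indicator {y<..} t \<partial>distr (density lborel h) borel logr)" by simp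
      also have "\<dots> = (\<integral>\<^sup>+x. indicator {y<..} (logr x) \<partial>density lborel h)"
        by (rule nn_integral_distr) measurable
      also have "\<dots> = (\<integral>\<^sup>+x. ennreal (h x) * indicator {y<..} (logr x) \<partial>lborel)"
        by (rule nn_integral_density) measurable
      finally show ?thesis .
    qed
    also have "\<dots> = (\<integral>\<^sup>+x. ennreal (h x) * indicator (ball 0 (exp (- y / 2))) x \<partial>lborel)"
      using AE_lborel_neq[of 0] by (intro nn_integral_cong_AE, eventually_elim) (auto simp: indicator_def logr_greater_iff)
    also have "\<dots> = ennreal (exp (- y / 2) ^ (DIM('a) + d) * mass)" by (rule nn_integral_ball) simp
    also have "exp (- y / 2) ^ (DIM('a) + d) = exp (- rate * y)"
      by (simp add: rate_def flip: exp_of_nat_mult)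
    finally show ?thesis by (simp add: mult.commute)
  qed
  have e2: "emeasure (density lborel (\<lambda>y. mass * rate * exp (- rate * y))) {y<..} = ennreal (mass * exp (- rate * y))" for y
  proof -
    have "emeasure (density lborel (\<lambda>y. mass * rate * exp (- rate * y))) {y<..}
        = (\<integral>\<^sup>+t. ennreal (mass * rate * exp (- rate * t)) * indicator {y<..} t \<partial>lborel)"
      by (simp add: emeasure_density)
    also have "\<dots> = (\<integral>\<^sup>+t. ennreal mass * (ennreal (rate * exp (- rate * t)) * indicator {y<..} t) \<partial>lborel)"
      using mass_nonneg by (intro nn_integral_cong) (simp add: mult.assoc ennreal_mult')
    also have "\<dots> = ennreal mass * ennreal (exp (- rate * y))"
      by (subst nn_integral_cmult) (simp_all only: nn_integral_exp_tail[OF rate_pos], measurable)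
    finally show ?thesis using mass_nonneg by (simp add: ennreal_mult')
  qed
  fix y
  show "emeasure (distr (density lborel h) borel logr) {y<..} < \<infinity>" by (simp add: e1)
  show "emeasure (distr (density lborel h) borel logr) {y<..}
    = emeasure (density lborel (\<lambda>y. mass * rate * exp (- rate * y))) {y<..}" by (simp only: e1 e2)
qed simp_all

lemma nn_integral_radial:
  assumes [measurable]: "F \<in> borel_measurable borel"
  shows "(\<integral>\<^sup>+x. ennreal (h x) * F (logr x) \<partial>lborel) = (\<integral>\<^sup>+y. ennreal (mass * rate * exp (- rate * y)) * F y \<partial>lborel)"
proof -
  have "(\<integral>\<^sup>+x. ennreal (h x) * F (logr x) \<partial>lborel) = (\<integral>\<^sup>+y. F y \<partial>distr (density lborel h) borel logr)"
    by (simp add: nn_integral_distr nn_integral_density)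
  also have "\<dots> = (\<integral>\<^sup>+y. ennreal (mass * rate * exp (- rate * y)) * F y \<partial>lborel)"
    by (simp add: distr_logr nn_integral_density)
  finally show ?thesis .
qed

lemma integral_radial:
  fixes F :: "real \<Rightarrow> 'b::{banach, second_countable_topology}"
  assumes [measurable]: "F \<in> borel_measurable borel"
  shows "(\<integral>x. h x *\<^sub>R F (logr x) \<partial>lborel) = (\<integral>y. (mass * rate * exp (- rate * y)) *\<^sub>R F y \<partial>lborel)"
proof -
  have "(\<integral>x. h x *\<^sub>R F (logr x) \<partial>lborel) = (\<integral>y. F y \<partial>distr (density lborel h) borel logr)"
    by (simp add: integral_distr integral_density h_nonneg)
  also have "\<dots> = (\<integral>y. (mass * rate * exp (- rate * y)) *\<^sub>R F y \<partial>lborel)"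
    using mass_nonneg rate_pos by (simp add: distr_logr integral_density)
  finally show ?thesis .
qed

text \<open>Layer cake: exp(-|x|^2) is the integral of exp(-t) over t > |x|^2, and swapping the
  integrals leaves the masses of balls of radius \<open>sqrt t\<close>, hence a Gamma integral. The
  integrality of \<open>rate\<close> turns a power of \<open>sqrt t\<close> into
  \<open>t ^ L\<close>. The formula is used backwards: a Gaussian integral computed otherwise yields
  \<open>mass\<close>.\<close>

lemma nn_integral_gaussian:
  assumes "rate = real L"
  shows "(\<integral>\<^sup>+x. ennreal (h x * exp (- (norm x)\<^sup>2)) \<partial>lborel) = ennreal (fact L * mass)"
proof -
  have L: "DIM('a) + d = 2 * L" using assms by (simp add: rate_def)
  have e: "ennreal (exp (- s)) = (\<integral>\<^sup>+t. ennreal (exp (- t)) * indicator {s<..} t \<partial>lborel)" for s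
    using nn_integral_exp_tail[of 1 s] by simp
  have [measurable]: "Measurable.pred (borel \<Otimes>\<^sub>M borel) (\<lambda>(x::'a, t). (norm x)\<^sup>2 < t)" by measurable
  have "(\<integral>\<^sup>+x. ennreal (h x * exp (- (norm x)\<^sup>2)) \<partial>lborel)
     = (\<integral>\<^sup>+x. \<integral>\<^sup>+t. ennreal (h x) * (ennreal (exp (- t)) * indicator {(norm x)\<^sup>2<..} t) \<partial>lborel \<partial>lborel)"
  proof (rule nn_integral_cong)
    fix x :: 'a
    show "ennreal (h x * exp (- (norm x)\<^sup>2))
      = (\<integral>\<^sup>+t. ennreal (h x) * (ennreal (exp (- t)) * indicator {(norm x)\<^sup>2<..} t) \<partial>lborel)"
      by (subst nn_integral_cmult) (simp_all add: ennreal_mult' h_nonneg flip: e)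
  qed
  also have "\<dots> = (\<integral>\<^sup>+x. \<integral>\<^sup>+t. ennreal (h x) * ennreal (exp (- t)) * (if (norm x)\<^sup>2 < t then 1 else 0) \<partial>lborel \<partial>lborel)"
    by (intro nn_integral_cong) (auto simp: indicator_def)
  also have "\<dots> = (\<integral>\<^sup>+t. \<integral>\<^sup>+x. ennreal (h x) * ennreal (exp (- t)) * (if (norm x)\<^sup>2 < t then 1 else 0) \<partial>lborel \<partial>lborel)"
    by (rule lborel_pair.Fubini'[symmetric]) measurable
  also have "\<dots> = (\<integral>\<^sup>+t. ennreal mass * (ennreal (t ^ L * exp (- t)) * indicator {0..} t) \<partial>lborel)"
  proof (rule nn_integral_cong_AE, use AE_lborel_neq[of "0::real"] in eventually_elim)
    fix t :: real assume "t \<noteq> 0"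
    show "(\<integral>\<^sup>+x. ennreal (h x) * ennreal (exp (- t)) * (if (norm x)\<^sup>2 < t then 1 else 0) \<partial>lborel)
       = ennreal mass * (ennreal (t ^ L * exp (- t)) * indicator {0..} t)"
    proof (cases "t > 0")
      case True
      have iff: "(norm x)\<^sup>2 < t \<longleftrightarrow> x \<in> ball 0 (sqrt t)" for x :: 'a
        using real_sqrt_less_iff[of "(norm x)\<^sup>2" t] by simp
      have "(\<integral>\<^sup>+x. ennreal (h x) * ennreal (exp (- t)) * (if (norm x)\<^sup>2 < t then 1 else 0) \<partial>lborel)
          = (\<integral>\<^sup>+x. ennreal (exp (- t)) * (ennreal (h x) * indicator (ball 0 (sqrt t)) x) \<partial>lborel)"
        by (intro nn_integral_cong) (simp only: iff, simp add: indicator_def mult.commute)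
      also have "\<dots> = ennreal (exp (- t)) * ennreal (sqrt t ^ (DIM('a) + d) * mass)"
        using True by (subst nn_integral_cmult) (auto simp: nn_integral_ball)
      also have "sqrt t ^ (DIM('a) + d) = t ^ L" using True by (simp add: L power_mult)
      finally show ?thesis using True mass_nonneg by (simp add: ac_simps flip: ennreal_mult')
    next
      case False
      then have "\<not> (norm x)\<^sup>2 < t" for x :: 'a by (meson not_le order_trans zero_le_power2)
      then show ?thesis using False \<open>t \<noteq> 0\<close> by simp
    qed
  qed
  also have "\<dots> = ennreal mass * real_of_nat (fact L)"
    by (subst nn_integral_cmult) (auto simp: nn_intergal_power_times_exp_Ici)
  finally show ?thesis using mass_nonneg by (simp add: mult.commute ennreal_mult' flip: ennreal_of_nat_eq_real_of_nat)
qed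

end

section \<open>Lebesgue measure on vectors as a product measure\<close>

lemma lborel_vec:
  "lborel = distr (\<Pi>\<^sub>M i\<in>UNIV. lborel) borel (\<lambda>f. (\<chi> i. f i) :: ('c::euclidean_space)^'n)"
proof (rule lborel_eqI)
  interpret product_sigma_finite "\<lambda>i::'n. lborel :: 'c measure" ..
  have [measurable]: "(\<lambda>f. (\<chi> i. f i) :: 'c^'n) \<in> borel_measurable (\<Pi>\<^sub>M i\<in>UNIV. lborel)"
    by (subst borel_measurable_euclidean_space) (auto simp: Basis_vec_def inner_axis)
  fix l u :: "'c^'n" assume le: "\<And>b. b \<in> Basis \<Longrightarrow> l \<bullet> b \<le> u \<bullet> b"
  have le': "l $ i \<bullet> b \<le> u $ i \<bullet> b" if "b \<in> Basis" for i b
  proof -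
    have "axis i b \<in> (Basis :: ('c^'n) set)" using that by (auto simp: Basis_vec_def)
    from le[OF this] show ?thesis by (simp add: inner_axis)
  qed
  have "emeasure (distr (\<Pi>\<^sub>M i\<in>UNIV. lborel) borel (\<lambda>f. (\<chi> i. f i) :: 'c^'n)) (box l u)
    = emeasure (\<Pi>\<^sub>M i\<in>UNIV. lborel) (Pi\<^sub>E UNIV (\<lambda>i. box (l $ i) (u $ i)))"
  proof -
    have "(\<lambda>f. (\<chi> i. f i) :: 'c^'n) -` box l u \<inter> space (\<Pi>\<^sub>M i\<in>UNIV. lborel) = Pi\<^sub>E UNIV (\<lambda>i. box (l $ i) (u $ i))"
      by (auto simp: space_PiM box_def Basis_vec_def inner_axis PiE_def Pi_def)
    then show ?thesis by (subst emeasure_distr) auto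
  qed
  also have "\<dots> = (\<Prod>i\<in>UNIV. emeasure lborel (box (l $ i) (u $ i)))"
    by (rule emeasure_PiM) auto
  also have "\<dots> = (\<Prod>i\<in>UNIV. ennreal (\<Prod>b\<in>Basis. (u $ i - l $ i) \<bullet> b))"
  proof (rule prod.cong)
    fix i :: 'n
    show "emeasure lborel (box (l $ i) (u $ i)) = ennreal (\<Prod>b\<in>Basis. (u $ i - l $ i) \<bullet> b)"
      using le' by (simp add: emeasure_lborel_box_eq)
  qed simp
  also have "\<dots> = ennreal (\<Prod>i\<in>UNIV. \<Prod>b\<in>Basis. (u $ i - l $ i) \<bullet> b)"
    by (intro prod_ennreal prod_nonneg) (simp_all add: le' inner_diff_left)
  also have "(\<Prod>i\<in>UNIV. \<Prod>b\<in>Basis. (u $ i - l $ i) \<bullet> b) = (\<Prod>(i,b)\<in>UNIV\<times>Basis. (u - l) \<bullet> axis i b)"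
    by (simp add: prod.cartesian_product inner_axis)
  also have "\<dots> = (\<Prod>b\<in>Basis. (u - l) \<bullet> b)"
  proof -
    have "inj_on (\<lambda>(i::'n, b::'c). axis i b) (UNIV \<times> Basis)"
      by (auto simp: inj_on_def axis_eq_axis nonzero_Basis)
    moreover have "(\<lambda>(i::'n, b::'c). axis i b) ` (UNIV \<times> Basis) = Basis"
      by (auto simp: Basis_vec_def)
    ultimately show ?thesis
      using prod.reindex[of "\<lambda>(i::'n, b::'c). axis i b" "UNIV \<times> Basis" "\<lambda>b. (u - l) \<bullet> b"]
      by (simp add: case_prod_unfold comp_def)
  qed
  finally show "emeasure (distr (\<Pi>\<^sub>M i\<in>UNIV. lborel) borel (\<lambda>f. (\<chi> i. f i) :: 'c^'n)) (box l u) = ennreal (\<Prod>b\<in>Basis. (u - l) \<bullet> b)" .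
qed simp

lemma nn_integral_vec_prod:
  fixes g :: "'n::finite \<Rightarrow> 'c::euclidean_space \<Rightarrow> ennreal"
  assumes [measurable]: "\<And>i. g i \<in> borel_measurable borel"
  shows "(\<integral>\<^sup>+x. (\<Prod>i\<in>UNIV. g i (x $ i)) \<partial>lborel) = (\<Prod>i\<in>UNIV. \<integral>\<^sup>+y. g i y \<partial>lborel)"
proof -
  interpret product_sigma_finite "\<lambda>i::'n. lborel :: 'c measure" ..
  have [measurable]: "(\<lambda>f. (\<chi> i. f i) :: 'c^'n) \<in> borel_measurable (\<Pi>\<^sub>M i\<in>UNIV. lborel)"
    by (subst borel_measurable_euclidean_space) (auto simp: Basis_vec_def inner_axis)
  have [measurable]: "(\<lambda>x::'c^'n. x $ i) \<in> borel_measurable borel" for i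
    by (intro borel_measurable_continuous_onI continuous_intros)
  have "(\<integral>\<^sup>+x. (\<Prod>i\<in>UNIV. g i (x $ i)) \<partial>lborel) = (\<integral>\<^sup>+f. (\<Prod>i\<in>UNIV. g i (f i)) \<partial>(\<Pi>\<^sub>M i\<in>UNIV. lborel))"
    by (subst lborel_vec, subst nn_integral_distr) auto
  also have "\<dots> = (\<Prod>i\<in>UNIV. \<integral>\<^sup>+y. g i y \<partial>lborel)"
    by (rule product_nn_integral_prod) auto
  finally show ?thesis .
qed

abbreviation ball_integrable :: "(complex^'n \<Rightarrow> complex) \<Rightarrow> bool" where
  "ball_integrable \<equiv> set_integrable lebesgue unit_ball"

abbreviation ball_integral :: "(complex^'n \<Rightarrow> complex) \<Rightarrow> complex" where
  "ball_integral \<equiv> set_lebesgue_integral lebesgue unit_ball"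

type_synonym 'n biindex = "('n \<Rightarrow> nat) \<times> ('n \<Rightarrow> nat)"

section \<open>Monomial integrals over the ball\<close>

lemma vec_nth_borel_measurable [measurable]: "(\<lambda>x::'c::euclidean_space^'n. x $ i) \<in> borel_measurable borel"
  by (intro borel_measurable_continuous_onI continuous_intros)

definition mdeg :: "('n::finite \<Rightarrow> nat) \<Rightarrow> nat" where "mdeg a = (\<Sum>j\<in>UNIV. a j)"

definition mfact :: "('n::finite \<Rightarrow> nat) \<Rightarrow> real" where "mfact a = (\<Prod>j\<in>UNIV. fact (a j))"

lemma mdeg_0 [simp]: "mdeg (\<lambda>_. 0) = 0" and mfact_0 [simp]: "mfact (\<lambda>_. 0) = 1"
  by (simp_all add: mdeg_def mfact_def)

lemma mfact_pos: "mfact a > 0"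
  by (simp add: mfact_def prod_pos)

definition absmonom :: "('n::finite \<Rightarrow> nat) \<Rightarrow> complex^'n \<Rightarrow> real" where
  "absmonom a x = (\<Prod>j\<in>UNIV. cmod (x $ j) ^ (2 * a j))"

lemma norm_vec_nth_le_1: "x \<in> ball 0 1 \<Longrightarrow> norm (x $ i) \<le> 1" for x :: "complex^'n"
  using Finite_Cartesian_Product.norm_nth_le[of x i] by auto

lemma finite_ball_integral:
  fixes h :: "'a::euclidean_space \<Rightarrow> real"
  assumes "\<And>x. x \<in> ball 0 1 \<Longrightarrow> h x \<le> 1"
  shows "(\<integral>\<^sup>+x. ennreal (h x) * indicator (ball 0 1) x \<partial>lborel) < \<infinity>"
proof -
  have "(\<integral>\<^sup>+x. ennreal (h x) * indicator (ball 0 1) x \<partial>lborel) \<le> (\<integral>\<^sup>+x. indicator (ball (0::'a) 1) x \<partial>lborel)"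
  proof (rule nn_integral_mono)
    show "ennreal (h x) * indicator (ball 0 1) x \<le> indicator (ball 0 1) x" for x
      using assms[of x] by (cases "x \<in> ball 0 1") (auto simp: ennreal_le_1)
  qed
  also have "\<dots> < \<infinity>" using emeasure_lborel_ball_finite by simp
  finally show ?thesis .
qed

lemma absmonom_homogeneous: "homogeneous (absmonom a) (2 * mdeg a)"
proof
  show "absmonom a \<in> borel_measurable borel" unfolding absmonom_def by measurable
  show "absmonom a x \<ge> 0" for x by (auto simp: absmonom_def intro!: prod_nonneg)
  show "absmonom a (r *\<^sub>R x) = r ^ (2 * mdeg a) * absmonom a x" if "r > 0" for r x
    using that by (simp add: absmonom_def power_mult_distrib prod.distrib power_sum sum_distrib_left mdeg_def)
  show "(\<integral>\<^sup>+x. ennreal (absmonom a x) * indicator (ball 0 1) x \<partial>lborel) < \<infinity>"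
    by (rule finite_ball_integral) (auto simp: absmonom_def power_le_one norm_vec_nth_le_1 intro!: prod_le_1)
qed

lemma homogeneous_norm_power: "homogeneous (\<lambda>z::complex. norm z ^ (2 * k)) (2 * k)"
proof
  show "(\<integral>\<^sup>+x. ennreal (norm (x::complex) ^ (2 * k)) * indicator (ball 0 1) x \<partial>lborel) < \<infinity>"
    by (rule finite_ball_integral) (auto simp: power_le_one)
qed (auto simp: power_mult_distrib)

text \<open>Starting from the area \<open>pi\<close> of the disc, that is from k = 0, the factor
  |x|^(2k) is absorbed as exp (- k * logr x) and integrated against the exponential law of
  \<open>logr\<close>.\<close>

lemma mass_norm_power: "homogeneous.mass (\<lambda>z::complex. norm z ^ (2 * k)) = pi / (k + 1)"
proof -
  interpret h0: homogeneous "\<lambda>z::complex. norm z ^ (2 * 0)" "2 * 0" by (rule homogeneous_norm_power)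
  interpret hk: homogeneous "\<lambda>z::complex. norm z ^ (2 * k)" "2 * k" by (rule homogeneous_norm_power)
  have "emeasure lborel (ball (0::complex) 1) = ennreal pi"
    using content_ball[of 1 "0::complex"] emeasure_lborel_ball_finite[of "0::complex" 1]
    by (subst emeasure_eq_ennreal_measure) (auto simp: unit_ball_vol_2)
  then have m0: "h0.mass = pi" unfolding h0.mass_def by simp
  have r0: "h0.rate = 1" unfolding h0.rate_def by simp
  have "ennreal hk.mass = (\<integral>\<^sup>+x. ennreal (norm (x::complex) ^ (2 * k)) * indicator (ball 0 1) x \<partial>lborel)"
    by (rule hk.ennreal_mass)
  also have "\<dots> = (\<integral>\<^sup>+x. ennreal (norm (x::complex) ^ (2 * 0)) * (ennreal (exp (- k * logr x)) * indicator {0<..} (logr x)) \<partial>lborel)"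
  proof (intro nn_integral_cong_AE, use AE_lborel_neq[of "0::complex"] in eventually_elim)
    fix x :: complex assume "x \<noteq> 0"
    have "exp (- real k * logr x) = norm x ^ (2 * k)"
      using exp_neg_logr[OF \<open>x \<noteq> 0\<close>] exp_of_nat_mult[of k "- logr x"] by (simp add: power_mult)
    then show "ennreal (norm x ^ (2 * k)) * indicator (ball 0 1) x =
        ennreal (norm x ^ (2 * 0)) * (ennreal (exp (- k * logr x)) * indicator {0<..} (logr x))"
      using logr_pos_iff[OF \<open>x \<noteq> 0\<close>] by (simp add: indicator_def)
  qed
  also have "\<dots> = (\<integral>\<^sup>+y. ennreal (pi * 1 * exp (- 1 * y)) * (ennreal (exp (- k * y)) * indicator {0<..} y) \<partial>lborel)"
    using h0.nn_integral_radial[of "\<lambda>y. ennreal (exp (- k * y)) * indicator {0<..} y"] unfolding m0 r0 by simp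
  also have "\<dots> = (\<integral>\<^sup>+y. ennreal (pi / (k + 1)) * (ennreal (real (k + 1) * exp (- real (k + 1) * y)) * indicator {0<..} y) \<partial>lborel)"
  proof (intro nn_integral_cong)
    fix y :: real
    have "exp (- 1 * y) * exp (- k * y) = exp (- real (k + 1) * y)"
      by (simp add: algebra_simps flip: exp_add)
    moreover have "pi / (k + 1) * real (k + 1) = pi" by simp
    ultimately have "pi * 1 * exp (- 1 * y) * exp (- k * y) = pi / (k + 1) * (real (k + 1) * exp (- real (k + 1) * y))"
      by (metis mult.assoc mult.right_neutral)
    then show "ennreal (pi * 1 * exp (- 1 * y)) * (ennreal (exp (- k * y)) * indicator {0<..} y) =
       ennreal (pi / (k + 1)) * (ennreal (real (k + 1) * exp (- real (k + 1) * y)) * indicator {0<..} y)"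
      by (simp only: mult.assoc[symmetric] ennreal_mult'[symmetric] ennreal_mult''[symmetric]
           exp_ge_zero pi_ge_zero mult_nonneg_nonneg divide_nonneg_nonneg of_nat_0_le_iff zero_le_one add_nonneg_nonneg)
  qed
  also have "\<dots> = ennreal (pi / (k + 1)) * ennreal (exp (- real (k + 1) * 0))"
  proof -
    have "real (k + 1) > 0" by simp
    note t = nn_integral_exp_tail[OF this, of 0]
    show ?thesis unfolding t[symmetric] by (rule nn_integral_cmult) measurable
  qed
  finally have "ennreal hk.mass = ennreal (pi / (k + 1))" by simp
  then show ?thesis using hk.mass_nonneg by (simp add: ennreal_inj)
qed

lemma nn_integral_gaussian_complex:
  "(\<integral>\<^sup>+z. ennreal (norm (z::complex) ^ (2 * k) * exp (- (norm z)\<^sup>2)) \<partial>lborel) = ennreal (pi * fact k)"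
proof -
  interpret hk: homogeneous "\<lambda>z::complex. norm z ^ (2 * k)" "2 * k" by (rule homogeneous_norm_power)
  have r: "hk.rate = real (k + 1)" unfolding hk.rate_def by (simp add: field_simps)
  show ?thesis using hk.nn_integral_gaussian[OF r] unfolding mass_norm_power by (simp add: field_simps)
qed

lemma absmonom_rate: "homogeneous.rate TYPE(complex^'n) (2 * mdeg (a :: 'n \<Rightarrow> nat)) = real (CARD('n) + mdeg a)"
proof -
  interpret homogeneous "absmonom a" "2 * mdeg a" by (rule absmonom_homogeneous)
  show ?thesis unfolding rate_def by (simp add: field_simps)
qed

text \<open>The Gaussian integral of \<open>absmonom a\<close> is computed twice: radially, where it
  contains the unknown \<open>mass\<close>, and coordinatewise, where it factors into planar Gamma
  integrals.\<close>

lemma absmonom_mass: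
  fixes a :: "'n::finite \<Rightarrow> nat"
  shows "homogeneous.mass (absmonom a) = pi ^ CARD('n) * mfact a / fact (CARD('n) + mdeg a)"
proof -
  interpret homogeneous "absmonom a" "2 * mdeg a" by (rule absmonom_homogeneous)
  have "ennreal (fact (CARD('n) + mdeg a) * mass) = (\<integral>\<^sup>+x. ennreal (absmonom a x * exp (- (norm x)\<^sup>2)) \<partial>lborel)"
    by (rule nn_integral_gaussian[OF absmonom_rate, symmetric])
  also have "\<dots> = (\<integral>\<^sup>+x. (\<Prod>i\<in>UNIV. ennreal (norm ((x::complex^'n) $ i) ^ (2 * a i) * exp (- (norm (x $ i))\<^sup>2))) \<partial>lborel)"
  proof (rule nn_integral_cong)
    fix x :: "complex^'n"
    have "(norm x)\<^sup>2 = (\<Sum>i\<in>UNIV. (norm (x $ i))\<^sup>2)" by (simp add: norm_vec_def L2_set_def sum_nonneg)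
    then have "absmonom a x * exp (- (norm x)\<^sup>2) = (\<Prod>i\<in>UNIV. norm (x $ i) ^ (2 * a i) * exp (- (norm (x $ i))\<^sup>2))"
      by (simp add: absmonom_def prod.distrib exp_sum flip: sum_negf)
    then show "ennreal (absmonom a x * exp (- (norm x)\<^sup>2)) = (\<Prod>i\<in>UNIV. ennreal (norm (x $ i) ^ (2 * a i) * exp (- (norm (x $ i))\<^sup>2)))"
      by (simp add: prod_ennreal)
  qed
  also have "\<dots> = (\<Prod>i\<in>UNIV. ennreal (pi * fact (a i)))"
    using nn_integral_vec_prod[of "\<lambda>i z. ennreal (norm (z::complex) ^ (2 * a i) * exp (- (norm z)\<^sup>2))"]
    by (simp add: nn_integral_gaussian_complex)
  also have "\<dots> = ennreal (pi ^ CARD('n) * mfact a)"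
    by (simp add: prod_ennreal prod.distrib mfact_def)
  finally have "fact (CARD('n) + mdeg a) * mass = pi ^ CARD('n) * mfact a"
    using mass_nonneg by (subst (asm) ennreal_inj) (auto intro!: mult_nonneg_nonneg simp: mfact_pos less_imp_le)
  then show ?thesis by (simp add: field_simps)
qed

lemma measure_unit_ball: "measure lebesgue (unit_ball :: (complex^'n) set) = pi ^ CARD('n) / fact (CARD('n::finite))"
proof -
  interpret homogeneous "absmonom (\<lambda>_::'n. 0)" "2 * mdeg (\<lambda>_::'n. 0)" by (rule absmonom_homogeneous)
  have "mass = measure lborel (unit_ball :: (complex^'n) set)"
    by (simp add: mass_def absmonom_def measure_def)
  then show ?thesis using absmonom_mass[of "\<lambda>_::'n. 0"] by (simp add: measure_completion)
qed

lemma zzmonom_measurable [measurable]: "zzmonom m \<in> borel_measurable borel"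
  unfolding zzmonom_def by (intro borel_measurable_continuous_onI continuous_intros)

lemma zzmonom_diag: "zzmonom (a, a) x = of_real (absmonom a x)"
proof -
  have "zzmonom (a, a) x = (\<Prod>j\<in>UNIV. (x $ j * cnj (x $ j)) ^ a j)"
    by (simp add: zzmonom_def power_mult_distrib)
  also have "\<dots> = of_real (absmonom a x)"
    by (simp only: complex_norm_square[symmetric] absmonom_def of_real_prod of_real_power power_mult)
  finally show ?thesis .
qed

lemma integral_zzmonom_offdiag:
  fixes a b :: "'n::finite \<Rightarrow> nat"
  assumes "a \<noteq> b" and [measurable]: "G \<in> borel_measurable borel"
  shows "(\<integral>x. zzmonom (a, b) x * G (logr x) \<partial>lborel) = 0"
proof -
  obtain i where i: "a i \<noteq> b i" using assms by auto
  \<comment> \<open>multiplying the \<open>i\<close>-th coordinate by \<open>c\<close> changes the sign of the integrand\<close>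
  define c where "c = cis (pi / (real (a i) - real (b i)))"
  have c1: "norm c = 1" by (simp add: c_def)
  have "c ^ a i * cnj c ^ b i = cis (real (a i) * (pi / (real (a i) - real (b i))) + real (b i) * (- (pi / (real (a i) - real (b i)))))"
    unfolding c_def cis_cnj Complex.DeMoivre cis_mult ..
  also have "real (a i) * (pi / (real (a i) - real (b i))) + real (b i) * (- (pi / (real (a i) - real (b i))))
      = (real (a i) - real (b i)) * pi / (real (a i) - real (b i))" by (simp add: algebra_simps flip: diff_divide_distrib)
  also have "\<dots> = pi" using i by simp
  finally have cm: "c ^ a i * cnj c ^ b i = -1" by simp
  define T :: "complex^'n \<Rightarrow> complex^'n" where "T x = (\<chi> j. if j = i then c * x $ j else x $ j)" for x
  have lin: "linear T" by (rule linearI) (auto simp: T_def vec_eq_iff algebra_simps)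
  have nT: "norm (T x) = norm x" for x
    unfolding norm_vec_def T_def by (rule L2_set_cong) (auto simp: norm_mult c1)
  have [measurable]: "T \<in> borel_measurable borel"
    using lin linear_continuous_on linear_conv_bounded_linear borel_measurable_continuous_onI by blast
  have "zzmonom (a, b) (T x) = - zzmonom (a, b) x" for x
  proof -
    have "zzmonom (a, b) (T x) = (\<Prod>j\<in>UNIV. (if j = i then -1 else 1) * ((x $ j) ^ a j * cnj (x $ j) ^ b j))"
      unfolding zzmonom_def
    proof (rule prod.cong)
      fix j
      show "T x $ j ^ fst (a, b) j * cnj (T x $ j) ^ snd (a, b) j = (if j = i then - 1 else 1) * (x $ j ^ a j * cnj (x $ j) ^ b j)"
        using cm by (auto simp: T_def power_mult_distrib)
          (metis (no_types, lifting) mult.assoc mult.left_commute mult_minus1)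
    qed simp
    then show ?thesis by (simp add: prod.distrib zzmonom_def)
  qed
  moreover have "logr (T x) = logr x" for x by (simp add: logr_def nT)
  ultimately have eq: "(\<integral>x. zzmonom (a, b) (T x) * G (logr (T x)) \<partial>lborel) = - (\<integral>x. zzmonom (a, b) x * G (logr x) \<partial>lborel)"
    by simp
  have "(\<integral>x. zzmonom (a, b) x * G (logr x) \<partial>lborel) = (\<integral>x. zzmonom (a, b) x * G (logr x) \<partial>distr lborel borel T)"
    by (simp add: distr_lborel_isometry[OF lin nT])
  also have "\<dots> = (\<integral>x. zzmonom (a, b) (T x) * G (logr (T x)) \<partial>lborel)"
    by (rule integral_distr) measurable
  finally show ?thesis using eq by simp
qed

lemma integral_zzmonom_diag:
  fixes a :: "'n::finite \<Rightarrow> nat" and G :: "real \<Rightarrow> complex"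
  assumes [measurable]: "G \<in> borel_measurable borel"
  shows "(\<integral>x. zzmonom (a, a) x * G (logr x) \<partial>lborel)
    = of_real (pi ^ CARD('n) * mfact a / fact (CARD('n) + mdeg a - 1)) * (\<integral>y. of_real (exp (- real (CARD('n) + mdeg a) * y)) * G y \<partial>lborel)"
proof -
  interpret homogeneous "absmonom a" "2 * mdeg a" by (rule absmonom_homogeneous)
  have pos: "CARD('n) + mdeg a > 0" by (simp add: card_gt_0_iff)
  have "(\<integral>x. zzmonom (a, a) x * G (logr x) \<partial>lborel) = (\<integral>y. (mass * rate * exp (- rate * y)) *\<^sub>R G y \<partial>lborel)"
    using integral_radial[of G] by (simp add: zzmonom_diag scaleR_conv_of_real)
  also have "\<dots> = (\<integral>y. of_real (mass * rate) * (of_real (exp (- rate * y)) * G y) \<partial>lborel)"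
    by (simp add: scaleR_conv_of_real mult.assoc)
  also have "\<dots> = of_real (mass * rate) * (\<integral>y. of_real (exp (- rate * y)) * G y \<partial>lborel)"
    by simp
  also have "mass * rate = pi ^ CARD('n) * mfact a / fact (CARD('n) + mdeg a - 1)"
  proof -
    have "real (CARD('n) + mdeg a) / fact (CARD('n) + mdeg a) = 1 / fact (CARD('n) + mdeg a - 1)"
      using pos fact_reduce[OF pos, where 'a=real] by (metis (no_types, lifting) divide_divide_eq_left' div_self of_nat_0_less_iff less_irrefl mult.commute)
    then show ?thesis unfolding absmonom_mass absmonom_rate by (metis times_divide_eq_left times_divide_eq_right mult.right_neutral)
  qed
  finally show ?thesis by (simp only: absmonom_rate)
qed

lemma cmod_zzmonom_le: "cmod (zzmonom (a, b) x) \<le> norm x ^ (mdeg a + mdeg b)"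
proof -
  have "cmod (zzmonom (a, b) x) = (\<Prod>j\<in>UNIV. cmod (x $ j) ^ (a j + b j))"
    by (simp add: zzmonom_def norm_mult norm_power power_add flip: prod_norm)
  also have "\<dots> \<le> (\<Prod>j\<in>UNIV. norm x ^ (a j + b j))"
    by (intro prod_mono) (auto intro!: power_mono Finite_Cartesian_Product.norm_nth_le)
  also have "\<dots> = norm x ^ (mdeg a + mdeg b)" by (simp add: mdeg_def sum.distrib flip: power_sum)
  finally show ?thesis .
qed

section \<open>Bihomogeneous polynomials and the Fischer pairing\<close>

abbreviation up :: "'n \<Rightarrow> ('n \<Rightarrow> nat) \<Rightarrow> 'n \<Rightarrow> nat" where "up i a \<equiv> a(i := a i + 1)"
abbreviation down :: "'n \<Rightarrow> ('n \<Rightarrow> nat) \<Rightarrow> 'n \<Rightarrow> nat" where "down i a \<equiv> a(i := a i - 1)"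

text \<open>On coefficients, \<open>normmul\<close> is multiplication by \<open>|z|^2\<close> and \<open>lap\<close> is the quarter of the
Laplacian; they are adjoint for the Fischer pairing.\<close>

definition normmul :: "'n::finite zzpoly \<Rightarrow> 'n zzpoly" where
  "normmul c = (\<lambda>(a, b). \<Sum>i\<in>UNIV. if 0 < a i \<and> 0 < b i then c (down i a, down i b) else 0)"

definition lap :: "'n::finite zzpoly \<Rightarrow> 'n zzpoly" where
  "lap c = (\<lambda>(a, b). \<Sum>i\<in>UNIV. of_nat ((a i + 1) * (b i + 1)) * c (up i a, up i b))"

definition bideg :: "nat \<Rightarrow> nat \<Rightarrow> 'n::finite biindex set" where
  "bideg k l = {m. mdeg (fst m) = k \<and> mdeg (snd m) = l}"

definition totdeg :: "nat \<Rightarrow> 'n::finite biindex set" where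
  "totdeg n = {m. mdeg (fst m) + mdeg (snd m) = n}"

lemma mdeg_up [simp]: "mdeg (up i a) = mdeg a + 1"
  unfolding mdeg_def by (subst sum.remove[of _ i], simp, simp, subst (2) sum.remove[of _ i]) auto

lemma mdeg_up_Suc [simp]: "mdeg (a(i := Suc (a i))) = Suc (mdeg a)"
  using mdeg_up[of a i] by simp

lemma mdeg_eq_0_iff [simp]: "mdeg a = 0 \<longleftrightarrow> (\<forall>i. a i = 0)"
  by (simp add: mdeg_def)

lemma mfact_up: "mfact (up i a) = real (a i + 1) * mfact a"
  unfolding mfact_def by (subst prod.remove[of _ i], simp, simp, subst (2) prod.remove[of _ i]) auto

lemma finite_mdeg_eq: "finite {a::'n::finite \<Rightarrow> nat. mdeg a = k}"
proof (rule finite_subset)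
  show "{a::'n \<Rightarrow> nat. mdeg a = k} \<subseteq> Pi\<^sub>E UNIV (\<lambda>_. {..k})"
  proof
    fix a :: "'n \<Rightarrow> nat" assume "a \<in> {a. mdeg a = k}"
    then have "a i \<le> k" for i using member_le_sum[of i UNIV a] by (simp add: mdeg_def)
    then show "a \<in> Pi\<^sub>E UNIV (\<lambda>_. {..k})" by (simp add: PiE_iff extensional_def)
  qed
qed (simp add: finite_PiE)

lemma bideg_times: "bideg k l = {a. mdeg a = k} \<times> {b. mdeg b = l}"
  by (auto simp: bideg_def)

lemma finite_bideg [simp]: "finite (bideg k l)"
  by (simp add: bideg_times finite_mdeg_eq)

lemma totdeg_Un: "totdeg n = (\<Union>k\<le>n. bideg k (n - k))"
  by (auto simp: totdeg_def bideg_def)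

lemma finite_totdeg [simp]: "finite (totdeg n)"
  unfolding totdeg_Un by (intro finite_UN_I finite_bideg finite_atMost)

lemma sum_totdeg: "(\<Sum>m\<in>totdeg n. g m) = (\<Sum>k\<le>n. \<Sum>m\<in>bideg k (n - k). g m)"
  unfolding totdeg_Un by (rule sum.UNION_disjoint) (simp_all, auto simp: bideg_def)

lemma bideg_up: "(up i a, up i b) \<in> bideg (Suc k) (Suc l) \<longleftrightarrow> (a, b) \<in> bideg k l"
  by (simp add: bideg_def)

lemma totdeg_up: "(up i a, up i b) \<in> totdeg (n + 2) \<longleftrightarrow> (a, b) \<in> totdeg n"
  by (simp add: totdeg_def)

lemma down_up: "down i (up i a) = a"
  by auto

lemma up_down: "0 < a i \<Longrightarrow> up i (down i a) = a"
  by auto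

text \<open>One reindexing serves two purposes: with \<open>W\<close> a Fischer weight times a
  conjugate coefficient it yields adjointness to \<open>lap\<close>, and with \<open>W\<close> a
  monomial value it shows that \<open>normmul\<close> multiplies by |z|^2.\<close>

lemma sum_normmul:
  fixes W :: "'n::finite zzpoly"
  assumes fin: "finite S" "finite S'" and S: "\<And>a b i. (up i a, up i b) \<in> S' \<longleftrightarrow> (a, b) \<in> S"
  shows "(\<Sum>m\<in>S'. normmul c m * W m) = (\<Sum>(a, b)\<in>S. c (a, b) * (\<Sum>i\<in>UNIV. W (up i a, up i b)))"
proof -
  let ?g = "\<lambda>i (a, b). if 0 < a i \<and> 0 < b i then c (down i a, down i b) else 0"
  have "(\<Sum>m\<in>S'. normmul c m * W m) = (\<Sum>m\<in>S'. \<Sum>i\<in>UNIV. ?g i m * W m)"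
    by (intro sum.cong refl) (auto simp: normmul_def sum_distrib_right)
  also have "\<dots> = (\<Sum>i\<in>UNIV. \<Sum>m\<in>S'. ?g i m * W m)" by (rule sum.swap)
  also have "\<dots> = (\<Sum>i\<in>UNIV. \<Sum>(a, b)\<in>S. c (a, b) * W (up i a, up i b))"
  proof (rule sum.cong)
    fix i :: 'n
    let ?S = "{m\<in>S'. 0 < fst m i \<and> 0 < snd m i}"
    have "(\<Sum>m\<in>S'. ?g i m * W m) = (\<Sum>m\<in>?S. ?g i m * W m)"
      using fin by (intro sum.mono_neutral_right) (auto split: prod.splits)
    also have "\<dots> = (\<Sum>(a, b)\<in>S. c (a, b) * W (up i a, up i b))"
    proof (rule sum.reindex_bij_witness[of _ "\<lambda>(a, b). (up i a, up i b)" "\<lambda>(a, b). (down i a, down i b)"])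
      fix m assume m: "m \<in> ?S"
      obtain a b where ab: "m = (a, b)" by (cases m)
      have ud: "up i (down i a) = a" "up i (down i b) = b" using m ab by (auto intro!: up_down)
      show "(case (case m of (a, b) \<Rightarrow> (down i a, down i b)) of (a, b) \<Rightarrow> (up i a, up i b)) = m"
        using ud ab by (simp only: prod.case)
      show "(case m of (a, b) \<Rightarrow> (down i a, down i b)) \<in> S"
        using m S[where a="down i a" and b="down i b" and i=i] unfolding ab prod.case ud by simp
      show "(case case m of (a, b) \<Rightarrow> (down i a, down i b) of (a, b) \<Rightarrow> c (a, b) * W (up i a, up i b)) = ?g i m * W m"
        using m unfolding ab prod.case ud by simp
    next
      fix m assume m: "m \<in> S"
      obtain a b where ab: "m = (a, b)" by (cases m)
      show "(case case m of (a, b) \<Rightarrow> (up i a, up i b) of (a, b) \<Rightarrow> (down i a, down i b)) = m"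
        unfolding ab prod.case down_up ..
      show "(case m of (a, b) \<Rightarrow> (up i a, up i b)) \<in> ?S"
        using m S[where a=a and b=b and i=i] unfolding ab prod.case by simp
    qed
    finally show "(\<Sum>m\<in>S'. ?g i m * W m) = (\<Sum>(a, b)\<in>S. c (a, b) * W (up i a, up i b))" .
  qed simp
  also have "\<dots> = (\<Sum>(a, b)\<in>S. c (a, b) * (\<Sum>i\<in>UNIV. W (up i a, up i b)))"
    by (subst sum.swap) (auto simp: sum_distrib_left intro!: sum.cong)
  finally show ?thesis .
qed

text \<open>The commutator of the Laplacian with |z|^2. The contributions \<open>E i j\<close> of
  distinct directions cancel; on the diagonal (a_i + 1)(b_i + 1) - a_i b_i = a_i + b_i + 1 remains
  and sums to N + |a| + |b|.\<close>

lemma lap_normmul: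
  fixes c :: "'n::finite zzpoly"
  shows "lap (normmul c) (a, b) = normmul (lap c) (a, b) + of_nat (CARD('n) + mdeg a + mdeg b) * c (a, b)"
proof -
  define E where "E i j = (if 0 < a j \<and> 0 < b j then of_nat ((a i + 1) * (b i + 1)) * c ((up i a)(j := a j - 1), (up i b)(j := b j - 1)) else 0)" for i j
  have 1: "lap (normmul c) (a, b) = (\<Sum>i\<in>UNIV. \<Sum>j\<in>UNIV. if i = j then of_nat ((a i + 1) * (b i + 1)) * c (a, b) else E i j)"
    unfolding lap_def normmul_def prod.case sum_distrib_left
    by (intro sum.cong refl) (auto simp: E_def)
  have 2: "normmul (lap c) (a, b) = (\<Sum>j\<in>UNIV. \<Sum>i\<in>UNIV. if i = j then of_nat (a i * b i) * c (a, b) else E i j)"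
    unfolding normmul_def prod.case
  proof (rule sum.cong)
    fix j :: 'n
    show "(if 0 < a j \<and> 0 < b j then lap c (down j a, down j b) else 0)
      = (\<Sum>i\<in>UNIV. if i = j then of_nat (a i * b i) * c (a, b) else E i j)"
    proof (cases "0 < a j \<and> 0 < b j")
      case True
      then have ud: "up j (down j a) = a" "up j (down j b) = b" by (auto intro!: up_down)
      have "of_nat ((down j a i + 1) * (down j b i + 1)) * c (up i (down j a), up i (down j b))
        = (if i = j then of_nat (a i * b i) * c (a, b) else E i j)" for i
      proof (cases "i = j")
        case i: True
        show ?thesis unfolding i ud using True by simp
      next
        case False
        then have "up i (down j a) = (up i a)(j := a j - 1)" "up i (down j b) = (up i b)(j := b j - 1)" by auto
        then show ?thesis using False True by (simp add: E_def)
      qed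
      then show ?thesis using True by (simp add: lap_def)
    next
      case False
      then have "(if i = j then of_nat (a i * b i) * c (a, b) else E i j) = 0" for i
        by (auto simp: E_def)
      then show ?thesis by (simp only: False if_False sum.neutral_const)
    qed
  qed simp
  have 3: "(\<Sum>i\<in>UNIV. \<Sum>j\<in>UNIV. if i = j then of_nat ((a i + 1) * (b i + 1)) * c (a, b) else E i j)
     = (\<Sum>i\<in>UNIV. \<Sum>j\<in>UNIV. (if i = j then of_nat (a i * b i) * c (a, b) else E i j) + (if i = j then of_nat (a i + b i + 1) * c (a, b) else 0))"
    by (intro sum.cong refl) (auto simp: algebra_simps)
  have 4: "(\<Sum>i\<in>UNIV. \<Sum>j\<in>UNIV. if i = j then of_nat (a i + b i + 1) * c (a, b) else 0) = of_nat (CARD('n) + mdeg a + mdeg b) * c (a, b)"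
  proof -
    have "(\<Sum>i\<in>UNIV. a i + b i + 1) = CARD('n) + mdeg a + mdeg b"
      unfolding sum.distrib by (simp add: mdeg_def)
    then have "of_nat (CARD('n) + mdeg a + mdeg b) * c (a, b) = (\<Sum>i\<in>UNIV. of_nat (a i + b i + 1) * c (a, b))"
      by (metis of_nat_sum sum_distrib_right)
    then show ?thesis by simp
  qed
  show ?thesis unfolding 1 2 3 sum.distrib 4 by (subst sum.swap) simp
qed

lemma normmul_scale: "normmul (\<lambda>m. x * c m) = (\<lambda>m. x * normmul c m)"
  by (auto simp: normmul_def sum_distrib_left fun_eq_iff intro!: sum.cong)

lemma normmul_zero: "normmul (\<lambda>m. 0) = (\<lambda>m. 0)"
  by (auto simp: normmul_def)

definition is_bihom :: "nat \<Rightarrow> nat \<Rightarrow> 'n::finite zzpoly \<Rightarrow> bool" where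
  "is_bihom k l c \<longleftrightarrow> (\<forall>m. c m \<noteq> 0 \<longrightarrow> m \<in> bideg k l)"

lemma mdeg_down: "0 < a i \<Longrightarrow> mdeg (down i a) + 1 = mdeg a"
  using mdeg_up[where i=i and a="down i a"] up_down[of a i] by simp

lemma is_bihom_normmul: "is_bihom k l c \<Longrightarrow> is_bihom (k + 1) (l + 1) (normmul c)"
  unfolding is_bihom_def[of "k + 1"]
proof (intro allI impI)
  fix m assume c: "is_bihom k l c" and "normmul c m \<noteq> 0"
  then obtain i where i: "0 < fst m i" "0 < snd m i" "c (down i (fst m), down i (snd m)) \<noteq> 0"
    by (auto simp: normmul_def split: prod.splits if_splits elim!: sum.not_neutral_contains_not_neutral)
  then have "(down i (fst m), down i (snd m)) \<in> bideg k l" using c by (auto simp: is_bihom_def)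
  then show "m \<in> bideg (k + 1) (l + 1)"
    using mdeg_down[of "fst m" i] mdeg_down[of "snd m" i] i by (simp add: bideg_def)
qed

lemma is_bihom_normmul_pow: "is_bihom k l c \<Longrightarrow> is_bihom (k + j) (l + j) ((normmul ^^ j) c)"
  by (induction j) (use is_bihom_normmul in force)+

lemma is_bihom_lap:
  assumes "is_bihom k l c" shows "is_bihom (k - 1) (l - 1) (lap c)"
  unfolding is_bihom_def
proof (intro allI impI)
  fix m assume "lap c m \<noteq> 0"
  then obtain i where "c (up i (fst m), up i (snd m)) \<noteq> 0"
    by (auto simp: lap_def split: prod.splits elim!: sum.not_neutral_contains_not_neutral)
  then have "(up i (fst m), up i (snd m)) \<in> bideg k l" using assms by (auto simp: is_bihom_def)
  then show "m \<in> bideg (k - 1) (l - 1)" by (auto simp: bideg_def)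
qed

lemma lap_bihom_zero:
  assumes "is_bihom k l c" "k = 0 \<or> l = 0" shows "lap c = (\<lambda>m. 0)"
proof (rule ccontr)
  assume "lap c \<noteq> (\<lambda>m. 0)"
  then obtain m where "lap c m \<noteq> 0" by fast
  then obtain i where "c (up i (fst m), up i (snd m)) \<noteq> 0"
    by (auto simp: lap_def split: prod.splits elim!: sum.not_neutral_contains_not_neutral)
  then have "(up i (fst m), up i (snd m)) \<in> bideg k l" using assms by (auto simp: is_bihom_def)
  then show False using assms(2) by (auto simp: bideg_def)
qed

text \<open>Each commutation past one factor |z|^2 adds N + p + q + 2i for i = 0, ..., j, and these
  numbers add up to (j + 1)(N + p + q + j); the last term dies because \<open>P\<close> is
  harmonic.\<close>

lemma lap_normmul_pow:
  fixes P :: "'n::finite zzpoly"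
  assumes P: "is_bihom p q P" "lap P = (\<lambda>m. 0)"
  shows "lap ((normmul ^^ Suc j) P) = (\<lambda>m. of_nat (Suc j * (CARD('n) + p + q + j)) * (normmul ^^ j) P m)"
proof (induction j)
  case 0
  show ?case
  proof
    fix m :: "'n biindex"
    obtain a b where m: "m = (a, b)" by (cases m)
    show "lap ((normmul ^^ Suc 0) P) m = of_nat (Suc 0 * (CARD('n) + p + q + 0)) * (normmul ^^ 0) P m"
      using P by (cases "P (a, b) = 0") (auto simp: m lap_normmul normmul_zero is_bihom_def bideg_def)
  qed
next
  case (Suc j)
  let ?Q = "(normmul ^^ Suc j) P"
  have hQ: "is_bihom (p + Suc j) (q + Suc j) ?Q" using is_bihom_normmul_pow[OF P(1)] .
  show ?case
  proof
    fix m :: "'n biindex"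
    obtain a b where m: "m = (a, b)" by (cases m)
    have "lap ((normmul ^^ Suc (Suc j)) P) m = normmul (lap ?Q) m + of_nat (CARD('n) + mdeg a + mdeg b) * ?Q m"
      using lap_normmul[of ?Q a b] by (simp add: m)
    also have "normmul (lap ?Q) m = of_nat (Suc j * (CARD('n) + p + q + j)) * ?Q m"
      unfolding Suc.IH normmul_scale by simp
    also have "of_nat (CARD('n) + mdeg a + mdeg b) * ?Q m = of_nat (CARD('n) + p + q + 2 * Suc j) * ?Q m"
      using hQ by (cases "?Q m = 0") (auto simp: is_bihom_def bideg_def m)
    finally show "lap ((normmul ^^ Suc (Suc j)) P) m = of_nat (Suc (Suc j) * (CARD('n) + p + q + Suc j)) * ?Q m"
      by (simp add: algebra_simps del: funpow.simps)
  qed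
qed

definition fischer :: "nat \<Rightarrow> nat \<Rightarrow> 'n::finite zzpoly \<Rightarrow> 'n zzpoly \<Rightarrow> complex" where
  "fischer k l c d = (\<Sum>m\<in>bideg k l. of_real (mfact (fst m) * mfact (snd m)) * c m * cnj (d m))"

text \<open>The factorial weights do the work: raising an index multiplies \<open>mfact\<close> by
  a_i + 1, which is the factor that differentiation produces in \<open>lap\<close>.\<close>

lemma fischer_adjoint:
  fixes c d :: "'a::finite zzpoly"
  shows "fischer (Suc k) (Suc l) (normmul c) d = fischer k l c (lap d)"
proof -
  have "fischer (Suc k) (Suc l) (normmul c) d
     = (\<Sum>m\<in>bideg (Suc k) (Suc l). normmul c m * (of_real (mfact (fst m) * mfact (snd m)) * cnj (d m)))"
    by (simp add: fischer_def mult_ac)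
  also have "\<dots> = (\<Sum>(a, b)\<in>bideg k l. c (a, b) * (\<Sum>i\<in>UNIV. of_real (mfact (up i a) * mfact (up i b)) * cnj (d (up i a, up i b))))"
    by (subst sum_normmul[of "bideg k l"]) (simp_all only: finite_bideg fst_conv snd_conv, simp add: bideg_def)
  also have "\<dots> = fischer k l c (lap d)"
    unfolding fischer_def
  proof (rule sum.cong, simp, clarify)
    fix a b :: "'a \<Rightarrow> nat"
    have "(\<Sum>i\<in>UNIV. of_real (mfact (up i a) * mfact (up i b)) * cnj (d (up i a, up i b)))
       = (\<Sum>i\<in>UNIV. of_real (mfact a * mfact b) * cnj (of_nat ((a i + 1) * (b i + 1)) * d (up i a, up i b)))"
      by (intro sum.cong refl) (simp only: mfact_up of_real_mult of_real_of_nat_eq of_nat_mult complex_cnj_mult complex_cnj_of_nat mult_ac)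
    also have "\<dots> = of_real (mfact a * mfact b) * cnj (lap d (a, b))"
      by (simp add: lap_def sum_distrib_left)
    finally show "c (a, b) * (\<Sum>i\<in>UNIV. of_real (mfact (up i a) * mfact (up i b)) * cnj (d (up i a, up i b)))
      = of_real (mfact (fst (a, b)) * mfact (snd (a, b))) * c (a, b) * cnj (lap d (a, b))"
      by (simp add: mult_ac)
  qed
  finally show ?thesis .
qed

lemma normmul_mdeg_0:
  assumes "mdeg (fst m) = 0 \<or> mdeg (snd m) = 0" shows "normmul c m = 0"
proof -
  have "\<not> (0 < fst m i \<and> 0 < snd m i)" for i using assms by auto
  then show ?thesis unfolding normmul_def case_prod_unfold by (simp only: if_False sum.neutral_const)
qed

lemma fischer_normmul_0: "k = 0 \<or> l = 0 \<Longrightarrow> fischer k l (normmul c) d = 0"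
  unfolding fischer_def by (rule sum.neutral) (auto simp: bideg_def normmul_mdeg_0 simp del: mdeg_eq_0_iff)

lemma fischer_cnj: "fischer k l d c = cnj (fischer k l c d)"
  by (simp add: fischer_def mult_ac)

lemma fischer_scale_right: "fischer k l c (\<lambda>m. x * d m) = cnj x * fischer k l c d"
  by (simp add: fischer_def sum_distrib_left mult_ac)

lemma fischer_zero_right: "fischer k l c (\<lambda>m. 0) = 0"
  by (simp add: fischer_def)

lemma fischer_adjoint_pow: "fischer (k + j) (l + j) ((normmul ^^ j) c) d = fischer k l c ((lap ^^ j) d)"
proof (induction j arbitrary: d)
  case (Suc j)
  have "fischer (k + Suc j) (l + Suc j) ((normmul ^^ Suc j) c) d = fischer (k + j) (l + j) ((normmul ^^ j) c) (lap d)"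
    by (simp add: fischer_adjoint)
  then show ?case using Suc[of "lap d"] by (simp add: funpow_swap1)
qed simp

lemma fischer_pos:
  assumes "is_bihom k l c" "c \<noteq> (\<lambda>m. 0)" shows "fischer k l c c \<noteq> 0"
proof -
  have "\<exists>m. c m \<noteq> 0"
  proof (rule ccontr)
    assume "\<nexists>m. c m \<noteq> 0"
    then have "c = (\<lambda>m. 0)" by (intro ext) blast
    then show False using assms(2) by simp
  qed
  then obtain m where m: "c m \<noteq> 0" ..
  then have mb: "m \<in> bideg k l" by (rule assms(1)[unfolded is_bihom_def, rule_format])
  have "fischer k l c c = of_real (\<Sum>m\<in>bideg k l. mfact (fst m) * mfact (snd m) * (cmod (c m))\<^sup>2)"
    unfolding fischer_def of_real_sum by (intro sum.cong refl) (simp only: of_real_mult complex_norm_square mult.assoc)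
  moreover have "(\<Sum>m\<in>bideg k l. mfact (fst m) * mfact (snd m) * (cmod (c m))\<^sup>2) > 0"
  proof (rule sum_pos2[OF finite_bideg mb])
    show "0 < mfact (fst m) * mfact (snd m) * (cmod (c m))\<^sup>2" using m by (simp add: mfact_pos)
    show "0 \<le> mfact (fst i) * mfact (snd i) * (cmod (c i))\<^sup>2" for i
      using mfact_pos[of "fst i"] mfact_pos[of "snd i"] by simp
  qed
  ultimately show ?thesis unfolding of_real_eq_0_iff using less_imp_neq[symmetric] by (auto simp only: of_real_eq_0_iff)
qed

text \<open>Factors |z|^2 are moved from the left to the right one at a time. Each becomes
  \<open>lap\<close> and lowers the power of |z|^2 on \<open>P\<close> from j to j - 1 at the cost
  of j (N - 1 + p + q + j); the factorial quotient is the product of these costs. If i > j the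
  harmonic \<open>P\<close> itself is hit, and the pairing vanishes.\<close>

lemma fischer_pow_pow:
  fixes P :: "'n::finite zzpoly"
  assumes P: "is_bihom p q P" "lap P = (\<lambda>m. 0)"
  shows "fischer (p + j) (q + j) ((normmul ^^ i) f) ((normmul ^^ j) P) =
    (if i \<le> j then of_real (fact j * fact (CARD('n) - 1 + p + q + j) / (fact (j - i) * fact (CARD('n) - 1 + p + q + j - i)))
        * fischer (p + j - i) (q + j - i) f ((normmul ^^ (j - i)) P) else 0)"
proof (induction i arbitrary: j)
  case 0
  then show ?case by simp
next
  case (Suc i)
  show ?case
  proof (cases j)
    case 0
    show ?thesis
    \<comment> \<open>\<open>fischer_adjoint\<close> needs both degrees to be successors. If one of
      them is 0, the image of \<open>normmul\<close> has no component there and the pairing vanishes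
      for that reason.\<close>
    proof (cases "p = 0 \<or> q = 0")
      case True
      then show ?thesis using 0 by (auto simp: fischer_normmul_0)
    next
      case False
      then obtain p' q' where pq: "p = Suc p'" "q = Suc q'" by (metis not0_implies_Suc)
      show ?thesis using P(2) by (simp add: 0 pq fischer_adjoint fischer_zero_right)
    qed
  next
    case (Suc j')
    let ?N = "CARD('n) - 1"
    obtain N' where N: "CARD('n) = Suc N'" by (metis card_gt_0_iff finite UNIV_not_empty gr0_implies_Suc)
    have "fischer (p + j) (q + j) ((normmul ^^ Suc i) f) ((normmul ^^ j) P)
       = fischer (p + j') (q + j') ((normmul ^^ i) f) (lap ((normmul ^^ Suc j') P))"
      by (simp add: Suc fischer_adjoint)
    also have "\<dots> = of_nat (Suc j' * (CARD('n) + p + q + j')) * fischer (p + j') (q + j') ((normmul ^^ i) f) ((normmul ^^ j') P)"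
      unfolding lap_normmul_pow[OF P] fischer_scale_right by simp
    also have "\<dots> = (if i \<le> j' then of_nat (Suc j' * (CARD('n) + p + q + j')) *
       (of_real (fact j' * fact (?N + p + q + j') / (fact (j' - i) * fact (?N + p + q + j' - i)))
        * fischer (p + j' - i) (q + j' - i) f ((normmul ^^ (j' - i)) P)) else 0)"
      by (simp add: Suc.IH)
    finally have eq: "fischer (p + j) (q + j) ((normmul ^^ Suc i) f) ((normmul ^^ j) P) = \<dots>" .
    have f1: "fact j * fact (?N + p + q + j) = (real (Suc j' * (CARD('n) + p + q + j')) * (fact j' * fact (?N + p + q + j')))"
      by (simp add: N Suc algebra_simps)
    show ?thesis
    proof (cases "i \<le> j'")
      case True
      have e: "j - Suc i = j' - i" "?N + p + q + j - Suc i = ?N + p + q + j' - i" "p + j - Suc i = p + j' - i" "q + j - Suc i = q + j' - i" "Suc i \<le> j"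
        using True Suc by auto
      show ?thesis unfolding eq e f1 using True by (simp add: e Suc)
    next
      case False
      then show ?thesis using Suc eq by simp
    qed
  qed
qed

lemma zzmonom_up: "zzmonom (up i a, up i b) z = z $ i * cnj (z $ i) * zzmonom (a, b) z"
  by (simp add: zzmonom_def, subst (1 2) prod.remove[of _ i]) (auto intro!: prod.cong)

lemma cnj_inner_self: "(\<Sum>i\<in>UNIV. z $ i * cnj (z $ i)) = of_real ((norm z)\<^sup>2)" for z :: "complex^'n"
proof -
  have "(\<Sum>i\<in>UNIV. z $ i * cnj (z $ i)) = of_real (\<Sum>i\<in>UNIV. (norm (z $ i))\<^sup>2)"
    by (simp only: of_real_sum complex_norm_square)
  also have "(\<Sum>i\<in>UNIV. (norm (z $ i))\<^sup>2) = (norm z)\<^sup>2"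
    by (simp add: norm_vec_def L2_set_def sum_nonneg)
  finally show ?thesis .
qed

lemma sum_normmul_zzmonom:
  assumes "finite S" "finite S'" "\<And>a b i. (up i a, up i b) \<in> S' \<longleftrightarrow> (a, b) \<in> S"
  shows "(\<Sum>m\<in>S'. normmul c m * zzmonom m z) = of_real ((norm z)\<^sup>2) * (\<Sum>m\<in>S. c m * zzmonom m z)"
proof -
  have "(\<Sum>m\<in>S'. normmul c m * zzmonom m z) = (\<Sum>(a, b)\<in>S. c (a, b) * (\<Sum>i\<in>UNIV. z $ i * cnj (z $ i) * zzmonom (a, b) z))"
    using sum_normmul[OF assms, of c "\<lambda>m. zzmonom m z"] by (simp only: zzmonom_up)
  also have "\<dots> = (\<Sum>(a, b)\<in>S. c (a, b) * (of_real ((norm z)\<^sup>2) * zzmonom (a, b) z))"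
    unfolding sum_distrib_right[symmetric] cnj_inner_self ..
  finally show ?thesis by (simp add: sum_distrib_left case_prod_unfold mult_ac)
qed

definition heval :: "nat \<Rightarrow> nat \<Rightarrow> 'n::finite zzpoly \<Rightarrow> complex^'n \<Rightarrow> complex" where
  "heval k l c z = (\<Sum>m\<in>bideg k l. c m * zzmonom m z)"

lemma heval_normmul_pow: "heval (k + j) (l + j) ((normmul ^^ j) c) z = of_real ((norm z) ^ (2 * j)) * heval k l c z"
proof (induction j)
  case (Suc j)
  have "heval (k + Suc j) (l + Suc j) ((normmul ^^ Suc j) c) z = of_real ((norm z)\<^sup>2) * heval (k + j) (l + j) ((normmul ^^ j) c) z"
    unfolding heval_def add_Suc_right funpow.simps comp_apply
    by (rule sum_normmul_zzmonom[OF finite_bideg finite_bideg bideg_up])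
  then show ?case by (simp add: Suc power_add mult_ac power2_eq_square)
qed simp

definition teval :: "nat \<Rightarrow> 'n::finite zzpoly \<Rightarrow> complex^'n \<Rightarrow> complex" where
  "teval n c z = (\<Sum>m\<in>totdeg n. c m * zzmonom m z)"

lemma teval_normmul: "teval (n + 2) (normmul c) z = of_real ((norm z)\<^sup>2) * teval n c z"
  unfolding teval_def by (rule sum_normmul_zzmonom[OF finite_totdeg finite_totdeg totdeg_up])

lemma teval_normmul_less_2: "n < 2 \<Longrightarrow> teval n (normmul c) z = 0"
proof -
  assume n: "n < 2"
  have "normmul c m = 0" if "m \<in> totdeg n" for m
  proof (rule ccontr)
    assume "normmul c m \<noteq> 0"
    then obtain i where i: "0 < fst m i" "0 < snd m i"
      by (auto simp: normmul_def split: prod.splits if_splits elim!: sum.not_neutral_contains_not_neutral)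
    then have "mdeg (fst m) \<ge> 1" "mdeg (snd m) \<ge> 1"
      using member_le_sum[of i UNIV "fst m"] member_le_sum[of i UNIV "snd m"] by (auto simp: mdeg_def)
    then show False using that n by (auto simp: totdeg_def)
  qed
  then show ?thesis by (simp add: teval_def)
qed

lemma teval_normmul_pow: "teval n ((normmul ^^ j) c) z = (if 2 * j \<le> n then of_real (norm z ^ (2 * j)) * teval (n - 2 * j) c z else 0)"
proof (induction j arbitrary: n)
  case (Suc j)
  show ?case
  proof (cases "n < 2")
    case True then show ?thesis by (simp add: teval_normmul_less_2)
  next
    case False
    then obtain n' where n: "n = n' + 2" by (metis add.commute le_Suc_ex not_less)
    show ?thesis by (simp add: n teval_normmul[simplified] Suc power_add mult_ac power2_eq_square)
  qed
qed simp

section \<open>Multinomial expansion and uniqueness of coefficients in z and its conjugate\<close>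

lemma mdeg_0_set: "{a::'n::finite \<Rightarrow> nat. mdeg a = 0} = {\<lambda>_. 0}"
  by (auto simp: fun_eq_iff)

lemma multinomial:
  fixes x :: "'n::finite \<Rightarrow> complex"
  shows "(\<Sum>i\<in>UNIV. x i) ^ k = (\<Sum>a | mdeg a = k. of_real (fact k / mfact a) * (\<Prod>i\<in>UNIV. x i ^ a i))"
proof (induction k)
  case 0
  show ?case unfolding mdeg_0_set by simp
next
  case (Suc k)
  have xup: "(\<Prod>j\<in>UNIV. x j ^ up i a j) = x i * (\<Prod>j\<in>UNIV. x j ^ a j)" for i a
    by (subst (1 2) prod.remove[of _ i]) (auto intro!: prod.cong)
  have "(\<Sum>i\<in>UNIV. x i) ^ Suc k = (\<Sum>i\<in>UNIV. x i) * (\<Sum>a | mdeg a = k. of_real (fact k / mfact a) * (\<Prod>i\<in>UNIV. x i ^ a i))"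
    by (simp add: Suc)
  also have "\<dots> = (\<Sum>i\<in>UNIV. \<Sum>a | mdeg a = k. of_real (fact k / mfact a) * (x i * (\<Prod>j\<in>UNIV. x j ^ a j)))"
    unfolding sum_product by (intro sum.cong refl) (simp add: mult_ac)
  also have "\<dots> = (\<Sum>i\<in>UNIV. \<Sum>a | mdeg a = Suc k. of_real (fact k / mfact a) * of_nat (a i) * (\<Prod>j\<in>UNIV. x j ^ a j))"
  proof (rule sum.cong)
    fix i :: 'n
    have "(\<Sum>a | mdeg a = Suc k. of_real (fact k / mfact a) * of_nat (a i) * (\<Prod>j\<in>UNIV. x j ^ a j))
      = (\<Sum>a | mdeg a = Suc k \<and> 0 < a i. of_real (fact k / mfact a) * of_nat (a i) * (\<Prod>j\<in>UNIV. x j ^ a j))"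
      by (rule sum.mono_neutral_right) (auto simp: finite_mdeg_eq)
    also have "\<dots> = (\<Sum>a | mdeg a = k. of_real (fact k / mfact a) * (x i * (\<Prod>j\<in>UNIV. x j ^ a j)))"
    proof (rule sum.reindex_bij_witness[of _ "up i" "down i"])
      fix a assume a: "a \<in> {a. mdeg a = Suc k \<and> 0 < a i}"
      then show ud: "up i (down i a) = a" by (intro up_down) auto
      show "down i a \<in> {a. mdeg a = k}" using a mdeg_down[of a i] by simp
      have "of_real (fact k / mfact a) * of_nat (a i) = (of_real (fact k / mfact (down i a)) :: complex)"
      proof -
        have "mfact a = real (a i) * mfact (down i a)" using mfact_up[of "down i a" i] a unfolding ud by simp
        then have "fact k / mfact a * real (a i) = fact k / mfact (down i a)" using a by simp
        then show ?thesis by (metis of_real_mult of_real_of_nat_eq)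
      qed
      then show "of_real (fact k / mfact (down i a)) * (x i * (\<Prod>j\<in>UNIV. x j ^ down i a j))
        = of_real (fact k / mfact a) * of_nat (a i) * (\<Prod>j\<in>UNIV. x j ^ a j)"
        using xup[of "down i a" i] unfolding ud by simp
    qed (auto simp: down_up)
    finally show "(\<Sum>a | mdeg a = k. of_real (fact k / mfact a) * (x i * (\<Prod>j\<in>UNIV. x j ^ a j)))
      = (\<Sum>a | mdeg a = Suc k. of_real (fact k / mfact a) * of_nat (a i) * (\<Prod>j\<in>UNIV. x j ^ a j))" by simp
  qed simp
  also have "\<dots> = (\<Sum>a | mdeg a = Suc k. of_real (fact k / mfact a) * (\<Sum>i\<in>UNIV. of_nat (a i)) * (\<Prod>j\<in>UNIV. x j ^ a j))"
    by (subst sum.swap) (simp add: sum_distrib_left sum_distrib_right)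
  also have "\<dots> = (\<Sum>a | mdeg a = Suc k. of_real (fact (Suc k) / mfact a) * (\<Prod>j\<in>UNIV. x j ^ a j))"
  proof (rule sum.cong)
    fix a :: "'n \<Rightarrow> nat" assume "a \<in> {a. mdeg a = Suc k}"
    then have "(\<Sum>i\<in>UNIV. of_nat (a i)) = (of_nat (Suc k) :: complex)" by (simp add: mdeg_def flip: of_nat_sum)
    then show "of_real (fact k / mfact a) * (\<Sum>i\<in>UNIV. of_nat (a i)) * (\<Prod>j\<in>UNIV. x j ^ a j)
      = of_real (fact (Suc k) / mfact a) * (\<Prod>j\<in>UNIV. x j ^ a j)" by (simp add: field_simps)
  qed simp
  finally show ?case .
qed

lemma cinner_power_power:
  "cinner z w ^ k * cnj (cinner z w) ^ l
    = (\<Sum>m\<in>bideg k l. of_real (fact k * fact l / (mfact (fst m) * mfact (snd m))) * zzmonom m z * cnj (zzmonom m w))"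
proof -
  have c: "cinner z w ^ k = (\<Sum>a | mdeg a = k. of_real (fact k / mfact a) * (\<Prod>i\<in>UNIV. (z $ i * cnj (w $ i)) ^ a i))" for k
    unfolding cinner_def by (rule multinomial)
  show ?thesis
    unfolding c bideg_times complex_cnj_power[symmetric] sum_product sum.cartesian_product cnj_sum
    by (intro sum.cong refl) (auto simp: zzmonom_def power_mult_distrib prod.distrib mult_ac)
qed

lemma infinite_unit_circle: "infinite {z::complex. norm z = 1}"
proof
  assume fin: "finite {z::complex. norm z = 1}"
  have "inj_on (\<lambda>x. Complex x (sqrt (1 - x\<^sup>2))) {0..1}" by (auto simp: inj_on_def)
  moreover have "(\<lambda>x. Complex x (sqrt (1 - x\<^sup>2))) ` {0..1} \<subseteq> {z. norm z = 1}"
    by (auto simp: cmod_def abs_square_le_1 power_le_one)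
  ultimately have "finite {0..1::real}" using fin by (meson finite_imageD finite_subset)
  then show False using infinite_Icc[of "0::real" 1] by simp
qed

text \<open>Real dilations separate the total degrees \<open>n\<close>. Within one total degree,
  restriction to the unit circle turns the relation into an ordinary polynomial \<open>r\<close>
  with infinitely many zeros.\<close>

lemma zz_poly_one_var:
  fixes d :: "nat \<times> nat \<Rightarrow> complex"
  assumes F: "finite F" and z: "\<And>x. (\<Sum>p\<in>F. d p * (x ^ fst p * cnj x ^ snd p)) = 0" and p: "p \<in> F"
  shows "d p = 0"
proof -
  define n where "n = fst p + snd p"
  have hom: "(\<Sum>p\<in>{p\<in>F. fst p + snd p = n}. d p * (w ^ fst p * cnj w ^ snd p)) = 0" for w
  proof -
    define q where "q = (\<Sum>p\<in>F. monom (d p * (w ^ fst p * cnj w ^ snd p)) (fst p + snd p))"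
    have "poly q (of_real x) = 0" for x :: real
    proof -
      have "poly q (of_real x) = (\<Sum>p\<in>F. d p * ((of_real x * w) ^ fst p * cnj (of_real x * w) ^ snd p))"
        unfolding q_def poly_sum by (intro sum.cong refl) (simp add: poly_monom power_add power_mult_distrib mult_ac)
      then show ?thesis by (simp only: z)
    qed
    then have "range (of_real :: real \<Rightarrow> complex) \<subseteq> {x. poly q x = 0}" by auto
    moreover have "infinite (range (of_real :: real \<Rightarrow> complex))"
      by (simp add: finite_image_iff inj_of_real infinite_UNIV_char_0)
    ultimately have "q = 0" using poly_roots_finite[of q] finite_subset by blast
    then have "coeff q n = 0" by simp
    then show ?thesis using F by (simp add: q_def coeff_sum sum.If_cases Int_def if_distrib cong: if_cong)
  qed
  define r where "r = (\<Sum>p\<in>{p\<in>F. fst p + snd p = n}. monom (d p) (fst p))"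
  have "poly r v = 0" if v: "norm v = 1" for v
  proof -
    \<comment> \<open>For |w| = 1 and i + j = n one has w^n w^i conj(w)^j = w^(2i). A square root of
      \<open>v\<close> is chosen so that this equals v^i.\<close>
    define w where "w = csqrt v"
    have w: "w\<^sup>2 = v" "norm w = 1" using v by (auto simp: w_def)
    have cw: "w * cnj w = 1" using w(2) by (metis complex_norm_square of_real_1 power_one)
    have "poly r v = (\<Sum>p\<in>{p\<in>F. fst p + snd p = n}. w ^ n * (d p * (w ^ fst p * cnj w ^ snd p)))"
      unfolding r_def poly_sum
    proof (intro sum.cong refl)
      fix p assume "p \<in> {p \<in> F. fst p + snd p = n}"
      then have n: "n = fst p + snd p" by simp
      have "w ^ n * (w ^ fst p * cnj w ^ snd p) = (w ^ fst p) * (w ^ fst p) * (w * cnj w) ^ snd p"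
        unfolding n by (simp add: power_add power_mult_distrib mult_ac)
      then have "w ^ n * (w ^ fst p * cnj w ^ snd p) = v ^ fst p"
        by (simp add: cw w(1)[symmetric] power2_eq_square power_mult_distrib)
      then show "poly (monom (d p) (fst p)) v = w ^ n * (d p * (w ^ fst p * cnj w ^ snd p))"
        by (simp add: poly_monom mult_ac)
    qed
    also have "\<dots> = 0" using hom[of w] by (simp flip: sum_distrib_left)
    finally show ?thesis .
  qed
  then have "{z. norm z = 1} \<subseteq> {x. poly r x = 0}" by auto
  then have "r = 0" using poly_roots_finite[of r] finite_subset infinite_unit_circle by blast
  then have "0 = coeff r (fst p)" by simp
  also have "\<dots> = (\<Sum>p'\<in>{p'\<in>F. fst p' + snd p' = n}. if p' = p then d p' else 0)"
    unfolding r_def coeff_sum by (intro sum.cong refl) (auto simp: n_def prod_eq_iff)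
  also have "\<dots> = d p" using F p by (simp add: n_def)
  finally show ?thesis by simp
qed

text \<open>Induction on the set of variables that may occur. Fixing the others and applying the
  one-variable case to coordinate \<open>i\<close> isolates the monomials with the exponents
  \<open>e m\<close> in that variable. On this class the map \<open>r\<close>, which erases the
  coordinate, is injective, so the coefficients can be transported along it to the smaller
  set.\<close>

lemma zz_poly_unique:
  fixes c :: "'n::finite zzpoly"
  assumes "finite F" and "\<And>z. (\<Sum>m\<in>F. c m * zzmonom m z) = 0" and "m \<in> F"
  shows "c m = 0"
proof -
  have "\<forall>F c. finite F \<longrightarrow> (\<forall>m\<in>F. \<forall>i. i \<notin> S \<longrightarrow> fst m i = 0 \<and> snd m i = 0) \<longrightarrow>
      (\<forall>z. (\<Sum>m\<in>F. c m * zzmonom m z) = 0) \<longrightarrow> (\<forall>m\<in>F. c m = 0)"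
    if "finite S" for S :: "'n set"
    using that
  proof induction
    case empty
    show ?case
    proof (intro allI impI ballI)
      fix F :: "'n biindex set" and c :: "'n zzpoly" and m
      assume "\<forall>m\<in>F. \<forall>i. i \<notin> {} \<longrightarrow> fst m i = 0 \<and> snd m i = 0" and z: "\<forall>z. (\<Sum>m\<in>F. c m * zzmonom m z) = 0"
        and m: "m \<in> F"
      then have "F = {m}" by (fastforce simp: prod_eq_iff fun_eq_iff)
      moreover have "zzmonom m (\<chi> i. 1) = 1" by (simp add: zzmonom_def)
      ultimately show "c m = 0" using z[rule_format, of "\<chi> i. 1"] by simp
    qed
  next
    case (insert i S)
    show ?case
    proof (intro allI impI ballI)
      fix F :: "'n biindex set" and c :: "'n zzpoly" and m
      assume F: "finite F" and supp: "\<forall>m\<in>F. \<forall>j. j \<notin> insert i S \<longrightarrow> fst m j = 0 \<and> snd m j = 0"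
        and z: "\<forall>z. (\<Sum>m\<in>F. c m * zzmonom m z) = 0" and m: "m \<in> F"
      define e where "e m = (fst m i, snd m i)" for m :: "'n biindex"
      define r where "r m = ((fst m)(i := 0), (snd m)(i := 0))" for m :: "'n biindex"
      define Fm where "Fm = {m'\<in>F. e m' = e m}"
      have finFm: "finite Fm" using F by (simp add: Fm_def)
      have split: "zzmonom m' (\<chi> j. if j = i then x else z $ j) = x ^ fst (e m') * cnj x ^ snd (e m') * zzmonom (r m') z" for m' x and z :: "complex^'n"
      proof -
        have "zzmonom m' (\<chi> j. if j = i then x else z $ j) = x ^ fst m' i * cnj x ^ snd m' i * (\<Prod>j\<in>UNIV - {i}. (z $ j) ^ fst m' j * cnj (z $ j) ^ snd m' j)"
          unfolding zzmonom_def by (subst prod.remove[of _ i]) (auto intro!: prod.cong)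
        also have "(\<Prod>j\<in>UNIV - {i}. (z $ j) ^ fst m' j * cnj (z $ j) ^ snd m' j) = zzmonom (r m') z"
          unfolding zzmonom_def by (subst (2) prod.remove[of _ i]) (auto simp: r_def intro!: prod.cong)
        finally show ?thesis by (simp add: e_def)
      qed
      have inj: "inj_on r Fm"
      proof (rule inj_onI)
        fix x y assume "x \<in> Fm" "y \<in> Fm" "r x = r y"
        then have "e x = e y" "r x = r y" by (auto simp: Fm_def)
        then show "x = y" by (auto simp: e_def r_def prod_eq_iff fun_eq_iff split: if_splits)
      qed
      have zero: "(\<Sum>m'\<in>Fm. c m' * zzmonom (r m') z) = 0" for z :: "complex^'n"
      proof -
        have "(\<Sum>p\<in>e ` F. (\<Sum>m'\<in>{m'\<in>F. e m' = p}. c m' * zzmonom (r m') z) * (x ^ fst p * cnj x ^ snd p)) = 0" for x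
        proof -
          have "0 = (\<Sum>m'\<in>F. c m' * zzmonom m' (\<chi> j. if j = i then x else z $ j))" using z by simp
          also have "\<dots> = (\<Sum>p\<in>e ` F. \<Sum>m'\<in>{m'\<in>F. e m' = p}. c m' * zzmonom m' (\<chi> j. if j = i then x else z $ j))"
            by (rule sum.image_gen[OF F])
          also have "\<dots> = (\<Sum>p\<in>e ` F. (\<Sum>m'\<in>{m'\<in>F. e m' = p}. c m' * zzmonom (r m') z) * (x ^ fst p * cnj x ^ snd p))"
            unfolding sum_distrib_right by (intro sum.cong refl) (auto simp: split mult_ac)
          finally show ?thesis by simp
        qed
        then show ?thesis
          using zz_poly_one_var[of "e ` F" "\<lambda>p. \<Sum>m'\<in>{m'\<in>F. e m' = p}. c m' * zzmonom (r m') z" "e m"] F m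
          by (simp add: Fm_def)
      qed
      let ?c = "\<lambda>m'. c (inv_into Fm r m')"
      have IHz: "\<forall>z. (\<Sum>m'\<in>r ` Fm. ?c m' * zzmonom m' z) = 0"
        using zero inj by (simp add: sum.reindex)
      have IHs: "\<forall>m\<in>r ` Fm. \<forall>j. j \<notin> S \<longrightarrow> fst m j = 0 \<and> snd m j = 0"
        using supp by (auto simp: r_def Fm_def)
      have "\<forall>m'\<in>r ` Fm. ?c m' = 0"
        by (rule insert.IH[THEN spec, THEN spec, THEN mp, THEN mp, THEN mp, OF finite_imageI[OF finFm] IHs IHz])
      moreover have "m \<in> Fm" using m by (simp add: Fm_def)
      ultimately show "c m = 0" using inj by (auto simp: inv_into_f_f)
    qed
  qed
  from this[OF finite[of UNIV], THEN spec[of _ F], THEN spec[of _ c]] show ?thesis using assms by simp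
qed

section \<open>The Berezin equation in terms of moments\<close>

text \<open>Induction on the exponent: multiply by the geometric series and sum the binomials along
  a diagonal. Absolute convergence is carried through the same induction because the Cauchy product
  requires it.\<close>

lemma neg_binomial_sums:
  fixes a :: "'a::{real_normed_field,banach}"
  assumes "norm a < 1"
  shows "(\<lambda>k. of_nat ((N + k) choose k) * a ^ k) sums (1 / (1 - a) ^ (N + 1))"
    and "summable (\<lambda>k. norm (of_nat ((N + k) choose k) * a ^ k))"
proof -
  have *: "(\<lambda>k. of_nat ((N + k) choose k) * a ^ k) sums (1 / (1 - a) ^ (N + 1))
      \<and> summable (\<lambda>k. norm (of_nat ((N + k) choose k) * a ^ k))"
    if "norm a < 1" for a :: "'b::{real_normed_field,banach}"
  proof (induction N)
    case 0
    show ?case using geometric_sums[OF that] summable_geometric[of "norm a"] that by (simp add: norm_power)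
  next
    case (Suc N)
    let ?f = "\<lambda>k. of_nat ((N + k) choose k) * a ^ k"
    have conv: "(\<Sum>k\<le>n. ?f k * a ^ (n - k)) = of_nat ((Suc N + n) choose n) * a ^ n" for n
    proof -
      have "(\<Sum>k\<le>n. ?f k * a ^ (n - k)) = (\<Sum>k\<le>n. of_nat ((N + k) choose k) * a ^ n)"
        by (intro sum.cong refl) (simp add: mult.assoc flip: power_add)
      also have "\<dots> = of_nat (\<Sum>k\<le>n. (N + k) choose k) * a ^ n" by (simp add: sum_distrib_right)
      finally show ?thesis by (simp only: sum_choose_lower add_Suc)
    qed
    have geo: "summable (\<lambda>k. norm (a ^ k))" using that by (simp add: norm_power)
    have "(\<lambda>n. \<Sum>k\<le>n. ?f k * a ^ (n - k)) sums ((\<Sum>k. ?f k) * (\<Sum>k. a ^ k))"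
      using Suc geo by (intro Cauchy_product_sums) auto
    then have s: "(\<lambda>n. of_nat ((Suc N + n) choose n) * a ^ n) sums (1 / (1 - a) ^ (Suc N + 1))"
    proof -
      have "(\<Sum>k. ?f k) = 1 / (1 - a) ^ (N + 1)" using Suc by (simp only: sums_iff)
      moreover have "(\<Sum>k. a ^ k) = 1 / (1 - a)" using geometric_sums[OF that] by (simp only: sums_iff)
      moreover have "1 / (1 - a) ^ (N + 1) * (1 / (1 - a)) = 1 / (1 - a) ^ (Suc N + 1)" by simp
      moreover assume "(\<lambda>n. \<Sum>k\<le>n. ?f k * a ^ (n - k)) sums ((\<Sum>k. ?f k) * (\<Sum>k. a ^ k))"
      ultimately show ?thesis by (simp only: conv)
    qed
    have "summable (\<lambda>n. \<Sum>k\<le>n. norm (?f k) * norm (a ^ (n - k)))"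
      using Suc geo by (intro summable_Cauchy_product) auto
    moreover have "(\<Sum>k\<le>n. norm (?f k) * norm (a ^ (n - k))) = norm (of_nat ((Suc N + n) choose n) * a ^ n)" for n
    proof -
      have "(\<Sum>k\<le>n. norm (?f k) * norm (a ^ (n - k))) = (\<Sum>k\<le>n. real ((N + k) choose k) * norm a ^ n)"
        by (intro sum.cong refl) (simp add: norm_mult norm_power mult.assoc flip: power_add)
      also have "\<dots> = real (\<Sum>k\<le>n. (N + k) choose k) * norm a ^ n" by (simp add: sum_distrib_right)
      finally show ?thesis by (simp only: sum_choose_lower add_Suc norm_mult norm_power norm_of_nat)
    qed
    ultimately show ?case using s by simp
  qed
  show "(\<lambda>k. of_nat ((N + k) choose k) * a ^ k) sums (1 / (1 - a) ^ (N + 1))"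
    and "summable (\<lambda>k. norm (of_nat ((N + k) choose k) * a ^ k))" using *[OF assms] by auto
qed

text \<open>The component of degree \<open>n\<close>, jointly in \<open>a\<close> and its conjugate,
  of the expansion of |1 - a|^(-2(N+1)).\<close>

definition kercoef :: "nat \<Rightarrow> nat \<Rightarrow> complex \<Rightarrow> complex" where
  "kercoef N n a = (\<Sum>k\<le>n. of_nat (((N + k) choose k) * ((N + (n - k)) choose (n - k))) * (a ^ k * cnj a ^ (n - k)))"

text \<open>The sum of the coefficients of \<open>kercoef\<close>, which are positive; hence its
  value at a = 1 and a majorant on the unit disc.\<close>

definition kerbound :: "nat \<Rightarrow> nat \<Rightarrow> real" where
  "kerbound N n = (\<Sum>k\<le>n. real (((N + k) choose k) * ((N + (n - k)) choose (n - k))))"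

lemma kerbound_nonneg: "kerbound N n \<ge> 0"
  by (simp add: kerbound_def sum_nonneg)

lemma kercoef_sums:
  assumes "norm a < 1"
  shows "(\<lambda>n. kercoef N n a) sums (1 / of_real (norm (1 - a) ^ (2 * (N + 1))))"
proof -
  let ?f = "\<lambda>a k. of_nat ((N + k) choose k) * a ^ k :: complex"
  have na: "norm (cnj a) < 1" using assms by simp
  have "(\<lambda>n. \<Sum>k\<le>n. ?f a k * ?f (cnj a) (n - k)) sums ((\<Sum>k. ?f a k) * (\<Sum>k. ?f (cnj a) k))"
    by (intro Cauchy_product_sums neg_binomial_sums assms na)
  also have "(\<Sum>k. ?f a k) * (\<Sum>k. ?f (cnj a) k) = 1 / (1 - a) ^ (N + 1) * (1 / (1 - cnj a) ^ (N + 1))"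
    using neg_binomial_sums(1)[OF assms, of N] neg_binomial_sums(1)[OF na, of N] by (simp add: sums_iff)
  also have "\<dots> = 1 / ((1 - a) * cnj (1 - a)) ^ (N + 1)" by (simp add: power_mult_distrib)
  also have "\<dots> = 1 / of_real (norm (1 - a) ^ (2 * (N + 1)))"
    unfolding complex_norm_square[symmetric] by (simp only: power_mult of_real_power)
  also have "(\<lambda>n. \<Sum>k\<le>n. ?f a k * ?f (cnj a) (n - k)) = (\<lambda>n. kercoef N n a)"
    by (simp add: kercoef_def mult_ac fun_eq_iff)
  finally show ?thesis .
qed

lemma norm_kercoef_le:
  assumes "norm a \<le> r" shows "norm (kercoef N n a) \<le> kerbound N n * r ^ n"
proof -
  have "norm (kercoef N n a) \<le> (\<Sum>k\<le>n. real (((N + k) choose k) * ((N + (n - k)) choose (n - k))) * norm a ^ n)"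
    unfolding kercoef_def
    by (rule sum_norm_le) (simp add: norm_mult norm_power flip: power_add)
  also have "\<dots> = kerbound N n * norm a ^ n" by (simp add: kerbound_def sum_distrib_right)
  also have "\<dots> \<le> kerbound N n * r ^ n" using assms by (intro mult_left_mono power_mono kerbound_nonneg) auto
  finally show ?thesis .
qed

lemma kerbound_summable:
  assumes "0 \<le> r" "r < 1" shows "summable (\<lambda>n. kerbound N n * r ^ n)"
proof -
  let ?f = "\<lambda>k. of_nat ((N + k) choose k) * r ^ k"
  have s: "summable (\<lambda>k. norm (?f k))" using neg_binomial_sums(2)[of r N] assms by simp
  have "summable (\<lambda>n. \<Sum>k\<le>n. ?f k * ?f (n - k))" by (rule summable_Cauchy_product[OF s s])
  also have "(\<lambda>n. \<Sum>k\<le>n. ?f k * ?f (n - k)) = (\<lambda>n. kerbound N n * r ^ n)"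
  proof
    fix n
    have "(\<Sum>k\<le>n. ?f k * ?f (n - k)) = (\<Sum>k\<le>n. real (((N + k) choose k) * ((N + (n - k)) choose (n - k))) * r ^ n)"
    proof (rule sum.cong)
      fix k assume "k \<in> {..n}"
      then have "r ^ k * r ^ (n - k) = r ^ n" by (simp flip: power_add)
      then show "?f k * ?f (n - k) = real (((N + k) choose k) * ((N + (n - k)) choose (n - k))) * r ^ n"
        by (simp add: mult_ac)
    qed simp
    then show "(\<Sum>k\<le>n. ?f k * ?f (n - k)) = kerbound N n * r ^ n" by (simp add: kerbound_def sum_distrib_right)
  qed
  finally show ?thesis .
qed

lemma norm_cinner_le: "cmod (cinner z w) \<le> norm z * norm w"
proof -
  have "cmod (cinner z w) \<le> (\<Sum>j\<in>UNIV. cmod (z $ j) * cmod (w $ j))"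
    unfolding cinner_def by (rule order_trans[OF norm_sum]) (simp add: norm_mult)
  also have "\<dots> \<le> L2_set (\<lambda>j. cmod (z $ j)) UNIV * L2_set (\<lambda>j. cmod (w $ j)) UNIV"
    using L2_set_mult_ineq[of "\<lambda>j. cmod (z $ j)" "\<lambda>j. cmod (w $ j)" UNIV] by simp
  finally show ?thesis by (simp add: norm_vec_def)
qed

lemma continuous_on_cinner_left: "continuous_on S (\<lambda>w. cinner z w)"
  unfolding cinner_def by (intro continuous_intros)

lemma cinner_measurable [measurable]: "(\<lambda>w. cinner z w) \<in> borel_measurable borel"
  by (intro borel_measurable_continuous_onI continuous_on_cinner_left)

definition moment :: "(complex^'n \<Rightarrow> complex) \<Rightarrow> 'n zzpoly" where
  "moment u m = ball_integral (\<lambda>x. u x * cnj (zzmonom m x))"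

text \<open>\<open>hcoef u\<close> collects the Taylor coefficients in \<open>z\<close> and its conjugate of the integral of
\<open>u(\<xi>) |1 - \<langle>z, \<xi>\<rangle>|^{-2(N+1)}\<close>, and \<open>rcoef f\<close> those of \<open>f(z) (1 - |z|^2)^{-(N+1)}\<close>.\<close>

definition hcoef :: "(complex^'n \<Rightarrow> complex) \<Rightarrow> 'n zzpoly" where
  "hcoef u m = of_real (fact (CARD('n) + mdeg (fst m)) * fact (CARD('n) + mdeg (snd m))
      / ((fact (CARD('n)))\<^sup>2 * (mfact (fst m) * mfact (snd m)))) * moment u m"

lemma set_integrable_mult_bounded:
  fixes u h :: "complex^'n \<Rightarrow> complex"
  assumes u: "ball_integrable u" and h: "h \<in> borel_measurable borel"
    and b: "\<And>x. x \<in> unit_ball \<Longrightarrow> norm (h x) \<le> C"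
  shows "ball_integrable (\<lambda>x. u x * h x)"
proof -
  have hm: "h \<in> borel_measurable lebesgue" using h by (simp add: measurable_completion)
  have um: "(\<lambda>x. indicator unit_ball x *\<^sub>R u x) \<in> borel_measurable lebesgue"
    using u unfolding set_integrable_def by (rule borel_measurable_integrable)
  have m: "(\<lambda>x. indicator unit_ball x *\<^sub>R (u x * h x)) \<in> borel_measurable lebesgue"
    using borel_measurable_times[OF um hm] by simp
  have i: "integrable lebesgue (\<lambda>x. C * norm (indicator unit_ball x *\<^sub>R u x))"
    using u unfolding set_integrable_def by (intro integrable_mult_right integrable_norm)
  show ?thesis unfolding set_integrable_def
    by (rule Bochner_Integration.integrable_bound[OF i m])
       (auto simp: indicator_def norm_mult mult.commute intro!: order_trans[OF mult_right_mono[OF b]])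
qed

lemma norm_zzmonom_le_1: "x \<in> unit_ball \<Longrightarrow> norm (zzmonom m x) \<le> 1"
  using cmod_zzmonom_le[of "fst m" "snd m" x] power_le_one[of "norm x" "mdeg (fst m) + mdeg (snd m)"] by simp

lemma set_integrable_zzmonom:
  fixes u :: "complex^'n \<Rightarrow> complex"
  assumes u: "ball_integrable u"
  shows "ball_integrable (\<lambda>x. u x * cnj (zzmonom m x))"
proof (rule set_integrable_mult_bounded[OF u])
  show "(\<lambda>x. cnj (zzmonom m x)) \<in> borel_measurable borel"
    unfolding zzmonom_def by (intro borel_measurable_continuous_onI continuous_intros)
  show "norm (cnj (zzmonom m x)) \<le> 1" if "x \<in> unit_ball" for x using norm_zzmonom_le_1[OF that] by simp
qed

lemma fact_choose: "real ((N + k) choose k) * fact k = fact (N + k) / fact N"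
  by (simp add: binomial_fact)

text \<open>The multinomial theorem separates \<open>z\<close> from the variable of integration. The
  binomial factors of the kernel times the multinomial factors combine to the weight in
  \<open>hcoef\<close>.\<close>

lemma integral_kercoef:
  fixes u :: "complex^'n \<Rightarrow> complex"
  assumes u: "ball_integrable u"
  shows "ball_integral (\<lambda>x. u x * kercoef (CARD('n)) n (cinner z x)) = teval n (hcoef u) z"
proof -
  let ?N = "CARD('n)"
  let ?w = "\<lambda>m. of_real (fact (?N + mdeg (fst m)) * fact (?N + mdeg (snd m)) / ((fact ?N)\<^sup>2 * (mfact (fst m) * mfact (snd m)))) :: complex"
  have eq: "kercoef ?N n (cinner z x) = (\<Sum>m\<in>totdeg n. ?w m * zzmonom m z * cnj (zzmonom m x))" for x
    unfolding kercoef_def sum_totdeg cinner_power_power sum_distrib_left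
  proof (intro sum.cong refl)
    fix k and m :: "'n biindex"
    assume "k \<in> {..n}" and m: "m \<in> bideg k (n - k)"
    have "real (((?N + k) choose k) * ((?N + (n - k)) choose (n - k))) * (fact k * fact (n - k))
      = (real ((?N + k) choose k) * fact k) * (real ((?N + (n - k)) choose (n - k)) * fact (n - k))" by simp
    also have "\<dots> = fact (?N + k) * fact (?N + (n - k)) / (fact ?N)\<^sup>2"
      unfolding fact_choose by (simp add: power2_eq_square)
    finally have "of_nat (((?N + k) choose k) * ((?N + (n - k)) choose (n - k))) * of_real (fact k * fact (n - k) / (mfact (fst m) * mfact (snd m))) = ?w m"
      using m unfolding bideg_def by (simp only: mem_Collect_eq)
        (metis (no_types, lifting) of_real_mult of_real_of_nat_eq times_divide_eq_right divide_divide_eq_left)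
    then show "of_nat (((?N + k) choose k) * ((?N + (n - k)) choose (n - k))) *
        (of_real (fact k * fact (n - k) / (mfact (fst m) * mfact (snd m))) * zzmonom m z * cnj (zzmonom m x))
      = ?w m * zzmonom m z * cnj (zzmonom m x)" by (simp only: mult.assoc[symmetric])
  qed
  have "ball_integral (\<lambda>x. u x * kercoef ?N n (cinner z x))
     = ball_integral (\<lambda>x. \<Sum>m\<in>totdeg n. ?w m * zzmonom m z * (u x * cnj (zzmonom m x)))"
    unfolding eq sum_distrib_left by (simp only: mult_ac)
  also have "\<dots> = (\<Sum>m\<in>totdeg n. ball_integral (\<lambda>x. ?w m * zzmonom m z * (u x * cnj (zzmonom m x))))"
    unfolding set_lebesgue_integral_def scaleR_sum_right
    by (rule Bochner_Integration.integral_sum, unfold set_integrable_def[symmetric])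
       (intro set_integrable_mult_right set_integrable_zzmonom u)
  also have "\<dots> = (\<Sum>m\<in>totdeg n. ?w m * zzmonom m z * moment u m)"
    by (simp add: moment_def)
  finally show ?thesis by (simp add: teval_def hcoef_def mult_ac)
qed

text \<open>For fixed \<open>z\<close> in the ball |<z,x>| is at most |z| < 1, so the terms are
  dominated by the convergent series of \<open>kerbound N n * |z|^n\<close> times |u|, and summation
  may be exchanged with integration.\<close>

lemma berezin_integral_sums:
  fixes u :: "complex^'n \<Rightarrow> complex"
  assumes u: "ball_integrable u" and z: "z \<in> unit_ball"
  shows "(\<lambda>n. teval n (hcoef u) z) sums
    ball_integral (\<lambda>x. u x / of_real (cmod (1 - cinner z x) ^ (2 * (CARD('n) + 1))))"
proof -
  let ?N = "CARD('n)"
  define r where "r = norm z"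
  have r: "0 \<le> r" "r < 1" using z by (auto simp: r_def)
  have ci: "norm (cinner z x) \<le> r" if "x \<in> unit_ball" for x
    using norm_cinner_le[of z x] mult_left_mono[of "norm x" 1 "norm z"] that by (auto simp: r_def)
  define F where "F n x = indicator unit_ball x *\<^sub>R (u x * kercoef ?N n (cinner z x))" for n x
  have km: "(\<lambda>x. kercoef ?N n (cinner z x)) \<in> borel_measurable borel" for n
    unfolding kercoef_def by (intro borel_measurable_continuous_onI continuous_intros continuous_on_cinner_left)
  have Fi: "integrable lebesgue (F n)" for n
    unfolding F_def set_integrable_def[symmetric]
    by (rule set_integrable_mult_bounded[OF u km norm_kercoef_le[OF ci]])
  define I where "I = (\<integral>x. norm (indicator unit_ball x *\<^sub>R u x) \<partial>lebesgue)"
  have Fb: "norm (F n x) \<le> kerbound ?N n * r ^ n * norm (indicator unit_ball x *\<^sub>R u x)" for n x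
    using norm_kercoef_le[OF ci, of x ?N n] mult_right_mono[of "norm (kercoef ?N n (cinner z x))" "kerbound ?N n * r ^ n" "norm (u x)"]
    by (auto simp: F_def indicator_def norm_mult mult_ac)
  have ui: "integrable lebesgue (\<lambda>x. norm (indicator unit_ball x *\<^sub>R u x))"
    using u unfolding set_integrable_def by (rule integrable_norm)
  have Fs: "summable (\<lambda>n. norm (F n x))" for x
    by (rule summable_comparison_test'[where g = "\<lambda>n. kerbound ?N n * r ^ n * norm (indicator unit_ball x *\<^sub>R u x)" and N = 0])
       (use Fb kerbound_summable[OF r] in \<open>auto intro!: summable_mult2\<close>)
  have FI: "summable (\<lambda>n. \<integral>x. norm (F n x) \<partial>lebesgue)"
  proof (rule summable_comparison_test'[where g = "\<lambda>n. kerbound ?N n * r ^ n * I" and N = 0])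
    show "summable (\<lambda>n. kerbound ?N n * r ^ n * I)" by (intro summable_mult2 kerbound_summable r)
    fix n :: nat
    have "(\<integral>x. norm (F n x) \<partial>lebesgue) \<le> (\<integral>x. kerbound ?N n * r ^ n * norm (indicator unit_ball x *\<^sub>R u x) \<partial>lebesgue)"
      using Fi Fb ui by (intro integral_mono) (auto intro: integrable_norm)
    also have "\<dots> = kerbound ?N n * r ^ n * I" by (simp add: I_def)
    finally show "norm (\<integral>x. norm (F n x) \<partial>lebesgue) \<le> kerbound ?N n * r ^ n * I" by simp
  qed
  have "(\<lambda>n. integral\<^sup>L lebesgue (F n)) sums (\<integral>x. (\<Sum>n. F n x) \<partial>lebesgue)"
    by (rule sums_integral[OF Fi _ FI]) (simp add: Fs)
  moreover have "integral\<^sup>L lebesgue (F n) = teval n (hcoef u) z" for n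
    using integral_kercoef[OF u, of n z] by (simp add: F_def[abs_def] set_lebesgue_integral_def)
  moreover have "(\<Sum>n. F n x) = indicator unit_ball x *\<^sub>R (u x / of_real (cmod (1 - cinner z x) ^ (2 * (?N + 1))))" for x
  proof (cases "x \<in> unit_ball")
    case True
    have "(\<lambda>n. u x * kercoef ?N n (cinner z x)) sums (u x * (1 / of_real (norm (1 - cinner z x) ^ (2 * (?N + 1)))))"
      by (intro sums_mult kercoef_sums) (use ci[OF True] r in simp)
    then show ?thesis using True by (simp add: F_def sums_iff)
  qed (simp add: F_def)
  ultimately show ?thesis by (simp add: set_lebesgue_integral_def)
qed

definition rcoef :: "'n::finite zzpoly \<Rightarrow> 'n zzpoly" where
  "rcoef f m = (\<Sum>i\<le>mdeg (fst m). of_nat ((CARD('n) + i) choose i) * (normmul ^^ i) f m)"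

text \<open>Each multiplication by |z|^2 raises the holomorphic degree by one. This is why the
  finite sum in \<open>rcoef\<close> already contains the whole binomial series.\<close>

lemma normmul_pow_eq_0: "mdeg (fst m) < i \<Longrightarrow> (normmul ^^ i) f m = 0"
proof (induction i arbitrary: m)
  case (Suc i)
  have "(if 0 < fst m j \<and> 0 < snd m j then (normmul ^^ i) f (down j (fst m), down j (snd m)) else 0) = 0" for j
  proof (cases "0 < fst m j \<and> 0 < snd m j")
    case True
    then have "mdeg (down j (fst m)) < i" using mdeg_down[of "fst m" j] Suc.prems by linarith
    then have "(normmul ^^ i) f (down j (fst m), down j (snd m)) = 0"
      by (rule Suc.IH[of "(down j (fst m), down j (snd m))", unfolded fst_conv])
    then show ?thesis by (simp only: if_cancel)
  next
    case False
    then show ?thesis by (simp only: if_False)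
  qed
  then have "normmul ((normmul ^^ i) f) m = 0" unfolding normmul_def[of "(normmul ^^ i) f"] case_prod_unfold
    by (simp only: sum.neutral_const)
  then show ?case by simp
qed simp

lemma teval_rcoef:
  fixes f :: "'n::finite zzpoly"
  shows "teval n (rcoef f) z = (\<Sum>i\<le>n. of_nat ((CARD('n) + i) choose i) * teval n ((normmul ^^ i) f) z)"
proof -
  have "rcoef f m = (\<Sum>i\<le>n. of_nat ((CARD('n) + i) choose i) * (normmul ^^ i) f m)" if "m \<in> totdeg n" for m
    unfolding rcoef_def using that by (intro sum.mono_neutral_left) (auto simp: totdeg_def normmul_pow_eq_0)
  then have "teval n (rcoef f) z = (\<Sum>m\<in>totdeg n. \<Sum>i\<le>n. of_nat ((CARD('n) + i) choose i) * (normmul ^^ i) f m * zzmonom m z)"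
    unfolding teval_def by (intro sum.cong refl) (simp add: sum_distrib_right)
  also have "\<dots> = (\<Sum>i\<le>n. \<Sum>m\<in>totdeg n. of_nat ((CARD('n) + i) choose i) * (normmul ^^ i) f m * zzmonom m z)"
    by (rule sum.swap)
  finally show ?thesis by (simp add: teval_def sum_distrib_left mult_ac)
qed

lemma zzeval_sums:
  assumes "is_zzpoly f"
  shows "(\<lambda>n. teval n f z) sums zzeval f z" "summable (\<lambda>n. norm (teval n f z))"
proof -
  let ?S = "{m. f m \<noteq> 0}"
  define d where "d = (\<lambda>m :: ('a \<Rightarrow> nat) \<times> ('a \<Rightarrow> nat). mdeg (fst m) + mdeg (snd m))"
  have fin: "finite ?S" using assms by (simp add: is_zzpoly_def)
  have t: "teval n f z = (\<Sum>m\<in>{m\<in>?S. d m = n}. f m * zzmonom m z)" for n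
    unfolding teval_def by (rule sum.mono_neutral_right) (simp, auto simp: totdeg_def d_def)
  have z0: "teval n f z = 0" if "n \<notin> d ` ?S" for n
    unfolding t using that by (intro sum.neutral) auto
  have "zzeval f z = (\<Sum>n\<in>d ` ?S. teval n f z)"
    unfolding zzeval_def t by (rule sum.image_gen[OF fin])
  then show "(\<lambda>n. teval n f z) sums zzeval f z"
    using sums_finite[of "d ` ?S" "\<lambda>n. teval n f z"] fin z0 by simp
  show "summable (\<lambda>n. norm (teval n f z))"
    using fin z0 by (intro summable_finite[of "d ` ?S"]) auto
qed

lemma rcoef_sums:
  fixes f :: "'n::finite zzpoly"
  assumes f: "is_zzpoly f" and z: "z \<in> unit_ball"
  shows "(\<lambda>n. teval n (rcoef f) z) sums (zzeval f z / of_real ((1 - (norm z)\<^sup>2) ^ (CARD('n) + 1)))"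
proof -
  let ?N = "CARD('n)"
  define a where "a = (of_real ((norm z)\<^sup>2) :: complex)"
  have a: "norm a < 1" using z by (simp add: a_def norm_power abs_square_less_1)
  \<comment> \<open>The binomial series in |z|^2, placed at the even indices, so that the index of
    the Cauchy product with the components of \<open>f\<close> is the total degree.\<close>
  define A where "A j = (if even j then of_nat ((?N + j div 2) choose (j div 2)) * a ^ (j div 2) else 0)" for j
  have sm: "strict_mono (\<lambda>i::nat. 2 * i)" by (auto simp: strict_mono_def)
  have rg: "A n = 0" if "n \<notin> range (\<lambda>i. 2 * i)" for n using that by (auto simp: A_def elim!: evenE)
  have A2: "A (2 * i) = of_nat ((?N + i) choose i) * a ^ i" for i by (simp add: A_def)
  have As: "A sums (1 / (1 - a) ^ (?N + 1))"
    using neg_binomial_sums(1)[OF a, of ?N] sums_mono_reindex[OF sm, of A] rg by (simp add: A2)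
  have An: "summable (\<lambda>j. norm (A j))"
    using neg_binomial_sums(2)[OF a, of ?N] summable_mono_reindex[OF sm, of "\<lambda>j. norm (A j)"] rg by (simp add: A2)
  have "(\<lambda>n. \<Sum>j\<le>n. A j * teval (n - j) f z) sums ((\<Sum>j. A j) * (\<Sum>j. teval j f z))"
    by (rule Cauchy_product_sums[OF An zzeval_sums(2)[OF f]])
  also have "(\<Sum>j. A j) * (\<Sum>j. teval j f z) = zzeval f z / of_real ((1 - (norm z)\<^sup>2) ^ (?N + 1))"
    unfolding sums_unique[OF As, symmetric] sums_unique[OF zzeval_sums(1)[OF f], symmetric] by (simp add: a_def)
  also have "(\<lambda>n. \<Sum>j\<le>n. A j * teval (n - j) f z) = (\<lambda>n. teval n (rcoef f) z)"
  proof
    fix n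
    have "(\<Sum>j\<le>n. A j * teval (n - j) f z) = (\<Sum>j\<in>(\<lambda>i. 2 * i) ` {i. 2 * i \<le> n}. A j * teval (n - j) f z)"
      by (rule sum.mono_neutral_right) (auto simp: A_def image_iff elim!: evenE)
    also have "\<dots> = (\<Sum>i | 2 * i \<le> n. A (2 * i) * teval (n - 2 * i) f z)"
      by (subst sum.reindex) (auto simp: inj_on_def)
    also have "\<dots> = (\<Sum>i | 2 * i \<le> n. of_nat ((?N + i) choose i) * teval n ((normmul ^^ i) f) z)"
      by (intro sum.cong refl) (simp add: A_def a_def teval_normmul_pow power_mult)
    also have "\<dots> = (\<Sum>i\<le>n. of_nat ((?N + i) choose i) * teval n ((normmul ^^ i) f) z)"
      by (rule sum.mono_neutral_left) (auto simp: teval_normmul_pow)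
    finally show "(\<Sum>j\<le>n. A j * teval (n - j) f z) = teval n (rcoef f) z" by (simp add: teval_rcoef)
  qed
  finally show ?thesis .
qed

lemma zzmonom_scaleR: "zzmonom m (r *\<^sub>R z) = of_real (r ^ (mdeg (fst m) + mdeg (snd m))) * zzmonom m z"
proof -
  have c: "(r *\<^sub>R z) $ j = of_real r * z $ j" for j
    unfolding vector_scaleR_component by (rule scaleR_conv_of_real)
  have "zzmonom m (r *\<^sub>R z) = (\<Prod>j\<in>UNIV. (of_real r ^ fst m j * of_real r ^ snd m j) * ((z $ j) ^ fst m j * cnj (z $ j) ^ snd m j))"
    unfolding zzmonom_def c by (simp add: power_mult_distrib mult_ac)
  also have "\<dots> = of_real (r ^ (mdeg (fst m) + mdeg (snd m))) * zzmonom m z"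
    by (simp add: prod.distrib zzmonom_def power_add mdeg_def flip: power_sum)
  finally show ?thesis .
qed

lemma teval_scaleR: "teval n c (r *\<^sub>R z) = of_real (r ^ n) * teval n c z"
  unfolding teval_def sum_distrib_left
  by (intro sum.cong refl) (simp add: zzmonom_scaleR totdeg_def)

lemma real_powser_unique:
  fixes a :: "nat \<Rightarrow> real"
  assumes "r > 0" and s: "\<And>x. \<bar>x\<bar> < r \<Longrightarrow> (\<lambda>n. a n * x ^ n) sums 0"
  shows "a n = 0"
proof (induction n rule: less_induct)
  case (less n)
  have "(\<lambda>m. a (m + n) * x ^ m) sums 0" if "x \<noteq> 0" "norm x < r" for x
  proof -
    have "(\<lambda>m. a m * x ^ m) sums 0" using s[of x] that by simp
    then have "(\<lambda>m. a (m + n) * x ^ (m + n)) sums 0"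
      using less by (subst sums_iff_shift) simp
    from sums_divide[OF this, of "x ^ n"] that show ?thesis by (simp add: power_add)
  qed
  from powser_limit_0_strong[OF assms(1) this] have "((\<lambda>x::real. 0::real) \<longlongrightarrow> a n) (at 0)" by simp
  then show ?case using tendsto_unique[OF _ tendsto_const] by (metis at_neq_bot)
qed

text \<open>Along a ray x * z with \<open>x\<close> real the series becomes a real power series in
  \<open>x\<close>, because the n-th term is homogeneous of degree n under real dilations. The
  radius 1 / (|z| + 1) keeps the ray in the ball.\<close>

lemma teval_unique:
  fixes c :: "'n::finite zzpoly"
  assumes "\<And>z. z \<in> unit_ball \<Longrightarrow> (\<lambda>n. teval n c z) sums 0"
  shows "c m = 0"
proof -
  have tz: "teval n c z = 0" for n and z :: "complex^'n"
  proof -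
    define r where "r = 1 / (norm z + 1)"
    have r: "r > 0" by (simp add: r_def add_nonneg_pos)
    have s: "(\<lambda>n. of_real (x ^ n) * teval n c z) sums 0" if "\<bar>x\<bar> < r" for x
    proof -
      have "\<bar>x\<bar> * norm z \<le> r * norm z" using that by (intro mult_right_mono) auto
      also have "\<dots> < 1" using add_nonneg_pos[of "norm z" 1] by (simp add: r_def divide_less_eq)
      finally have "x *\<^sub>R z \<in> unit_ball" by simp
      from assms[OF this] show ?thesis by (simp add: teval_scaleR)
    qed
    have "Re (teval n c z) = 0"
      by (rule real_powser_unique[OF r]) (use sums_Re[OF s] in \<open>simp add: mult.commute\<close>)
    moreover have "Im (teval n c z) = 0"
      by (rule real_powser_unique[OF r]) (use sums_Im[OF s] in \<open>simp add: mult.commute\<close>)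
    ultimately show ?thesis by (simp add: complex_eq_iff)
  qed
  show ?thesis
    by (rule zz_poly_unique[OF finite_totdeg[of "mdeg (fst m) + mdeg (snd m)"]])
       (use tz in \<open>simp add: teval_def, simp add: totdeg_def\<close>)
qed

text \<open>After division by (1 - |z|^2)^(N+1) both sides of f = B(u) are convergent series of
  homogeneous polynomials, so equality on the ball is equality of coefficients. The volume factor
  comes from the normalization of the measure.\<close>

lemma berezin_moment_iff:
  fixes u :: "complex^'n \<Rightarrow> complex"
  assumes u: "ball_integrable u" and f: "is_zzpoly f"
  shows "(\<forall>z\<in>unit_ball. zzeval f z = berezin u z)
    \<longleftrightarrow> (\<forall>m. hcoef u m = of_real (measure lebesgue (unit_ball :: (complex^'n) set)) * rcoef f m)"
proof -
  let ?N = "CARD('n)"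
  define V where "V = measure lebesgue (unit_ball :: (complex^'n) set)"
  have V: "V > 0" by (simp add: V_def measure_unit_ball)
  let ?I = "\<lambda>z. ball_integral (\<lambda>x. u x / of_real (cmod (1 - cinner z x) ^ (2 * (?N + 1))))"
  have eq: "zzeval f z = berezin u z \<longleftrightarrow> ?I z = of_real V * (zzeval f z / of_real ((1 - (norm z)\<^sup>2) ^ (?N + 1)))"
    if "z \<in> unit_ball" for z
  proof -
    have "(1 - (norm z)\<^sup>2) ^ (?N + 1) > 0" using that by (simp add: abs_square_less_1)
    then have "of_real ((1 - (norm z)\<^sup>2) ^ (?N + 1)) \<noteq> (0::complex)" by (metis of_real_eq_0_iff less_irrefl)
    moreover have "of_real V \<noteq> (0::complex)" using V by simp
    moreover have gen: "(g = c / v * I) \<longleftrightarrow> (I = v * (g / c))" if "c \<noteq> 0" "v \<noteq> 0" for g c v I :: complex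
      using that by (auto simp: field_simps)
    moreover have b: "berezin u z = of_real ((1 - (norm z)\<^sup>2) ^ (?N + 1)) / of_real V * ?I z"
      by (simp only: berezin_def V_def of_real_divide)
    ultimately show ?thesis unfolding b by (intro gen)
  qed
  show ?thesis
  proof
    assume "\<forall>z\<in>unit_ball. zzeval f z = berezin u z"
    then have I: "?I z = of_real V * (zzeval f z / of_real ((1 - (norm z)\<^sup>2) ^ (?N + 1)))" if "z \<in> unit_ball" for z
      using that eq by blast
    define c where "c m = hcoef u m - of_real V * rcoef f m" for m
    have tc: "teval n c z = teval n (hcoef u) z - of_real V * teval n (rcoef f) z" for n z
      by (simp add: teval_def c_def left_diff_distrib sum_subtractf sum_distrib_left mult.assoc)
    have "(\<lambda>n. teval n c z) sums 0" if "z \<in> unit_ball" for z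
      using sums_diff[OF berezin_integral_sums[OF u that] sums_mult[OF rcoef_sums[OF f that], of "of_real V"]] I[OF that]
      by (simp add: tc)
    then have "c m = 0" for m by (rule teval_unique)
    then show "\<forall>m. hcoef u m = of_real (measure lebesgue (unit_ball :: (complex^'n) set)) * rcoef f m"
      by (simp add: c_def V_def)
  next
    assume h: "\<forall>m. hcoef u m = of_real (measure lebesgue (unit_ball :: (complex^'n) set)) * rcoef f m"
    show "\<forall>z\<in>unit_ball. zzeval f z = berezin u z"
    proof
      fix z :: "complex^'n" assume z: "z \<in> unit_ball"
      have "teval n (hcoef u) z = of_real V * teval n (rcoef f) z" for n
        by (simp only: teval_def V_def sum_distrib_left mult.assoc h[rule_format])
      then have "?I z = of_real V * (zzeval f z / of_real ((1 - (norm z)\<^sup>2) ^ (?N + 1)))"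
        using sums_unique2[OF berezin_integral_sums[OF u z]] sums_mult[OF rcoef_sums[OF f z], of "of_real V"] by simp
      then show "zzeval f z = berezin u z" using eq[OF z] by simp
    qed
  qed
qed

section \<open>Mellin interpolation by Bernstein polynomials\<close>

text \<open>\<open>coeff_mult D\<close> is the differential operator \<open>D(x d/dx)\<close>.\<close>

definition coeff_mult :: "complex poly \<Rightarrow> complex poly \<Rightarrow> complex poly" where
  "coeff_mult D p = (\<Sum>j\<le>degree p. monom (poly D (of_nat j) * coeff p j) j)"

lemma coeff_coeff_mult: "coeff (coeff_mult D p) j = poly D (of_nat j) * coeff p j"
  by (auto simp: coeff_mult_def coeff_sum coeff_eq_0)

lemma degree_coeff_mult_le: "degree (coeff_mult D p) \<le> degree p"
  by (rule degree_le) (auto simp: coeff_coeff_mult coeff_eq_0)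

definition euler_op :: "complex poly \<Rightarrow> complex poly" where
  "euler_op p = pCons 0 (pderiv p)"

lemma coeff_euler_op: "coeff (euler_op p) j = of_nat j * coeff p j"
  by (cases j) (simp_all add: euler_op_def coeff_pderiv)

lemma euler_op_add: "euler_op (p + q) = euler_op p + euler_op q"
  by (rule poly_eqI) (simp add: coeff_euler_op algebra_simps)

lemma euler_op_smult: "euler_op (smult c p) = smult c (euler_op p)"
  by (rule poly_eqI) (simp add: coeff_euler_op)

lemma coeff_mult_0: "coeff_mult 0 p = 0"
  by (rule poly_eqI) (simp add: coeff_coeff_mult)

lemma coeff_mult_pCons: "coeff_mult (pCons c D) p = smult c p + euler_op (coeff_mult D p)"
  by (rule poly_eqI) (simp add: coeff_coeff_mult coeff_euler_op algebra_simps)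

lemma coeff_mult_diff: "coeff_mult D (p - q) = coeff_mult D p - coeff_mult D q"
  by (rule poly_eqI) (simp add: coeff_coeff_mult algebra_simps)

lemma coeff_mult_1: "coeff_mult D 1 = [:poly D 0:]"
  by (rule poly_eqI) (auto simp: coeff_coeff_mult coeff_pCons split: nat.splits)

definition bernstein_poly :: "nat \<Rightarrow> nat \<Rightarrow> complex poly" where
  "bernstein_poly n i = smult (of_nat (n choose i)) ([:0, 1:] ^ i * [:1, -1:] ^ (n - i))"

lemma poly_bernstein: "poly (bernstein_poly n i) x = of_nat (n choose i) * x ^ i * (1 - x) ^ (n - i)"
  by (simp add: bernstein_poly_def)

lemma sum_bernstein_poly: "(\<Sum>i\<le>n. bernstein_poly n i) = 1"
proof -
  have "poly (\<Sum>i\<le>n. bernstein_poly n i) x = poly 1 x" for x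
    using binomial_ring[of x "1 - x" n] by (simp add: poly_sum poly_bernstein)
  then show ?thesis by (simp add: poly_eq_poly_eq_iff[symmetric] fun_eq_iff)
qed

text \<open>The degree \<open>n\<close> disappears from the coefficients by the absorption identity
  (n - i) C(n, i) = (i + 1) C(n, i + 1).\<close>

lemma euler_op_bernstein:
  "euler_op (bernstein_poly n i) = smult (of_nat i) (bernstein_poly n i) - smult (of_nat (i + 1)) (bernstein_poly n (i + 1))"
proof -
  have absorb: "of_nat (n - i) * of_nat (n choose i) = (of_nat (i + 1) * of_nat (n choose (i + 1)) :: complex)"
    using binomial_absorb_comp[of n i] binomial_absorption[of i n] by (metis Suc_eq_plus1 of_nat_mult)
  have "poly (euler_op (bernstein_poly n i)) x
    = poly (smult (of_nat i) (bernstein_poly n i) - smult (of_nat (i + 1)) (bernstein_poly n (i + 1))) x" for x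
  proof -
    have xi: "x * (of_nat i * x ^ (i - 1)) = of_nat i * x ^ i" by (cases i) auto
    have "poly (euler_op (bernstein_poly n i)) x = of_nat (n choose i) *
       (x * (of_nat i * x ^ (i - 1)) * (1 - x) ^ (n - i) - of_nat (n - i) * (x ^ (i + 1) * (1 - x) ^ (n - i - 1)))"
      by (simp add: euler_op_def bernstein_poly_def pderiv_smult pderiv_mult pderiv_power pderiv_pCons algebra_simps)
    also have "\<dots> = of_nat i * (of_nat (n choose i) * x ^ i * (1 - x) ^ (n - i))
        - of_nat (n - i) * of_nat (n choose i) * (x ^ (i + 1) * (1 - x) ^ (n - (i + 1)))"
      unfolding xi by (simp add: algebra_simps)
    finally show ?thesis unfolding absorb by (simp add: poly_bernstein algebra_simps)
  qed
  then show ?thesis by (simp add: poly_eq_poly_eq_iff[symmetric] fun_eq_iff)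
qed

text \<open>Sequences that are finite linear combinations of n -> B_{n,i}, with indices
  \<open>i\<close> and constants that do not vary with \<open>n\<close>; only then do limits in
  \<open>n\<close> pass through the combination.\<close>

inductive bernstein_family :: "(nat \<Rightarrow> complex poly) \<Rightarrow> bool" where
  base: "bernstein_family (\<lambda>n. bernstein_poly n i)"
| add: "bernstein_family F \<Longrightarrow> bernstein_family G \<Longrightarrow> bernstein_family (\<lambda>n. F n + G n)"
| smult: "bernstein_family F \<Longrightarrow> bernstein_family (\<lambda>n. smult c (F n))"

lemma bernstein_family_euler: "bernstein_family F \<Longrightarrow> bernstein_family (\<lambda>n. euler_op (F n))"
proof (induction rule: bernstein_family.induct)
  case (base i)
  have "bernstein_family (\<lambda>n. smult (of_nat i) (bernstein_poly n i) + smult (- of_nat (i + 1)) (bernstein_poly n (i + 1)))"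
    by (intro bernstein_family.intros)
  then show ?case by (simp only: euler_op_bernstein diff_conv_add_uminus smult_minus_left)
qed (auto simp: euler_op_add euler_op_smult intro: bernstein_family.intros)

lemma bernstein_family_coeff_mult:
  assumes F: "bernstein_family F" shows "bernstein_family (\<lambda>n. coeff_mult D (F n))"
proof (induction D)
  case 0
  show ?case using bernstein_family.smult[OF F, of 0] by (simp add: coeff_mult_0)
next
  case (pCons c D)
  then show ?case unfolding coeff_mult_pCons
    by (intro bernstein_family.intros bernstein_family_euler F)
qed

lemma bernstein_family_1: "bernstein_family F \<Longrightarrow> eventually (\<lambda>n. poly (F n) 1 = 0) sequentially"
proof (induction rule: bernstein_family.induct)
  case (base i)
  show ?case using eventually_gt_at_top[of i] by eventually_elim (simp add: poly_bernstein)
next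
  case (add F G)
  from add.IH show ?case by eventually_elim simp
next
  case (smult F c)
  from smult.IH show ?case by eventually_elim simp
qed

lemma bernstein_bounds:
  fixes t :: real
  assumes "0 \<le> t" "t \<le> 1"
  shows "norm (poly (bernstein_poly n i) (of_real t)) \<le> 1"
proof -
  let ?b = "\<lambda>i. real (n choose i) * t ^ i * (1 - t) ^ (n - i)"
  have nn: "?b i \<ge> 0" for i using assms by simp
  have eq: "poly (bernstein_poly n i) (of_real t) = of_real (?b i)" by (simp add: poly_bernstein)
  show ?thesis
  proof (cases "i \<le> n")
    case True
    have "?b i \<le> (\<Sum>i\<le>n. ?b i)" using True nn by (intro member_le_sum) auto
    also have "\<dots> = (t + (1 - t)) ^ n" using binomial_ring[of t "1 - t" n] by simp
    finally show ?thesis using nn[of i] by (simp only: eq norm_of_real) simp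
  qed (simp add: eq binomial_eq_0)
qed

text \<open>With n = i + k the values are t^i times the terms of the binomial series for (1 - (1 -
  t))^(-(i+1)), which converges for 0 < t <= 1.\<close>

lemma bernstein_tendsto_0:
  fixes t :: real
  assumes "0 < t" "t \<le> 1"
  shows "(\<lambda>n. poly (bernstein_poly n i) (of_real t)) \<longlonglongrightarrow> 0"
proof (rule LIMSEQ_offset[where k=i])
  have "norm (of_real (1 - t) :: complex) < 1" using assms by (simp flip: of_real_diff)
  then have "summable (\<lambda>k. of_nat ((i + k) choose k) * of_real (1 - t) ^ k :: complex)"
    using neg_binomial_sums(1) sums_summable by blast
  then have "(\<lambda>k. of_real t ^ i * (of_nat ((i + k) choose k) * of_real (1 - t) ^ k :: complex)) \<longlonglongrightarrow> of_real t ^ i * 0"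
    by (intro tendsto_mult tendsto_const summable_LIMSEQ_zero)
  moreover have "(k + i) choose i = (i + k) choose k" for k
    using binomial_symmetric[of i "i + k"] by (simp add: add.commute)
  ultimately show "(\<lambda>k. poly (bernstein_poly (k + i) i) (of_real t)) \<longlonglongrightarrow> 0"
    by (simp add: poly_bernstein mult_ac)
qed

lemma integrable_bernstein:
  fixes G :: "'a \<Rightarrow> complex" and t :: "'a \<Rightarrow> real"
  assumes G: "integrable M G" and t: "t \<in> borel_measurable M" "\<And>x. 0 \<le> t x \<and> t x \<le> 1"
  shows "integrable M (\<lambda>x. G x * poly p (of_real (t x)))"
proof -
  have "integrable M (\<lambda>x. G x * of_real (t x ^ j))" for j
  proof (rule Bochner_Integration.integrable_bound[OF G])
    show "(\<lambda>x. G x * of_real (t x ^ j)) \<in> borel_measurable M" using borel_measurable_integrable[OF G] t(1) by measurable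
    show "AE x in M. norm (G x * of_real (t x ^ j)) \<le> norm (G x)"
      using t(2) by (auto simp: norm_mult norm_power intro!: mult_left_le power_le_one)
  qed
  then have "integrable M (\<lambda>x. \<Sum>j\<le>degree p. coeff p j * (G x * of_real (t x ^ j)))"
    by (intro Bochner_Integration.integrable_sum integrable_mult_right)
  then show ?thesis by (simp add: poly_altdef sum_distrib_left mult_ac)
qed

text \<open>Dominated convergence with majorant |G|. Points with t = 0 must be negligible, since
  B_{n,0} equals 1 there for all \<open>n\<close>.\<close>

lemma bernstein_family_integral:
  fixes G :: "'a \<Rightarrow> complex" and t :: "'a \<Rightarrow> real"
  assumes G: "integrable M G" and t: "t \<in> borel_measurable M" "\<And>x. 0 \<le> t x \<and> t x \<le> 1" "AE x in M. 0 < t x"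
    and F: "bernstein_family F"
  shows "(\<lambda>n. \<integral>x. G x * poly (F n) (of_real (t x)) \<partial>M) \<longlonglongrightarrow> 0"
  using F
proof (induction rule: bernstein_family.induct)
  case (base i)
  have "(\<lambda>n. \<integral>x. G x * poly (bernstein_poly n i) (of_real (t x)) \<partial>M) \<longlonglongrightarrow> (\<integral>x. 0 \<partial>M)"
  proof (rule integral_dominated_convergence[where w = "\<lambda>x. norm (G x)"])
    show "AE x in M. (\<lambda>n. G x * poly (bernstein_poly n i) (of_real (t x))) \<longlonglongrightarrow> 0"
      using t(3)
    proof eventually_elim
      case (elim x)
      have "(\<lambda>n. G x * poly (bernstein_poly n i) (of_real (t x))) \<longlonglongrightarrow> G x * 0"
        using elim t(2)[of x] by (intro tendsto_mult tendsto_const bernstein_tendsto_0) auto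
      then show ?case by simp
    qed
    show "AE x in M. norm (G x * poly (bernstein_poly n i) (of_real (t x))) \<le> norm (G x)" for n
      using t(2) by (auto simp: norm_mult intro!: mult_left_le bernstein_bounds)
  qed (use integrable_bernstein[OF G t(1,2)] G in \<open>auto dest: borel_measurable_integrable\<close>)
  then show ?case by simp
next
  case (add F1 F2)
  then show ?case using tendsto_add[OF add.IH] integrable_bernstein[OF G t(1,2)]
    by (simp add: distrib_left)
next
  case (smult F c)
  then show ?case using tendsto_mult[OF tendsto_const smult.IH, of c]
    by (simp add: mult.left_commute)
qed

text \<open>An analytic continuation argument without analyticity: \<open>1 - B n\<close> has no terms of degree below \<open>K\<close>, so the
assumed identities apply to it, while the Euler operator maps Bernstein polynomials of degree \<open>n\<close> to combinations
of such with coefficients independent of \<open>n\<close>, whose integrals vanish in the limit.\<close>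

lemma mellin_interpolation:
  fixes G :: "'a \<Rightarrow> complex" and t :: "'a \<Rightarrow> real" and D S :: "complex poly"
  assumes G: "integrable M G" and t: "t \<in> borel_measurable M" "\<And>x. 0 \<le> t x \<and> t x \<le> 1" "AE x in M. 0 < t x"
    and id: "\<And>j. K \<le> j \<Longrightarrow> poly D (of_nat j) * (\<integral>x. G x * of_real (t x ^ j) \<partial>M) = poly S (of_nat j)"
  shows "poly D 0 * (\<integral>x. G x \<partial>M) = poly S 0"
proof -
  define \<Lambda> where "\<Lambda> p = (\<integral>x. G x * poly p (of_real (t x)) \<partial>M)" for p
  note int = integrable_bernstein[OF G t(1,2)]
  have \<Lambda>_diff: "\<Lambda> (p - q) = \<Lambda> p - \<Lambda> q" for p q
    unfolding \<Lambda>_def using int by (simp add: right_diff_distrib)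
  have \<Lambda>_coeff: "\<Lambda> p = (\<Sum>j\<le>degree p. coeff p j * (\<integral>x. G x * of_real (t x ^ j) \<partial>M))" for p
  proof -
    have "\<Lambda> p = (\<integral>x. (\<Sum>j\<le>degree p. coeff p j * (G x * of_real (t x ^ j))) \<partial>M)"
      by (simp add: \<Lambda>_def poly_altdef sum_distrib_left mult_ac)
    also have "\<dots> = (\<Sum>j\<le>degree p. coeff p j * (\<integral>x. G x * of_real (t x ^ j) \<partial>M))"
      using int[of "monom 1 _"] by (subst Bochner_Integration.integral_sum) (auto simp: poly_monom)
    finally show ?thesis .
  qed
  define B where "B n = (\<Sum>i<K. bernstein_poly n i)" for n
  have famB: "bernstein_family (\<lambda>n. \<Sum>i<L. bernstein_poly n i)" for L
  proof (induction L)
    case 0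
    show ?case using bernstein_family.smult[OF bernstein_family.base, of 0] by simp
  next
    case (Suc L)
    then show ?case by (simp add: bernstein_family.intros)
  qed
  then have fam: "bernstein_family (\<lambda>n. coeff_mult E (B n))" for E
    unfolding B_def by (rule bernstein_family_coeff_mult)
  \<comment> \<open>Bernstein polynomials sum to 1, so 1 - B n is the sum over i >= K, and B_{n,i}
    is divisible by x^i.\<close>
  have low: "coeff (1 - B n) j = 0" if "j < K" "K \<le> n" for n j
  proof -
    have "{..n} - {..<K} = {K..n}" by auto
    then have "1 - B n = (\<Sum>i\<in>{K..n}. bernstein_poly n i)"
    proof -
      have "{..<K} \<subseteq> {..n}" using that by auto
      from sum.subset_diff[OF this finite_atMost, of "bernstein_poly n"] show ?thesis
        unfolding sum_bernstein_poly \<open>{..n} - {..<K} = {K..n}\<close> by (simp only: B_def diff_eq_eq)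
    qed
    moreover have "coeff (bernstein_poly n i) j = 0" if "i \<ge> K" for i
    proof -
      have "[:0, 1:] ^ i = (monom 1 i :: complex poly)" by (simp add: monom_altdef)
      then show ?thesis using that \<open>j < K\<close> by (simp add: bernstein_poly_def coeff_monom_mult)
    qed
    ultimately show ?thesis by (simp add: coeff_sum)
  qed
  have eq: "\<Lambda> (coeff_mult D (1 - B n)) = poly (coeff_mult S (1 - B n)) 1" if "K \<le> n" for n
  proof -
    define p where "p = 1 - B n"
    note dD = degree_coeff_mult_le[of _ p]
    have "\<Lambda> (coeff_mult D p) = (\<Sum>j\<le>degree p. coeff (coeff_mult D p) j * (\<integral>x. G x * of_real (t x ^ j) \<partial>M))"
      unfolding \<Lambda>_coeff using dD by (intro sum.mono_neutral_left) (auto simp: coeff_eq_0)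
    also have "\<dots> = (\<Sum>j\<le>degree p. coeff (coeff_mult S p) j)"
    proof (rule sum.cong)
      fix j
      show "coeff (coeff_mult D p) j * (\<integral>x. G x * of_real (t x ^ j) \<partial>M) = coeff (coeff_mult S p) j"
      proof (cases "j < K")
        case True
        then show ?thesis using low[OF True that, folded p_def] by (simp add: coeff_coeff_mult)
      next
        case False
        then show ?thesis using id[of j] by (simp add: coeff_coeff_mult)
      qed
    qed simp
    also have "\<dots> = (\<Sum>j\<le>degree (coeff_mult S p). coeff (coeff_mult S p) j)"
      using dD by (intro sum.mono_neutral_right) (auto simp: coeff_eq_0)
    finally show ?thesis by (simp add: poly_altdef p_def)
  qed
  have "(\<lambda>n. \<Lambda> (coeff_mult D 1) - \<Lambda> (coeff_mult D (B n))) \<longlonglongrightarrow> \<Lambda> (coeff_mult D 1) - 0"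
    unfolding \<Lambda>_def by (intro tendsto_diff tendsto_const bernstein_family_integral[OF G t fam])
  \<comment> \<open>On the right side \<open>coeff_mult S 1\<close> is the constant S(0), while the
    part coming from \<open>B n\<close> is a Bernstein family evaluated at 1 and vanishes for large
    \<open>n\<close>.\<close>
  moreover have "eventually (\<lambda>n. \<Lambda> (coeff_mult D 1) - \<Lambda> (coeff_mult D (B n)) = poly S 0) sequentially"
    using bernstein_family_1[OF fam, of S] eventually_ge_at_top[of K]
  proof eventually_elim
    case (elim n)
    show ?case using eq[OF elim(2)] elim(1) by (simp add: coeff_mult_diff \<Lambda>_diff coeff_mult_1)
  qed
  ultimately have "\<Lambda> (coeff_mult D 1) = poly S 0"
    using tendsto_unique[OF sequentially_bot _ tendsto_eventually] by (simp only: diff_zero)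
  then show ?thesis by (simp add: \<Lambda>_def coeff_mult_1 mult.commute)
qed

section \<open>Necessity of the degree bound\<close>

lemma poly_pochhammer: "poly (pochhammer p n) x = pochhammer (poly p x) n"
  by (induction n) (simp_all add: pochhammer_Suc)

lemma fact_mult_pochhammer: "(fact (j + n) :: 'a::field_char_0) = fact j * pochhammer (of_nat j + 1) n"
  by (induction n) (simp_all add: pochhammer_Suc algebra_simps)

lemma heval_bound:
  fixes x :: "complex^'n"
  shows "cmod (heval p q P x) \<le> (\<Sum>m\<in>bideg p q. cmod (P m)) * norm x ^ (p + q)"
proof -
  have "cmod (heval p q P x) \<le> (\<Sum>m\<in>bideg p q. cmod (P m) * norm x ^ (p + q))"
    unfolding heval_def
  proof (rule sum_norm_le)
    fix m :: "'n biindex"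
    assume "m \<in> bideg p q"
    then have "cmod (zzmonom m x) \<le> norm x ^ (p + q)"
      using cmod_zzmonom_le[of "fst m" "snd m" x] by (simp add: bideg_def)
    then show "cmod (P m * zzmonom m x) \<le> cmod (P m) * norm x ^ (p + q)"
      by (simp add: norm_mult mult_left_mono)
  qed
  then show ?thesis by (simp add: sum_distrib_right)
qed

text \<open>The test function is the conjugate of \<open>(normmul ^^ j) P\<close>. Solving
  \<open>h\<close> for the moments produces the weights \<open>mfact\<close>, which are those of the
  Fischer pairing, so the integral becomes the pairing of \<open>rcoef f\<close> with |z|^(2j) P,
  and \<open>fischer_pow_pow\<close> evaluates each summand of \<open>rcoef\<close>.\<close>

lemma moment_pairing:
  fixes u :: "complex^'n \<Rightarrow> complex" and P f :: "'n zzpoly"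
  defines "N \<equiv> CARD('n)"
  assumes u: "ball_integrable u"
    and h: "\<And>m. hcoef u m = of_real V * rcoef f m"
    and P: "is_bihom p q P" "lap P = (\<lambda>m. 0)"
  shows "ball_integral (\<lambda>x. u x * cnj (heval p q P x) * of_real (norm x ^ (2 * j)))
    = of_real (V * (fact N)\<^sup>2 / (fact (N + p + j) * fact (N + q + j))) *
      (\<Sum>i\<le>j. of_nat ((N + i) choose i) * of_real (fact j * fact (N - 1 + p + q + j) / (fact (j - i) * fact (N - 1 + p + q + j - i)))
          * fischer (p + (j - i)) (q + (j - i)) f ((normmul ^^ (j - i)) P))"
proof -
  let ?Q = "(normmul ^^ j) P"
  let ?B = "bideg (p + j) (q + j)"
  let ?c = "V * (fact N)\<^sup>2 / (fact (N + p + j) * fact (N + q + j))"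
  have mom: "moment u m = of_real (?c * (mfact (fst m) * mfact (snd m))) * rcoef f m" if "m \<in> ?B" for m
  proof -
    let ?w = "fact (N + p + j) * fact (N + q + j) / ((fact N)\<^sup>2 * (mfact (fst m) * mfact (snd m)))"
    have pos: "mfact (fst m) > 0" "mfact (snd m) > 0" by (simp_all add: mfact_pos)
    have "hcoef u m = of_real ?w * moment u m"
      using that by (simp add: hcoef_def N_def bideg_def add.assoc)
    then have "of_real ?w * moment u m = of_real V * rcoef f m" by (simp only: h)
    moreover have "fact (N + p + j) * fact (N + q + j) \<noteq> (0::real)" "(fact N)\<^sup>2 \<noteq> (0::real)"
      "mfact (fst m) * mfact (snd m) \<noteq> 0" using pos by simp_all
    moreover have "M = of_real (V * F / W * X) * R" if "of_real (W / (F * X)) * M = of_real V * R" "W \<noteq> 0" "F \<noteq> 0" "X \<noteq> 0"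
      for M R :: complex and V W F X :: real
      using that by (simp add: field_simps)
    ultimately show ?thesis by blast
  qed
  have "ball_integral (\<lambda>x. u x * cnj (heval p q P x) * of_real (norm x ^ (2 * j)))
    = ball_integral (\<lambda>x. \<Sum>m\<in>?B. cnj (?Q m) * (u x * cnj (zzmonom m x)))"
  proof (rule arg_cong[where f = "ball_integral"], rule ext)
    fix x :: "complex^'n"
    have e: "cnj (heval p q P x) * of_real (norm x ^ (2 * j)) = cnj (heval (p + j) (q + j) ?Q x)"
      by (simp add: heval_normmul_pow mult.commute)
    show "u x * cnj (heval p q P x) * of_real (norm x ^ (2 * j)) = (\<Sum>m\<in>?B. cnj (?Q m) * (u x * cnj (zzmonom m x)))"
      unfolding mult.assoc e by (simp add: heval_def sum_distrib_left mult_ac)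
  qed
  also have "\<dots> = (\<Sum>m\<in>?B. cnj (?Q m) * moment u m)"
    unfolding set_lebesgue_integral_def scaleR_sum_right moment_def
  proof (subst Bochner_Integration.integral_sum)
    show "integrable lebesgue (\<lambda>x. indicat_real unit_ball x *\<^sub>R (cnj (?Q m) * (u x * cnj (zzmonom m x))))" for m
      using set_integrable_mult_right[of "cnj (?Q m)" lebesgue unit_ball "\<lambda>x. u x * cnj (zzmonom m x)"] set_integrable_zzmonom[OF u]
      by (simp add: set_integrable_def)
  qed (simp add: mult_scaleR_right[symmetric] del: mult_scaleR_right)
  also have "\<dots> = (\<Sum>m\<in>?B. of_real ?c * (\<Sum>i\<le>p + j. of_nat ((N + i) choose i) * (of_real (mfact (fst m) * mfact (snd m)) * (normmul ^^ i) f m * cnj (?Q m))))"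
    by (intro sum.cong refl) (simp add: mom, simp add: rcoef_def bideg_def N_def sum_distrib_left mult_ac)
  also have "\<dots> = of_real ?c * (\<Sum>i\<le>p + j. of_nat ((N + i) choose i) * fischer (p + j) (q + j) ((normmul ^^ i) f) ?Q)"
    unfolding fischer_def sum_distrib_left by (subst sum.swap) simp
  also have "(\<Sum>i\<le>p + j. of_nat ((N + i) choose i) * fischer (p + j) (q + j) ((normmul ^^ i) f) ?Q)
    = (\<Sum>i\<le>j. of_nat ((N + i) choose i) * fischer (p + j) (q + j) ((normmul ^^ i) f) ?Q)"
    by (rule sum.mono_neutral_right) (auto simp: fischer_pow_pow[OF P])
  also have "\<dots> = (\<Sum>i\<le>j. of_nat ((N + i) choose i) * of_real (fact j * fact (N - 1 + p + q + j) / (fact (j - i) * fact (N - 1 + p + q + j - i)))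
          * fischer (p + (j - i)) (q + (j - i)) f ((normmul ^^ (j - i)) P))"
    by (intro sum.cong refl) (simp add: fischer_pow_pow[OF P] N_def)
  finally show ?thesis .
qed

text \<open>Denominators are cleared so that \<open>j\<close> enters only through Pochhammer
  symbols, which make sense at arbitrary complex arguments. The normalization of \<open>A\<close>
  puts all dependence on \<open>j\<close> of the k-th summand into (j-k+1)_N. The quotient
  (N-1+p+q+j)! / (N+q+j)! is a Pochhammer symbol of length p - 1 if p >= 1, but 1 / (N+q+j) if p =
  0; hence the case distinction.\<close>

lemma moment_pairing_pochhammer:
  fixes u :: "complex^'n \<Rightarrow> complex" and P f :: "'n zzpoly" and p q :: nat
  defines "N \<equiv> CARD('n)"
  defines "A \<equiv> \<lambda>k. fischer (p + k) (q + k) f ((normmul ^^ k) P) / of_real (fact k * fact (N - 1 + p + q + k))"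
  assumes u: "ball_integrable u"
    and h: "\<And>m. hcoef u m = of_real V * rcoef f m"
    and P: "is_bihom p q P" "lap P = (\<lambda>m. 0)"
  shows "pochhammer (of_nat j + 1) (N + p) * (if p = 0 then of_nat (N + q) + of_nat j else 1) *
      ball_integral (\<lambda>x. u x * cnj (heval p q P x) * of_real (norm x ^ (2 * j)))
    = of_real (V * fact N) * pochhammer (of_nat (N + q) + of_nat j + 1) (p - 1) *
      (\<Sum>k\<le>j. A k * pochhammer (of_nat (j - k) + 1) N)"
proof -
  have N: "N \<ge> 1" by (simp add: N_def Suc_le_eq card_gt_0_iff)
  define U where "U = ball_integral (\<lambda>x. u x * cnj (heval p q P x) * of_real (norm x ^ (2 * j)))"
  have fr: "of_nat ((N + i) choose i) = (pochhammer (of_nat i + 1) N / fact N :: complex)" for i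
    using fact_mult_pochhammer[of i N, where 'a=complex] binomial_fact[of i "N + i", where 'a=complex]
    by (simp add: add.commute)
  have "U = of_real (V * (fact N)\<^sup>2 / (fact (N + p + j) * fact (N + q + j))) *
      (\<Sum>i\<le>j. of_real (fact j * fact (N - 1 + p + q + j) / fact N) * (A (j - i) * pochhammer (of_nat i + 1) N))"
    unfolding U_def moment_pairing[OF u h P, folded N_def]
  proof (rule arg_cong2[where f="(*)", OF refl], rule sum.cong[OF refl])
    fix i assume "i \<in> {..j}"
    then have e: "N - 1 + p + q + j - i = N - 1 + p + q + (j - i)" by simp
    show "of_nat ((N + i) choose i) * of_real (fact j * fact (N - 1 + p + q + j) / (fact (j - i) * fact (N - 1 + p + q + j - i)))
          * fischer (p + (j - i)) (q + (j - i)) f ((normmul ^^ (j - i)) P)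
        = of_real (fact j * fact (N - 1 + p + q + j) / fact N) * (A (j - i) * pochhammer (of_nat i + 1) N)"
      unfolding fr A_def e by simp
  qed
  also have "\<dots> = of_real (V * (fact N)\<^sup>2 / (fact (N + p + j) * fact (N + q + j)) * (fact j * fact (N - 1 + p + q + j) / fact N)) *
      (\<Sum>i\<le>j. A (j - i) * pochhammer (of_nat i + 1) N)"
    by (simp only: sum_distrib_left[symmetric] of_real_mult mult.assoc)
  also have "(\<Sum>i\<le>j. A (j - i) * pochhammer (of_nat i + 1) N) = (\<Sum>k\<le>j. A k * pochhammer (of_nat (j - k) + 1) N)"
    by (rule sum.reindex_bij_witness[of _ "\<lambda>i. j - i" "\<lambda>i. j - i"]) auto
  finally have U: "U = of_real (V * (fact N)\<^sup>2 / (fact (N + p + j) * fact (N + q + j)) * (fact j * fact (N - 1 + p + q + j) / fact N)) *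
      (\<Sum>k\<le>j. A k * pochhammer (of_nat (j - k) + 1) N)" .
  have f1: "(fact (N + p + j) :: complex) = fact j * pochhammer (of_nat j + 1) (N + p)"
    using fact_mult_pochhammer[of j "N + p"] by (simp add: add_ac)
  have nz: "pochhammer (of_nat j + 1) (N + p) \<noteq> (0::complex)"
    using f1 by (metis fact_nonzero mult_eq_0_iff)
  have f2: "(if p = 0 then of_nat (N + q) + of_nat j else 1) * fact (N - 1 + p + q + j)
     = (fact (N + q + j) * pochhammer (of_nat (N + q) + of_nat j + 1) (p - 1) :: complex)"
  proof (cases p)
    case 0
    obtain N' where N': "N = Suc N'" using N by (metis Suc_le_D One_nat_def)
    show ?thesis by (simp add: 0 N' algebra_simps)
  next
    case (Suc p')
    have "N - 1 + p + q + j = (N + q + j) + p'" using Suc N by simp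
    then show ?thesis using fact_mult_pochhammer[of "N + q + j" p', where 'a=complex] Suc by (simp add: add_ac)
  qed
  have "pochhammer (of_nat j + 1) (N + p) * (if p = 0 then of_nat (N + q) + of_nat j else 1) *
      of_real (V * (fact N)\<^sup>2 / (fact (N + p + j) * fact (N + q + j)) * (fact j * fact (N - 1 + p + q + j) / fact N))
    = of_real (V * fact N) * (pochhammer (of_nat j + 1) (N + p) * fact j / fact (N + p + j)) *
       ((if p = 0 then of_nat (N + q) + of_nat j else 1) * fact (N - 1 + p + q + j) / fact (N + q + j) :: complex)"
    by (simp add: power2_eq_square del: of_nat_add)
  also have "\<dots> = of_real (V * fact N) * pochhammer (of_nat (N + q) + of_nat j + 1) (p - 1)"
    unfolding f1 f2 using nz by simp
  finally show ?thesis unfolding U_def[symmetric] U by (simp only: mult.assoc[symmetric])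
qed

lemma pochhammer_minus_eq_0:
  assumes "1 \<le> n" "d \<le> n - 1" shows "pochhammer (- of_nat d :: complex) n = 0"
  using assms by (auto simp: pochhammer_eq_0_iff intro!: exI[of _ d])

lemma is_bihom_lap_pow: "is_bihom k l c \<Longrightarrow> is_bihom (k - i) (l - i) ((lap ^^ i) c)"
  by (induction i) (use is_bihom_lap in fastforce)+

lemma lap_pow_exhaust:
  assumes c: "is_bihom k l c" and nz: "c \<noteq> (\<lambda>m. 0)"
  obtains i where "i \<le> k" "i \<le> l" "(lap ^^ i) c \<noteq> (\<lambda>m. 0)" "lap ((lap ^^ i) c) = (\<lambda>m. 0)"
proof -
  have z: "(lap ^^ Suc i) c = (\<lambda>m. 0)" if "k \<le> i \<or> l \<le> i" for i
    using lap_bihom_zero[OF is_bihom_lap_pow[OF c, of i]] that by auto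
  define i where "i = (LEAST i. (lap ^^ Suc i) c = (\<lambda>m. 0))"
  have i: "(lap ^^ Suc i) c = (\<lambda>m. 0)"
    unfolding i_def by (rule LeastI[where P = "\<lambda>i. (lap ^^ Suc i) c = (\<lambda>m. 0)", OF z[of k]]) simp
  have min: "(lap ^^ Suc j) c \<noteq> (\<lambda>m. 0)" if "j < i" for j
    using not_less_Least[of j "\<lambda>i. (lap ^^ Suc i) c = (\<lambda>m. 0)"] that by (simp add: i_def)
  have "i \<le> k" "i \<le> l"
    unfolding i_def by (rule Least_le[where P = "\<lambda>i. (lap ^^ Suc i) c = (\<lambda>m. 0)"], rule z, simp)+
  moreover have "(lap ^^ i) c \<noteq> (\<lambda>m. 0)"
    using min[of "i - 1"] nz by (cases i) auto
  moreover have "lap ((lap ^^ i) c) = (\<lambda>m. 0)" using i by simp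
  ultimately show ?thesis by (rule that)
qed

text \<open>Only mixed monomials compete for the maximal total degree. The pairing with |z|^(2i) P
  sees \<open>f\<close> in bidegree (p + i, q + i) alone, so maximality makes i = k the last index
  with a nonzero coefficient.\<close>

lemma berezin_range_degree:
  fixes u :: "complex^'n \<Rightarrow> complex" and f :: "'n zzpoly"
  assumes u: "ball_integrable u" and f: "is_zzpoly f"
    and fu: "\<forall>z\<in>unit_ball. zzeval f z = berezin u z"
    and m0: "f m0 \<noteq> 0" "mdeg (fst m0) \<ge> 1" "mdeg (snd m0) \<ge> 1"
  shows "mdeg (fst m0) + mdeg (snd m0) \<le> 2 * CARD('n) + 1"
proof (rule ccontr)
  assume big: "\<not> mdeg (fst m0) + mdeg (snd m0) \<le> 2 * CARD('n) + 1"
  define N where "N = CARD('n)"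
  define V where "V = measure lebesgue (unit_ball :: (complex^'n) set)"
  have V: "V > 0" by (simp add: V_def measure_unit_ball)
  have N: "N \<ge> 1" by (simp add: N_def Suc_le_eq card_gt_0_iff)
  have hr: "hcoef u m = of_real V * rcoef f m" for m
    using berezin_moment_iff[OF u f, THEN iffD1, OF fu] unfolding V_def by (rule spec)
  define T where "T m = mdeg (fst m) + mdeg (snd m)" for m :: "'n biindex"
  define B where "B = {m. f m \<noteq> 0 \<and> mdeg (fst m) \<ge> 1 \<and> mdeg (snd m) \<ge> 1}"
  have finB: "finite B" using f unfolding is_zzpoly_def B_def by (rule rev_finite_subset) auto
  have "m0 \<in> B" using m0 by (simp add: B_def)
  then obtain m1 where m1: "m1 \<in> B" and max: "\<And>m. m \<in> B \<Longrightarrow> T m \<le> T m1"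
    using finB by (metis (mono_tags, lifting) Max_ge Max_in empty_iff finite_imageI imageE image_eqI)
  define p' where "p' = mdeg (fst m1)"
  define q' where "q' = mdeg (snd m1)"
  have pq': "p' \<ge> 1" "q' \<ge> 1" "p' + q' \<ge> 2 * N + 2"
    using m1 max[OF \<open>m0 \<in> B\<close>] big by (auto simp: B_def p'_def q'_def T_def N_def)
  define f0 where "f0 m = (if m \<in> bideg p' q' then f m else 0)" for m
  have f0: "is_bihom p' q' f0" by (simp add: is_bihom_def f0_def)
  have "f0 m1 \<noteq> 0" using m1 by (simp add: f0_def B_def bideg_def p'_def q'_def)
  then have f0nz: "f0 \<noteq> (\<lambda>m. 0)" by auto
  obtain k where k: "k \<le> p'" "k \<le> q'" "(lap ^^ k) f0 \<noteq> (\<lambda>m. 0)" "lap ((lap ^^ k) f0) = (\<lambda>m. 0)"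
    using lap_pow_exhaust[OF f0 f0nz] by metis
  define P where "P = (lap ^^ k) f0"
  define p where "p = p' - k"
  define q where "q = q' - k"
  have pk: "p + k = p'" "q + k = q'" using k by (simp_all add: p_def q_def)
  have P: "is_bihom p q P" "lap P = (\<lambda>m. 0)"
    using is_bihom_lap_pow[OF f0, of k] k by (simp_all add: P_def p_def q_def)
  define A where "A i = fischer (p + i) (q + i) f ((normmul ^^ i) P) / of_real (fact i * fact (N - 1 + p + q + i))" for i
  \<comment> \<open>By adjointness the pairing with |z|^(2k) P is, up to conjugation, that of
    \<open>P\<close> with the k-th Laplacian of \<open>f0\<close>, which is \<open>P\<close>
    itself.\<close>
  have Ak: "A k \<noteq> 0"
  proof -
    have "fischer (p + k) (q + k) f ((normmul ^^ k) P) = fischer (p + k) (q + k) f0 ((normmul ^^ k) P)"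
      unfolding fischer_def by (intro sum.cong refl) (simp add: f0_def pk)
    also have "\<dots> = cnj (fischer p q P ((lap ^^ k) f0))"
      by (subst fischer_cnj) (simp add: fischer_adjoint_pow)
    also have "\<dots> \<noteq> 0" using fischer_pos[OF P(1)] k(3) by (simp add: P_def)
    finally show ?thesis by (simp add: A_def)
  qed
  \<comment> \<open>For i > k the bidegree is mixed even if p or q is 0, so the maximality of
    \<open>T m1\<close> applies to it.\<close>
  have Abig: "A i = 0" if "i > k" for i
  proof -
    have "f m = 0" if m: "m \<in> bideg (p + i) (q + i)" for m
    proof (rule ccontr)
      assume "f m \<noteq> 0"
      then have "m \<in> B" using m \<open>i > k\<close> by (simp add: B_def bideg_def)
      from max[OF this] show False using m \<open>i > k\<close> pk by (simp add: T_def bideg_def p'_def[symmetric] q'_def[symmetric])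
    qed
    then show ?thesis by (simp add: A_def fischer_def)
  qed
  define h where "h x = cnj (heval p q P x)" for x
  define U where "U j = ball_integral (\<lambda>x. u x * h x * of_real (norm x ^ (2 * j)))" for j
  note rel = moment_pairing_pochhammer[OF u hr P, folded N_def, folded A_def, folded h_def, folded U_def]
  \<comment> \<open>both sides of \<open>rel\<close> at \<open>j = s0 + x\<close> as polynomials in \<open>x\<close>; \<open>s0\<close> may be a negative integer\<close>
  define s0 where "s0 = (of_nat k - of_nat N - 1 :: complex)"
  define D where "D = pochhammer [:s0 + 1, 1:] (N + p) * (if p = 0 then [:of_nat (N + q) + s0, 1:] else 1)"
  define S where "S = smult (of_real (V * fact N)) (pochhammer [:of_nat (N + q) + s0 + 1, 1:] (p - 1) *
     (\<Sum>i\<le>k. smult (A i) (pochhammer [:s0 - of_nat i + 1, 1:] N)))"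
  have DS: "poly D x = pochhammer (s0 + x + 1) (N + p) * (if p = 0 then of_nat (N + q) + (s0 + x) else 1)"
    "poly S x = of_real (V * fact N) * pochhammer (of_nat (N + q) + (s0 + x) + 1) (p - 1) * (\<Sum>i\<le>k. A i * pochhammer (s0 + x - of_nat i + 1) N)" for x
    by (simp_all add: D_def S_def poly_pochhammer poly_sum algebra_simps)
  \<comment> \<open>The integrand of \<open>U\<close> with exponent k - N - 1 in place of j, written
    as a quotient because this number may be negative. The value that division by zero assigns at
    the origin is irrelevant almost everywhere.\<close>
  define G where "G x = indicator unit_ball x *\<^sub>R (u x * (h x * of_real (norm x ^ (2 * k) / norm x ^ (2 * N + 2))))" for x
  \<comment> \<open>Clipping at 1 provides the global bounds required by the interpolation;
    \<open>t x\<close> differs from |x|^2 only where \<open>G\<close> vanishes.\<close>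
  define t where "t x = min 1 ((norm x)\<^sup>2)" for x :: "complex^'n"
  have hm: "h \<in> borel_measurable borel"
    unfolding h_def heval_def zzmonom_def by (intro borel_measurable_continuous_onI continuous_intros)
  have Gi: "integrable lebesgue G"
    unfolding G_def set_integrable_def[symmetric]
  proof (rule set_integrable_mult_bounded[OF u])
    show "(\<lambda>x. h x * of_real (norm x ^ (2 * k) / norm x ^ (2 * N + 2))) \<in> borel_measurable borel"
      using hm by measurable
    fix x :: "complex^'n" assume x: "x \<in> unit_ball"
    define C where "C = (\<Sum>m\<in>bideg p q. cmod (P m))"
    have C: "C \<ge> 0" by (simp add: C_def sum_nonneg)
    have "norm (h x * of_real (norm x ^ (2 * k) / norm x ^ (2 * N + 2))) \<le> C * norm x ^ (p + q) * (norm x ^ (2 * k) / norm x ^ (2 * N + 2))"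
      unfolding norm_mult norm_of_real h_def C_def using heval_bound[of p q P x]
      by (intro mult_mono) (auto intro!: mult_nonneg_nonneg sum_nonneg)
    also have "\<dots> = C * (norm x ^ (p + q + 2 * k) / norm x ^ (2 * N + 2))" by (simp add: power_add)
    also have "\<dots> \<le> C * 1"
    proof (intro mult_left_mono C)
      have "norm x ^ (p + q + 2 * k) \<le> norm x ^ (2 * N + 2)"
        using x pk pq' by (intro power_decreasing) auto
      then show "norm x ^ (p + q + 2 * k) / norm x ^ (2 * N + 2) \<le> 1"
        by (intro divide_le_eq_1[THEN iffD2]) (auto simp: zero_less_power)
    qed
    finally show "norm (h x * of_real (norm x ^ (2 * k) / norm x ^ (2 * N + 2))) \<le> C * 1" .
  qed
  have AE0: "AE x in lebesgue. x \<noteq> (0 :: complex^'n)"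
    using AE_completion[OF AE_lborel_neq[of "0 :: complex^'n"]] .
  have GU: "(\<integral>x. G x * of_real (t x ^ i) \<partial>lebesgue) = U (k + i - N - 1)" if i: "N + 1 \<le> k + i" for i
    unfolding U_def set_lebesgue_integral_def
  proof (rule integral_cong_AE)
    show "(\<lambda>x. G x * of_real (t x ^ i)) \<in> borel_measurable lebesgue"
    proof -
      have "(\<lambda>x. of_real (t x ^ i) :: complex) \<in> borel_measurable lebesgue"
        unfolding t_def by (intro measurable_completion) measurable
      then show ?thesis using borel_measurable_integrable[OF Gi] by measurable
    qed
    show "(\<lambda>x. indicat_real unit_ball x *\<^sub>R (u x * h x * of_real (norm x ^ (2 * (k + i - N - 1))))) \<in> borel_measurable lebesgue"
    proof -
      have "(\<lambda>x. h x * of_real (norm x ^ (2 * (k + i - N - 1)))) \<in> borel_measurable lebesgue"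
        using borel_measurable_times[OF hm, of "\<lambda>x. of_real (norm x ^ (2 * (k + i - N - 1)))"]
        by (intro measurable_completion) (simp add: borel_measurable_continuous_onI continuous_intros)
      from borel_measurable_times[OF borel_measurable_integrable[OF u[unfolded set_integrable_def]] this]
      show ?thesis by (simp add: mult.assoc)
    qed
    show "AE x in lebesgue. G x * of_real (t x ^ i) = indicat_real unit_ball x *\<^sub>R (u x * h x * of_real (norm x ^ (2 * (k + i - N - 1))))"
      using AE0
    proof eventually_elim
      case (elim x)
      show ?case
      proof (cases "x \<in> unit_ball")
        case True
        then have t: "t x = (norm x)\<^sup>2" by (simp add: t_def abs_square_le_1)
        have "norm x ^ (2 * k) / norm x ^ (2 * N + 2) * ((norm x)\<^sup>2) ^ i = norm x ^ (2 * (k + i - N - 1))"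
        proof -
          have "norm x ^ (2 * k) * ((norm x)\<^sup>2) ^ i = norm x ^ (2 * (k + i - N - 1)) * norm x ^ (2 * N + 2)"
          proof -
            have e: "2 * k + 2 * i = 2 * (k + i - N - 1) + (2 * N + 2)" using i by simp
            show ?thesis by (simp only: power_mult[symmetric] power_add[symmetric] e)
          qed
          then show ?thesis using elim by (simp add: field_simps)
        qed
        then have "of_real (norm x ^ (2 * k) / norm x ^ (2 * N + 2)) * of_real (t x ^ i) = (of_real (norm x ^ (2 * (k + i - N - 1))) :: complex)"
          unfolding t by (metis of_real_mult)
        then show ?thesis using True by (simp only: G_def indicator_simps if_True scaleR_one mult.assoc)
      qed (simp add: G_def)
    qed
  qed
  have key: "poly D 0 * (\<integral>x. G x \<partial>lebesgue) = poly S 0"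
  \<comment> \<open>From i = N + 1 on, the exponent j = k + i - N - 1 is at least k, so the sum over
    indices up to j may be cut at k and is a polynomial.\<close>
  proof (rule mellin_interpolation[OF Gi, where t=t and K="N+1"])
    show "t \<in> borel_measurable lebesgue" unfolding t_def by (intro measurable_completion) measurable
    show "0 \<le> t x \<and> t x \<le> 1" for x by (simp add: t_def)
    show "AE x in lebesgue. 0 < t x" using AE0 by eventually_elim (simp add: t_def)
    fix i assume i: "N + 1 \<le> i"
    define j where "j = k + i - N - 1"
    have sj: "s0 + of_nat i = of_nat j" using i by (simp add: s0_def j_def of_nat_diff)
    have kj: "k \<le> j" using i by (simp add: j_def)
    have "poly D (of_nat i) * (\<integral>x. G x * of_real (t x ^ i) \<partial>lebesgue) = poly D (of_nat i) * U j"
      using GU[of i] i by (simp add: j_def)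
    also have "\<dots> = of_real (V * fact N) * pochhammer (of_nat (N + q) + of_nat j + 1) (p - 1) * (\<Sum>i\<le>j. A i * pochhammer (of_nat (j - i) + 1) N)"
      unfolding DS sj by (rule rel)
    also have "(\<Sum>i\<le>j. A i * pochhammer (of_nat (j - i) + 1) N) = (\<Sum>i\<le>k. A i * pochhammer (of_nat (j - i) + 1) N)"
      using kj Abig by (intro sum.mono_neutral_right) auto
    also have "\<dots> = (\<Sum>i\<le>k. A i * pochhammer (of_nat j - of_nat i + 1) N)"
      using kj by (intro sum.cong refl) (simp add: of_nat_diff)
    finally show "poly D (of_nat i) * (\<integral>x. G x * of_real (t x ^ i) \<partial>lebesgue) = poly S (of_nat i)"
      unfolding DS sj .
  qed
  \<comment> \<open>The base is -(N - (k - i)), between -(N - 1) and 0, so one of the N factors is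
    zero. The index i = k has base -N and just escapes.\<close>
  have van: "pochhammer (s0 - of_nat i + 1) N = 0" if "i < k" "k \<le> i + N" for i
  proof -
    have e: "s0 - of_nat i + 1 = - of_nat (N - (k - i))" using that by (simp add: s0_def of_nat_diff)
    have "N - (k - i) \<le> N - 1" using that by linarith
    then show ?thesis unfolding e by (rule pochhammer_minus_eq_0[OF N])
  qed
  have pN: "pochhammer (s0 - of_nat k + 1) N \<noteq> 0"
    by (simp add: s0_def pochhammer_eq_0_iff)
  \<comment> \<open>The base N + q + s0 + 1 equals q + k = q', a positive integer.\<close>
  have front: "of_real (V * fact N) * pochhammer (of_nat (N + q) + s0 + 1) (p - 1) \<noteq> 0"
  proof -
    have "of_nat (N + q) + s0 + 1 = of_nat q'" unfolding pk(2)[symmetric] by (simp add: s0_def)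
    moreover have "pochhammer (of_nat q' :: complex) (p - 1) \<noteq> 0"
    proof
      assume "pochhammer (of_nat q' :: complex) (p - 1) = 0"
      then obtain i where "(of_nat q' :: complex) = - of_nat i" unfolding pochhammer_eq_0_iff by blast
      then have "of_nat (q' + i) = (0 :: complex)" by simp
      then show False using pq'(2) by (simp only: of_nat_eq_0_iff)
    qed
    ultimately show ?thesis using V by simp
  qed
  show False
  proof (cases "k \<le> N")
    case True
    \<comment> \<open>The pole: \<open>D\<close> vanishes at 0. When k = 0 the base is -N, and the
      symbol has more than N factors only because p = p' >= 1, that is, because the monomial is
      mixed.\<close>
    have "pochhammer (s0 + 1) (N + p) = 0"
    proof -
      have e: "s0 + 1 = - of_nat (N - k)" using True by (simp add: s0_def of_nat_diff)
      have "1 \<le> N + p" "N - k \<le> N + p - 1" using N True pk pq' by linarith+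
      then show ?thesis unfolding e by (rule pochhammer_minus_eq_0)
    qed
    then have "poly S 0 = 0" using key DS(1)[of 0] by simp
    moreover have "(\<Sum>i\<le>k. A i * pochhammer (s0 - of_nat i + 1) N) = A k * pochhammer (s0 - of_nat k + 1) N"
      using True van by (subst sum.remove[of _ k]) (auto intro!: sum.neutral)
    ultimately show False using DS(2)[of 0] front Ak pN by simp
  next
    case False
    \<comment> \<open>Now \<open>s0\<close> is a genuine exponent, and the moment identity holds at
      it with the sum over i <= j. Interpolation gives the sum over i <= k; the two differ exactly
      by the nonzero term i = k.\<close>
    define j where "j = k - N - 1"
    have j: "s0 = of_nat j" "j < k" using False by (simp_all add: s0_def j_def of_nat_diff)
    have "(\<integral>x. G x \<partial>lebesgue) = U j" using GU[of 0] False by (simp add: j_def)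
    then have "poly S 0 = poly D 0 * U j" using key by simp
    also have "\<dots> = of_real (V * fact N) * pochhammer (of_nat (N + q) + of_nat j + 1) (p - 1) * (\<Sum>i\<le>j. A i * pochhammer (of_nat (j - i) + 1) N)"
      using DS(1)[of 0] rel[of j] by (simp only: j(1) add_0_right)
    finally have "(\<Sum>i\<le>k. A i * pochhammer (s0 - of_nat i + 1) N) = (\<Sum>i\<le>j. A i * pochhammer (of_nat (j - i) + 1) N)"
      using DS(2)[of 0] front by (simp only: j(1) add_0_right mult_cancel_left) simp
    also have "\<dots> = (\<Sum>i\<le>j. A i * pochhammer (s0 - of_nat i + 1) N)"
      by (intro sum.cong refl) (simp add: j(1) of_nat_diff)
    finally have "(\<Sum>i\<in>{..k} - {..j}. A i * pochhammer (s0 - of_nat i + 1) N) = 0"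
      using j(2) by (subst sum_diff) auto
    moreover have "(\<Sum>i\<in>{..k} - {..j}. A i * pochhammer (s0 - of_nat i + 1) N) = A k * pochhammer (s0 - of_nat k + 1) N"
    proof -
      have "pochhammer (s0 - of_nat i + 1) N = 0" if "i \<in> {..k} - {..j} - {k}" for i
        using that by (intro van) (auto simp: j_def)
      then have "(\<Sum>i\<in>{..k} - {..j} - {k}. A i * pochhammer (s0 - of_nat i + 1) N) = 0"
        by (intro sum.neutral) simp
      then show ?thesis using j(2) by (subst sum.remove[of _ k]) simp_all
    qed
    ultimately show False using Ak pN by simp
  qed
qed

section \<open>Preimages of monomials\<close>

text \<open>\<open>r\<close> is the Laplace transform of \<open>w\<close> on the half line \<open>x > - k\<close>.\<close>

inductive mellin_pair :: "real \<Rightarrow> (real \<Rightarrow> real) \<Rightarrow> (real \<Rightarrow> real) \<Rightarrow> bool" for k where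
  base: "k \<le> c \<Longrightarrow> mellin_pair k (\<lambda>y. y ^ j * exp (- c * y)) (\<lambda>x. fact j / (x + c) ^ (j + 1))"
| add: "mellin_pair k v r \<Longrightarrow> mellin_pair k w s \<Longrightarrow> mellin_pair k (\<lambda>y. v y + w y) (\<lambda>x. r x + s x)"
| smult: "mellin_pair k v r \<Longrightarrow> mellin_pair k (\<lambda>y. a * v y) (\<lambda>x. a * r x)"

text \<open>Read off from the moments of the exponential distribution, which is the Erlang
  distribution with index 0.\<close>

lemma has_bochner_integral_power_exp:
  fixes l :: real
  assumes "l > 0"
  shows "has_bochner_integral lborel (\<lambda>y. indicator {0<..} y * (y ^ j * exp (- l * y))) (fact j / l ^ (j + 1))"
proof (rule has_bochner_integral_nn_integral)
  have "(\<integral>\<^sup>+y. ennreal (erlang_density 0 l y * y ^ j) \<partial>lborel) = ennreal l * (\<integral>\<^sup>+y. ennreal (indicator {0<..} y * (y ^ j * exp (- l * y))) \<partial>lborel)"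
  proof (subst nn_integral_cmult[symmetric])
    show "(\<integral>\<^sup>+y. ennreal (erlang_density 0 l y * y ^ j) \<partial>lborel) = (\<integral>\<^sup>+y. ennreal l * ennreal (indicator {0<..} y * (y ^ j * exp (- l * y))) \<partial>lborel)"
    proof (rule nn_integral_cong_AE)
      show "AE y in lborel. ennreal (erlang_density 0 l y * y ^ j) = ennreal l * ennreal (indicator {0<..} y * (y ^ j * exp (- l * y)))"
        using AE_lborel_neq[of "0::real"]
      proof eventually_elim
        case (elim y)
        then show ?case using assms
          by (cases "0 < y") (auto simp: erlang_density_def mult_ac simp flip: ennreal_mult')
      qed
    qed
  qed measurable
  moreover have "(\<integral>\<^sup>+y. ennreal (erlang_density 0 l y * y ^ j) \<partial>lborel) = ennreal (fact j / l ^ j)"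
    using nn_integral_erlang_ith_moment[OF assms, of 0 j] by simp
  ultimately have eq: "ennreal l * (\<integral>\<^sup>+y. ennreal (indicator {0<..} y * (y ^ j * exp (- l * y))) \<partial>lborel) = ennreal (fact j / l ^ j)"
    by simp
  have "ennreal (1 / l) * ennreal l = 1" using assms by (simp flip: ennreal_mult')
  then have "(\<integral>\<^sup>+y. ennreal (indicator {0<..} y * (y ^ j * exp (- l * y))) \<partial>lborel) = ennreal (1 / l) * ennreal (fact j / l ^ j)"
    unfolding eq[symmetric] mult.assoc[symmetric] by simp
  also have "\<dots> = ennreal (1 / l * (fact j / l ^ j))" using assms by (subst ennreal_mult') simp_all
  also have "1 / l * (fact j / l ^ j) = fact j / l ^ (j + 1)" by simp
  finally show "(\<integral>\<^sup>+y. ennreal (indicator {0<..} y * (y ^ j * exp (- l * y))) \<partial>lborel) = ennreal (fact j / l ^ (j + 1))" .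
qed (use assms in \<open>auto simp: indicator_def\<close>)

lemma mellin_pair_measurable: "mellin_pair k w r \<Longrightarrow> w \<in> borel_measurable borel"
  by (induction rule: mellin_pair.induct) simp_all

lemma mellin_pair_integral:
  assumes "mellin_pair k w r" "- k < x"
  shows "has_bochner_integral lborel (\<lambda>y. indicator {0<..} y * (w y * exp (- x * y))) (r x)"
  using assms(1)
proof (induction rule: mellin_pair.induct)
  case (base c j)
  have e: "y ^ j * exp (- c * y) * exp (- x * y) = y ^ j * exp (- (x + c) * y)" for y
    by (simp add: algebra_simps flip: exp_add)
  show ?case unfolding e by (rule has_bochner_integral_power_exp) (use base assms(2) in simp)
next
  case (add v r w s)
  from has_bochner_integral_add[OF add.IH] show ?case by (simp add: algebra_simps)
next
  case (smult v r a)
  from has_bochner_integral_mult_right[OF smult.IH, of a] show ?case by (simp add: mult_ac)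
qed

text \<open>Equality with a Laplace transform is required only for x > - k. Identities between
  rational functions hold there, away from the poles, which makes the class closed under partial
  fractions.\<close>

definition mellin_transform :: "real \<Rightarrow> (real \<Rightarrow> real) \<Rightarrow> bool" where
  "mellin_transform k r \<longleftrightarrow> (\<exists>w s. mellin_pair k w s \<and> (\<forall>x. - k < x \<longrightarrow> r x = s x))"

lemma mellin_transform_cong:
  "mellin_transform k r \<Longrightarrow> (\<And>x. - k < x \<Longrightarrow> s x = r x) \<Longrightarrow> mellin_transform k s"
  unfolding mellin_transform_def by metis

lemma mellin_transform_add:
  assumes "mellin_transform k r" "mellin_transform k s" shows "mellin_transform k (\<lambda>x. r x + s x)"
proof -
  obtain v r' w s' where "mellin_pair k v r'" "\<forall>x. - k < x \<longrightarrow> r x = r' x" "mellin_pair k w s'" "\<forall>x. - k < x \<longrightarrow> s x = s' x"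
    using assms unfolding mellin_transform_def by metis
  then show ?thesis unfolding mellin_transform_def
    by (intro exI[of _ "\<lambda>y. v y + w y"] exI[of _ "\<lambda>x. r' x + s' x"]) (simp add: mellin_pair.add)
qed

lemma mellin_transform_smult:
  assumes "mellin_transform k r" shows "mellin_transform k (\<lambda>x. a * r x)"
proof -
  obtain v r' where "mellin_pair k v r'" "\<forall>x. - k < x \<longrightarrow> r x = r' x"
    using assms unfolding mellin_transform_def by metis
  then show ?thesis unfolding mellin_transform_def
    by (intro exI[of _ "\<lambda>y. a * v y"] exI[of _ "\<lambda>x. a * r' x"]) (simp add: mellin_pair.smult)
qed

lemma mellin_transform_base: "k \<le> c \<Longrightarrow> mellin_transform k (\<lambda>x. 1 / (x + c) ^ (j + 1))"
  using mellin_transform_smult[of k "\<lambda>x. fact j / (x + c) ^ (j + 1)" "1 / fact j"] mellin_pair.base[of k c j]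
  unfolding mellin_transform_def by fastforce

text \<open>Partial fractions. Distinct poles are separated by induction on the order; a coinciding
  pole raises the order, which corresponds to one more power of y, a logarithm of |z|.\<close>

lemma mellin_transform_base_divide:
  assumes "k \<le> c" "k \<le> d" shows "mellin_transform k (\<lambda>x. 1 / (x + c) ^ (j + 1) / (x + d))"
proof (cases "c = d")
  case True
  then show ?thesis using mellin_transform_base[OF assms(1), of "j + 1"]
    by (auto elim!: mellin_transform_cong simp: mult_ac)
next
  case False
  have pf: "1 / (x + c) / (x + d) = 1 / (d - c) * (1 / (x + c)) + (- 1 / (d - c)) * (1 / (x + d))" if "- k < x" for x
    using assms that False by (simp add: divide_simps)
  show ?thesis
  proof (induction j)
    case 0
    have "mellin_transform k (\<lambda>x. 1 / (d - c) * (1 / (x + c) ^ (0 + 1)) + (- 1 / (d - c)) * (1 / (x + d) ^ (0 + 1)))"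
      by (intro mellin_transform_add mellin_transform_smult mellin_transform_base assms)
    then show ?case by (rule mellin_transform_cong) (use pf in simp)
  next
    case (Suc j)
    have "mellin_transform k (\<lambda>x. 1 / (d - c) * (1 / (x + c) ^ (Suc j + 1)) + (- 1 / (d - c)) * (1 / (x + c) ^ (j + 1) / (x + d)))"
      by (intro mellin_transform_add mellin_transform_smult mellin_transform_base assms Suc)
    then show ?case
    proof (rule mellin_transform_cong)
      fix x assume x: "- k < x"
      have alg: "p * i1 * i2 = e1 * (p * i1) + e2 * (p * i2)" if "i1 * i2 = e1 * i1 + e2 * i2" for p i1 i2 e1 e2 :: real
        using arg_cong[OF that, of "\<lambda>t. p * t"] by (simp add: distrib_left mult.assoc mult.left_commute)
      have "1 / (x + c) * (1 / (x + d)) = 1 / (d - c) * (1 / (x + c)) + (- 1 / (d - c)) * (1 / (x + d))"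
        using pf[OF x] by simp
      from alg[OF this, of "1 / (x + c) ^ (j + 1)"]
      show "1 / (x + c) ^ (Suc j + 1) / (x + d) = 1 / (d - c) * (1 / (x + c) ^ (Suc j + 1)) + (- 1 / (d - c)) * (1 / (x + c) ^ (j + 1) / (x + d))"
        by (simp add: mult.commute)
    qed
  qed
qed

lemma mellin_transform_divide:
  assumes "mellin_transform k r" "k \<le> d" shows "mellin_transform k (\<lambda>x. r x / (x + d))"
proof -
  obtain w s where ws: "mellin_pair k w s" "\<forall>x. - k < x \<longrightarrow> r x = s x"
    using assms(1) unfolding mellin_transform_def by metis
  from ws(1) have "mellin_transform k (\<lambda>x. s x / (x + d))"
  proof (induction rule: mellin_pair.induct)
    case (base c j)
    from mellin_transform_smult[OF mellin_transform_base_divide[OF base assms(2), of j], of "fact j"]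
    show ?case by simp
  next
    case (add v r w s)
    from mellin_transform_add[OF add.IH] show ?case by (simp add: add_divide_distrib)
  next
    case (smult v r a)
    from mellin_transform_smult[OF smult.IH, of a] show ?case by simp
  qed
  then show ?thesis by (rule mellin_transform_cong) (use ws(2) in simp)
qed

lemma mellin_transform_mult_divide:
  assumes "mellin_transform k r" "k \<le> d" shows "mellin_transform k (\<lambda>x. r x * (x + e) / (x + d))"
proof -
  have "mellin_transform k (\<lambda>x. r x + (e - d) * (r x / (x + d)))"
    by (intro mellin_transform_add mellin_transform_smult mellin_transform_divide assms)
  then show ?thesis by (rule mellin_transform_cong) (use assms(2) in \<open>simp add: field_simps\<close>)
qed

text \<open>A proper rational function with poles at -1, ..., -A. Each induction step splits off one
  linear factor of the denominator, together with one of the numerator if any is left, so the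
  fraction stays proper.\<close>

lemma mellin_transform_pochhammer:
  "n < A \<Longrightarrow> mellin_transform 1 (\<lambda>x. pochhammer (x + c) n / pochhammer (x + 1) A)"
proof (induction A arbitrary: n)
  case (Suc A)
  show ?case
  proof (cases n)
    case 0
    show ?thesis
    proof (cases "A = 0")
      case True
      then show ?thesis using 0 mellin_transform_base[of 1 1 0] by simp
    next
      case False
      from mellin_transform_divide[OF Suc.IH[of 0], of "1 + real A"] False 0 show ?thesis
        by (simp add: pochhammer_Suc add_ac mult.commute)
    qed
  next
    case (Suc n')
    from mellin_transform_mult_divide[OF Suc.IH[of n'], of "1 + real A" "c + real n'"] Suc Suc.prems show ?thesis
      by (simp add: pochhammer_Suc add_ac)
  qed
qed simp

text \<open>Growth of the radial factors at the origin: up to logarithms they are of size \<open>|x|^{2k}\<close>, where \<open>k\<close> is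
the range exponent.\<close>

definition range_exponent :: "nat \<Rightarrow> nat \<Rightarrow> real" where
  "range_exponent A B = (if A = 0 \<or> B = 0 then real (A + B) else 1)"

text \<open>Since m <= A + B the quotient is a proper rational function of x. If A or B is 0, then m
  = A + B is forced and everything cancels to 1 / (x + A + B), with a half plane as large as A + B
  allows. Otherwise (x + m - 1)! / (x + B)! is a Pochhammer symbol of length m - 1 - B < A, or 1 /
  (x + B) when m = B, and the poles of the whole quotient start at -1 or further left.\<close>

lemma mellin_pair_factorials:
  fixes A B m N :: nat
  assumes N: "N \<ge> 1" and m: "A \<le> m" "B \<le> m" "m \<le> A + B"
  shows "\<exists>w r. mellin_pair (range_exponent A B) w r \<and>
    (\<forall>x. N \<le> x + A \<and> N \<le> x + B \<longrightarrow> - range_exponent A B < real x \<and>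
       r (real x) = fact x * fact (x + m - 1) / (fact (x + A) * fact (x + B)))"
proof (cases "A = 0 \<or> B = 0")
  case True
  then have mAB: "m = A + B" using m by auto
  have st: "real x > - real (A + B) \<and> fact 0 / (real x + real (A + B)) ^ (0 + 1) = fact x * fact (x + m - 1) / (fact (x + A) * fact (x + B))"
    if "N \<le> x + A" "N \<le> x + B" for x
  proof -
    \<comment> \<open>Needed for m = 0, where the truncated x + m - 1 would break the recursion of
      the factorial at x = 0.\<close>
    have "x \<ge> 1" using that True N by auto
    then obtain x' where x: "x = Suc x'" by (metis Suc_le_D One_nat_def)
    have "fact (x + A) * fact (x + B) = (fact x * fact (x + m) :: real)"
      using True by (auto simp: mAB)
    moreover have "fact (x + m) = (real (x + m) * fact (x + m - 1) :: real)" by (simp add: x)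
    ultimately show ?thesis by (simp add: mAB x)
  qed
  have k: "range_exponent A B = real (A + B)" using True by (simp add: range_exponent_def)
  show ?thesis unfolding k
  proof (intro exI conjI allI impI)
    show "mellin_pair (real (A + B)) (\<lambda>y. y ^ 0 * exp (- real (A + B) * y)) (\<lambda>x. fact 0 / (x + real (A + B)) ^ (0 + 1))"
      by (rule mellin_pair.base) simp
    fix x assume "N \<le> x + A \<and> N \<le> x + B"
    then show "- real (A + B) < real x"
      and "fact 0 / (real x + real (A + B)) ^ (0 + 1) = fact x * fact (x + m - 1) / (fact (x + A) * fact (x + B))"
      using st[of x] by simp_all
  qed
next
  case False
  then have k: "range_exponent A B = 1" by (simp add: range_exponent_def)
  have fp: "fact (x + A) = (fact x * pochhammer (real x + 1) A :: real)" for x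
    by (rule fact_mult_pochhammer)
  have pp: "pochhammer (real x + 1) A > 0" for x by (intro pochhammer_pos) simp
  have "\<exists>r. mellin_transform 1 r \<and> (\<forall>x. r (real x) = fact x * fact (x + m - 1) / (fact (x + A) * fact (x + B)))"
  proof (cases "m = B")
    case True
    have "mellin_transform 1 (\<lambda>x. pochhammer (x + 1) 0 / pochhammer (x + 1) A / (x + real B))"
      using False by (intro mellin_transform_divide mellin_transform_pochhammer) auto
    moreover have "pochhammer (real x + 1) 0 / pochhammer (real x + 1) A / (real x + real B) = fact x * fact (x + m - 1) / (fact (x + A) * fact (x + B))" for x
    proof -
      obtain B' where B: "B = Suc B'" using False by (metis not0_implies_Suc)
      show ?thesis unfolding fp using pp[of x] by (simp add: True B add_ac)
    qed
    ultimately show ?thesis by blast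
  next
    case m2: False
    define n where "n = m - 1 - B"
    have n: "n < A" "m - 1 = B + n" using m m2 False by (auto simp: n_def)
    have "mellin_transform 1 (\<lambda>x. pochhammer (x + (real B + 1)) n / pochhammer (x + 1) A)"
      by (rule mellin_transform_pochhammer[OF n(1)])
    moreover have "pochhammer (real x + (real B + 1)) n / pochhammer (real x + 1) A = fact x * fact (x + m - 1) / (fact (x + A) * fact (x + B))" for x
    proof -
      have e: "x + m - 1 = (x + B) + n" using n m m2 False by simp
      have "fact (x + m - 1) = (fact (x + B) * pochhammer (real x + (real B + 1)) n :: real)"
        unfolding e using fact_mult_pochhammer[of "x + B" n, where 'a=real] by (simp add: add_ac)
      then show ?thesis unfolding fp using pp[of x] by simp
    qed
    ultimately show ?thesis by blast
  qed
  then obtain r w s where r: "\<forall>x. r (real x) = fact x * fact (x + m - 1) / (fact (x + A) * fact (x + B))"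
    and ws: "mellin_pair 1 w s" "\<forall>x. - 1 < x \<longrightarrow> r x = s x"
    unfolding mellin_transform_def by metis
  have "- 1 < real x" for x by (rule order_less_le_trans[of _ 0]) simp_all
  then show ?thesis unfolding k using ws r by (intro exI[of _ w] exI[of _ s]) simp
qed

text \<open>Chu--Vandermonde. That the sum vanishes unless \<open>a \<le> x\<close> is what makes the moments of the preimage supported
where those of \<open>z^a\<close> times the conjugate of \<open>z^b\<close> have to be.\<close>

lemma fact_pochhammer_sum:
  fixes a b x y :: nat
  assumes ab: "a + y = b + x"
  shows "(\<Sum>e\<le>min a b. real (min a b choose e) * pochhammer (- real (max a b)) (min a b - e) * fact (a - min a b + y + e))
    = (if a \<le> x then fact x * fact y / fact (x - a) else 0)"
proof -
  define \<mu> where "\<mu> = min a b"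
  define M where "M = max a b"
  define d where "d = a - \<mu> + y"
  have d: "d = max x y" using ab by (auto simp: d_def \<mu>_def min_def max_def)
  have "(\<Sum>e\<le>\<mu>. real (\<mu> choose e) * pochhammer (- real M) (\<mu> - e) * fact (d + e))
     = fact d * (\<Sum>e\<le>\<mu>. real (\<mu> choose e) * pochhammer (real d + 1) e * pochhammer (- real M) (\<mu> - e))"
    unfolding sum_distrib_left by (intro sum.cong refl) (simp add: fact_mult_pochhammer mult_ac)
  also have "(\<Sum>e\<le>\<mu>. real (\<mu> choose e) * pochhammer (real d + 1) e * pochhammer (- real M) (\<mu> - e)) = pochhammer (real d + 1 + (- real M)) \<mu>"
    by (rule pochhammer_binomial_sum[symmetric])
  also have "fact d * pochhammer (real d + 1 + (- real M)) \<mu> = (if a \<le> x then fact x * fact y / fact (x - a) else 0)"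
  proof (cases "a \<le> x")
    case True
    define g where "g = x - a"
    have x: "x = a + g" "y = b + g" using True ab by (auto simp: g_def)
    have dM: "d = M + g" by (auto simp: d M_def x)
    have "fact (g + \<mu>) = (fact g * pochhammer (real g + 1) \<mu> :: real)" by (rule fact_mult_pochhammer)
    moreover have f2: "fact x * fact y = (fact d * fact (g + \<mu>) :: real)"
      by (auto simp: dM M_def \<mu>_def x max_def min_def add.commute mult.commute)
    moreover have e: "real d + 1 + (- real M) = real g + 1" by (simp add: dM)
    ultimately show ?thesis unfolding e f2 using True by (simp add: g_def[symmetric])
  next
    case False
    \<comment> \<open>Then a = x + g and b = y + g, so g is at most the minimum of a and b, and the
      base -(g - 1) is a root of the Pochhammer symbol.\<close>
    define g where "g = a - x"
    have g: "g \<ge> 1" "a = x + g" "b = y + g" using False ab by (auto simp: g_def)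
    have "real d + 1 + (- real M) = - real (g - 1)" using g by (auto simp: d M_def max_def)
    moreover have "g - 1 < \<mu>" using g by (auto simp: \<mu>_def)
    ultimately have "pochhammer (real d + 1 + (- real M)) \<mu> = 0" by (auto simp: pochhammer_eq_0_iff)
    then show ?thesis using False by simp
  qed
  finally show ?thesis by (simp add: \<mu>_def M_def d_def)
qed

section \<open>Taylor coefficients of a monomial divided by (1 - |z|^2)^(N+1)\<close>

definition monopoly :: "('n::finite \<Rightarrow> nat) \<Rightarrow> ('n \<Rightarrow> nat) \<Rightarrow> 'n zzpoly" where
  "monopoly a b = (\<lambda>m. if m = (a, b) then 1 else 0)"

lemma is_zzpoly_monopoly: "is_zzpoly (monopoly a b)"
  by (simp add: is_zzpoly_def monopoly_def)

lemma zzeval_monopoly: "zzeval (monopoly a b) z = zzmonom (a, b) z"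
proof -
  have "{m. monopoly a b m \<noteq> 0} = {(a, b)}" by (auto simp: monopoly_def)
  then show ?thesis by (simp add: zzeval_def monopoly_def)
qed

lemma normmul_nonzeroE:
  assumes "normmul c m \<noteq> 0"
  obtains j where "0 < fst m j" "0 < snd m j" "c (down j (fst m), down j (snd m)) \<noteq> 0"
  using assms
  by (auto simp: normmul_def split: prod.splits if_splits elim!: sum.not_neutral_contains_not_neutral)

lemma normmul_pow_monopoly_support:
  "(normmul ^^ i) (monopoly a b) m \<noteq> 0 \<Longrightarrow> \<exists>g. m = (\<lambda>j. a j + g j, \<lambda>j. b j + g j)"
proof (induction i arbitrary: m)
  case 0
  then show ?case by (intro exI[of _ "\<lambda>_. 0"]) (auto simp: monopoly_def split: if_splits)
next
  case (Suc i)
  have "normmul ((normmul ^^ i) (monopoly a b)) m \<noteq> 0" using Suc.prems by simp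
  then obtain j where j: "0 < fst m j" "0 < snd m j" "(normmul ^^ i) (monopoly a b) (down j (fst m), down j (snd m)) \<noteq> 0"
    by (rule normmul_nonzeroE)
  from Suc.IH[OF j(3)] obtain g where g: "down j (fst m) = (\<lambda>j. a j + g j)" "down j (snd m) = (\<lambda>j. b j + g j)" by auto
  have "up j (down j (fst m)) = (\<lambda>i. a i + up j g i)" "up j (down j (snd m)) = (\<lambda>i. b i + up j g i)"
    unfolding g by auto
  then show ?case unfolding up_down[of "fst m" j, OF j(1)] up_down[of "snd m" j, OF j(2)] by (metis prod.collapse)
qed

text \<open>The multinomial theorem for the i-th power of the sum of the |z_j|^2, at the level of
  coefficients.\<close>

lemma normmul_pow_monopoly:
  "(normmul ^^ i) (monopoly a b) (\<lambda>j. a j + g j, \<lambda>j. b j + g j) = (if mdeg g = i then of_real (fact i / mfact g) else 0)"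
proof (induction i arbitrary: g)
  case 0
  have "mdeg g = 0 \<longleftrightarrow> g = (\<lambda>_. 0)" by auto
  moreover have "(\<lambda>j. a j + g j, \<lambda>j. b j + g j) = (a, b) \<longleftrightarrow> g = (\<lambda>_. 0)" by (auto simp: fun_eq_iff)
  ultimately show ?case by (auto simp: monopoly_def)
next
  case (Suc i)
  let ?a = "\<lambda>j. a j + g j" and ?b = "\<lambda>j. b j + g j"
  have "(if 0 < ?a j \<and> 0 < ?b j then (normmul ^^ i) (monopoly a b) (down j ?a, down j ?b) else 0)
      = (if mdeg g = Suc i then of_real (fact i * real (g j) / mfact g) else 0)" for j
  proof (cases "0 < g j")
    case True
    have ud: "up j (down j g) = g" using True by (rule up_down)
    have e: "down j ?a = (\<lambda>i. a i + down j g i)" "down j ?b = (\<lambda>i. b i + down j g i)" using True by auto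
    have "mdeg g = mdeg (down j g) + 1" using mdeg_down[of g j] True by simp
    moreover have "mfact g = real (g j) * mfact (down j g)" using mfact_up[of "down j g" j] True unfolding ud by simp
    ultimately show ?thesis using True unfolding e Suc.IH by auto
  next
    case False
    have "(normmul ^^ i) (monopoly a b) (down j ?a, down j ?b) = 0" if "0 < ?a j"
    proof (rule ccontr)
      assume "(normmul ^^ i) (monopoly a b) (down j ?a, down j ?b) \<noteq> 0"
      from normmul_pow_monopoly_support[OF this] obtain g' where "down j ?a = (\<lambda>j. a j + g' j)" by auto
      from fun_cong[OF this, of j] show False using False that by simp
    qed
    then show ?thesis using False by auto
  qed
  then have "(normmul ^^ Suc i) (monopoly a b) (?a, ?b) = (\<Sum>j\<in>UNIV. if mdeg g = Suc i then of_real (fact i * real (g j) / mfact g) else 0)"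
    by (simp only: normmul_def[of "(normmul ^^ i) (monopoly a b)"] funpow.simps comp_apply prod.case)
  also have "\<dots> = (if mdeg g = Suc i then of_real (fact i * real (mdeg g) / mfact g) else 0)"
  proof -
    have "(\<Sum>j\<in>UNIV. fact i * real (g j) / mfact g) = fact i * real (mdeg g) / mfact g"
      by (simp add: mdeg_def sum_distrib_left sum_divide_distrib)
    then show ?thesis by (cases "mdeg g = Suc i") (simp_all only: if_True if_False of_real_sum[symmetric] sum.neutral_const simp_thms)
  qed
  finally show ?case by (simp add: mult.commute)
qed

lemma rcoef_monopoly:
  fixes a b :: "'n::finite \<Rightarrow> nat"
  shows "rcoef (monopoly a b) (\<lambda>j. a j + g j, \<lambda>j. b j + g j) = of_real (fact (CARD('n) + mdeg g) / (fact (CARD('n)) * mfact g))"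
proof -
  let ?N = "CARD('n)"
  have "mdeg g \<le> mdeg (\<lambda>j. a j + g j)" by (simp add: mdeg_def sum_mono)
  then have "rcoef (monopoly a b) (\<lambda>j. a j + g j, \<lambda>j. b j + g j) = of_nat ((?N + mdeg g) choose mdeg g) * of_real (fact (mdeg g) / mfact g)"
    by (simp add: rcoef_def normmul_pow_monopoly if_distrib cong: if_cong)
  also have "\<dots> = of_real (real ((?N + mdeg g) choose mdeg g) * fact (mdeg g) / mfact g)" by simp
  finally show ?thesis unfolding fact_choose by simp
qed

lemma rcoef_monopoly_0:
  assumes "\<nexists>g. m = (\<lambda>j. a j + g j, \<lambda>j. b j + g j)" shows "rcoef (monopoly a b) m = 0"
  unfolding rcoef_def using normmul_pow_monopoly_support[of _ a b m] assms by (intro sum.neutral) auto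

section \<open>Integrals of monomials times radial functions\<close>

lemma integrable_lebesgueI:
  fixes f :: "'a::euclidean_space \<Rightarrow> 'b::{banach, second_countable_topology}"
  assumes "integrable lborel f" shows "integrable lebesgue f"
  using assms integrable_completion[of f lborel] borel_measurable_integrable[OF assms] by simp

lemma integral_lebesgue_lborel:
  fixes f :: "'a::euclidean_space \<Rightarrow> 'b::{banach, second_countable_topology}"
  assumes "f \<in> borel_measurable borel" shows "integral\<^sup>L lebesgue f = integral\<^sup>L lborel f"
  using assms by (intro integral_completion) simp

lemma ball_logr_AE: "AE x in lborel. indicator (ball 0 1) x = (indicator {0<..} (logr x) :: real)"
  using AE_lborel_neq[of 0] by eventually_elim (auto simp: indicator_def logr_pos_iff)

text \<open>Under the constant density \<open>logr\<close> has rate N, so the factor exp (- s * logr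
  x) = |x|^(2s) moves the transform to the point N + s, which has to lie in the half plane of the
  pair.\<close>

lemma integrable_radial_mellin:
  assumes w: "mellin_pair k w r" and s: "real (CARD('n::finite)) + s > - k"
  shows "integrable lborel (\<lambda>x::complex^'n. indicator {0<..} (logr x) * (w (logr x) * exp (- s * logr x)))"
proof -
  interpret homogeneous "absmonom (\<lambda>_::'n. 0)" "2 * mdeg (\<lambda>_::'n. 0)" by (rule absmonom_homogeneous)
  have [measurable]: "w \<in> borel_measurable borel" by (rule mellin_pair_measurable[OF w])
  let ?F = "\<lambda>y. indicator {0<..} y * (w y * exp (- s * y)) :: real"
  have r: "rate = CARD('n)" using absmonom_rate[of "\<lambda>_::'n. 0"] by simp
  have "integrable lborel (\<lambda>y. indicator {0<..} y * (w y * exp (- (real CARD('n) + s) * y)))"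
    using mellin_pair_integral[OF w s] by (rule integrable.intros)
  then have fin: "(\<integral>\<^sup>+y. ennreal (norm (indicator {0<..} y * (w y * exp (- (real CARD('n) + s) * y)))) \<partial>lborel) < \<infinity>"
    by (simp add: integrable_iff_bounded)
  have "(\<integral>\<^sup>+x. ennreal (norm (?F (logr (x::complex^'n)))) \<partial>lborel) = (\<integral>\<^sup>+x. ennreal (absmonom (\<lambda>_::'n. 0) x) * ennreal (norm (?F (logr x))) \<partial>lborel)"
    by (simp add: absmonom_def)
  also have "\<dots> = (\<integral>\<^sup>+y. ennreal (mass * rate * exp (- rate * y)) * ennreal (norm (?F y)) \<partial>lborel)"
    by (rule nn_integral_radial) measurable
  also have "\<dots> = (\<integral>\<^sup>+y. ennreal (mass * rate) * ennreal (norm (indicator {0<..} y * (w y * exp (- (real CARD('n) + s) * y)))) \<partial>lborel)"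
  proof (rule nn_integral_cong)
    fix y
    have x: "exp (- (real CARD('n) + s) * y) = exp (- rate * y) * exp (- s * y)"
      unfolding r by (simp add: algebra_simps flip: exp_add)
    have "mass * rate * exp (- rate * y) * norm (?F y) = mass * rate * norm (indicator {0<..} y * (w y * exp (- (real CARD('n) + s) * y)))"
      unfolding x by (simp add: abs_mult mult_ac)
    then show "ennreal (mass * rate * exp (- rate * y)) * ennreal (norm (?F y))
      = ennreal (mass * rate) * ennreal (norm (indicator {0<..} y * (w y * exp (- (real CARD('n) + s) * y))))"
      using mass_nonneg rate_pos by (simp flip: ennreal_mult')
  qed
  also have "\<dots> < \<infinity>" using fin by (subst nn_integral_cmult) (auto simp: ennreal_mult_less_top)
  finally show ?thesis unfolding integrable_iff_bounded by simp
qed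

lemma set_integrable_monom_radial:
  fixes a b :: "'n::finite \<Rightarrow> nat"
  assumes w: "mellin_pair k w r" and s: "real (CARD('n)) + (real (mdeg a + mdeg b) / 2 - m) > - k"
  shows "ball_integrable (\<lambda>x. zzmonom (a, b) x * of_real (exp (m * logr x) * w (logr x)))"
    and "(\<lambda>x. zzmonom (a, b) x * of_real (exp (m * logr x) * w (logr x))) \<in> borel_measurable borel"
proof -
  have [measurable]: "w \<in> borel_measurable borel" by (rule mellin_pair_measurable[OF w])
  show meas[measurable]: "(\<lambda>x. zzmonom (a, b) x * of_real (exp (m * logr x) * w (logr x))) \<in> borel_measurable borel"
    by measurable
  have "integrable lborel (\<lambda>x. indicator unit_ball x *\<^sub>R (zzmonom (a, b) x * of_real (exp (m * logr x) * w (logr x))))"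
  proof (rule Bochner_Integration.integrable_bound[OF integrable_radial_mellin[OF w s]])
    show "(\<lambda>x. indicator unit_ball x *\<^sub>R (zzmonom (a, b) x * of_real (exp (m * logr x) * w (logr x)))) \<in> borel_measurable lborel"
      by measurable
    show "AE x in lborel. norm (indicator unit_ball x *\<^sub>R (zzmonom (a, b) x * of_real (exp (m * logr x) * w (logr x))))
      \<le> norm (indicator {0<..} (logr x) * (w (logr x) * exp (- (real (mdeg a + mdeg b) / 2 - m) * logr x)))"
      using AE_lborel_neq[of 0]
    proof eventually_elim
      case (elim x)
      define A where "A = mdeg a + mdeg b"
      have "norm x = exp (- logr x / 2)" using elim by (simp add: logr_def ln_realpow)
      then have nA: "norm x ^ A = exp (- (A / 2) * logr x)" by (simp flip: exp_of_nat_mult)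
      show ?case
      proof (cases "x \<in> unit_ball")
        case True
        then have i: "indicator {0<..} (logr x) = (1::real)" using logr_pos_iff[OF elim] by simp
        have "norm (zzmonom (a, b) x * of_real (exp (m * logr x) * w (logr x))) \<le> norm x ^ A * (exp (m * logr x) * \<bar>w (logr x)\<bar>)"
          unfolding norm_mult norm_of_real A_def abs_mult by (intro mult_mono cmod_zzmonom_le) auto
        also have "\<dots> = \<bar>w (logr x)\<bar> * exp (- (A / 2 - m) * logr x)"
          unfolding nA by (simp add: algebra_simps flip: exp_add)
        finally show ?thesis using True i by (simp add: A_def abs_mult)
      qed simp
    qed
  qed
  then show "ball_integrable (\<lambda>x. zzmonom (a, b) x * of_real (exp (m * logr x) * w (logr x)))"
    unfolding set_integrable_def by (rule integrable_lebesgueI)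
qed

lemma zzmonom_mult_cnj: "zzmonom (a, b) x * cnj (zzmonom (c, d) x) = zzmonom (\<lambda>j. a j + d j, \<lambda>j. b j + c j) x"
  by (simp add: zzmonom_def power_add prod.distrib mult_ac)

text \<open>Angular orthogonality removes all moments off the diagonal. On it, the monomial
  contributes the rate N + |e|, and the factor exp (m * logr x) shifts the argument of the transform
  down by m.\<close>

lemma moment_monom_radial:
  fixes a b c d :: "'n::finite \<Rightarrow> nat"
  defines "e \<equiv> \<lambda>j. a j + d j"
  assumes w: "mellin_pair k w r"
    and s: "e = (\<lambda>j. b j + c j) \<Longrightarrow> real (CARD('n) + mdeg e) - m > - k"
  shows "moment (\<lambda>x. zzmonom (a, b) x * of_real (exp (m * logr x) * w (logr x))) (c, d)
    = (if e = (\<lambda>j. b j + c j) then of_real (pi ^ CARD('n) * mfact e / fact (CARD('n) + mdeg e - 1) * r (real (CARD('n) + mdeg e) - m)) else 0)"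
proof -
  have [measurable]: "w \<in> borel_measurable borel" by (rule mellin_pair_measurable[OF w])
  define G where "G y = (of_real (indicator {0<..} y * (exp (m * y) * w y)) :: complex)" for y
  have Gm: "G \<in> borel_measurable borel" unfolding G_def by measurable
  have cm: "(\<lambda>x. cnj (zzmonom (c, d) x)) \<in> borel_measurable borel"
    unfolding zzmonom_def by (intro borel_measurable_continuous_onI continuous_intros)
  have tm: "(\<lambda>x. zzmonom (a, b) x * of_real (exp (m * logr x) * w (logr x))) \<in> borel_measurable borel" by measurable
  have "moment (\<lambda>x. zzmonom (a, b) x * of_real (exp (m * logr x) * w (logr x))) (c, d)
    = (\<integral>x. indicator unit_ball x *\<^sub>R (zzmonom (a, b) x * of_real (exp (m * logr x) * w (logr x)) * cnj (zzmonom (c, d) x)) \<partial>lborel)"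
    unfolding moment_def set_lebesgue_integral_def
    by (rule integral_lebesgue_lborel) (use tm cm in measurable)
  also have "\<dots> = (\<integral>x. zzmonom (e, \<lambda>j. b j + c j) x * G (logr x) \<partial>lborel)"
  proof (rule integral_cong_AE)
    show "(\<lambda>x. indicator unit_ball x *\<^sub>R (zzmonom (a, b) x * of_real (exp (m * logr x) * w (logr x)) * cnj (zzmonom (c, d) x))) \<in> borel_measurable lborel"
      using tm cm by measurable
    show "(\<lambda>x. zzmonom (e, \<lambda>j. b j + c j) x * G (logr x)) \<in> borel_measurable lborel" using Gm by measurable
    show "AE x in lborel. indicator unit_ball x *\<^sub>R (zzmonom (a, b) x * of_real (exp (m * logr x) * w (logr x)) * cnj (zzmonom (c, d) x))
      = zzmonom (e, \<lambda>j. b j + c j) x * G (logr x)"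
      using ball_logr_AE
    proof eventually_elim
      case (elim x)
      have "zzmonom (a, b) x * of_real (exp (m * logr x) * w (logr x)) * cnj (zzmonom (c, d) x)
        = zzmonom (e, \<lambda>j. b j + c j) x * of_real (exp (m * logr x) * w (logr x))"
        using zzmonom_mult_cnj[of a b x c d] by (simp add: e_def mult_ac)
      then show ?case unfolding elim G_def by (simp add: scaleR_conv_of_real)
    qed
  qed
  finally have m: "moment (\<lambda>x. zzmonom (a, b) x * of_real (exp (m * logr x) * w (logr x))) (c, d)
    = (\<integral>x. zzmonom (e, \<lambda>j. b j + c j) x * G (logr x) \<partial>lborel)" .
  show ?thesis
  proof (cases "e = (\<lambda>j. b j + c j)")
    case True
    let ?L = "real (CARD('n) + mdeg e)"
    have "(\<integral>y. of_real (exp (- ?L * y)) * G y \<partial>lborel) = (\<integral>y. of_real (indicator {0<..} y * (w y * exp (- (?L - m) * y))) \<partial>lborel)"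
    proof (rule Bochner_Integration.integral_cong[OF refl])
      fix y
      have "exp (- ?L * y) * (exp (m * y) * w y) = w y * exp (- (?L - m) * y)"
        by (simp add: algebra_simps flip: exp_add)
      then have "exp (- ?L * y) * (indicator {0<..} y * (exp (m * y) * w y)) = indicator {0<..} y * (w y * exp (- (?L - m) * y))"
        by (simp only: mult.left_commute[of "exp (- ?L * y)" "indicator {0<..} y"])
      then show "of_real (exp (- ?L * y)) * G y = (of_real (indicator {0<..} y * (w y * exp (- (?L - m) * y))) :: complex)"
        unfolding G_def of_real_mult[symmetric] by (simp only:)
    qed
    also have "\<dots> = of_real (r (?L - m))"
      unfolding integral_complex_of_real using mellin_pair_integral[OF w s[OF True]]
      by (simp only: has_bochner_integral_integral_eq)
    finally show ?thesis using m True integral_zzmonom_diag[OF Gm, of e] by simp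
  next
    case False
    then show ?thesis using m integral_zzmonom_offdiag[OF False Gm] by simp
  qed
qed

lemma moment_sum:
  fixes u :: "'i \<Rightarrow> complex^'n \<Rightarrow> complex"
  assumes "\<And>i. i \<in> I \<Longrightarrow> ball_integrable (u i)"
  shows "moment (\<lambda>x. \<Sum>i\<in>I. c i * u i x) m = (\<Sum>i\<in>I. c i * moment (u i) m)"
proof -
  have "moment (\<lambda>x. \<Sum>i\<in>I. c i * u i x) m = ball_integral (\<lambda>x. \<Sum>i\<in>I. c i * (u i x * cnj (zzmonom m x)))"
    unfolding moment_def by (simp add: sum_distrib_right mult.assoc)
  also have "\<dots> = (\<Sum>i\<in>I. ball_integral (\<lambda>x. c i * (u i x * cnj (zzmonom m x))))"
    unfolding set_lebesgue_integral_def scaleR_sum_right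
    by (rule Bochner_Integration.integral_sum, unfold set_integrable_def[symmetric])
       (intro set_integrable_mult_right set_integrable_zzmonom assms)
  finally show ?thesis by (simp add: moment_def)
qed

lemma set_integrable_sum_mult:
  fixes u :: "'i \<Rightarrow> complex^'n \<Rightarrow> complex"
  assumes "\<And>i. i \<in> I \<Longrightarrow> ball_integrable (u i)"
  shows "ball_integrable (\<lambda>x. \<Sum>i\<in>I. c i * u i x)"
  unfolding set_integrable_def scaleR_sum_right
  by (rule Bochner_Integration.integrable_sum, unfold set_integrable_def[symmetric])
     (intro set_integrable_mult_right assms)

lemma mfact_pochhammer_sum:
  fixes a b x y :: "'n::finite \<Rightarrow> nat"
  assumes ab: "\<And>i. a i + y i = b i + x i"
  shows "(\<Sum>e\<in>Pi\<^sub>E UNIV (\<lambda>i. {..min (a i) (b i)}). (\<Prod>i\<in>UNIV. real (min (a i) (b i) choose e i) * pochhammer (- real (max (a i) (b i))) (min (a i) (b i) - e i))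
      * mfact (\<lambda>i. a i - min (a i) (b i) + e i + y i))
    = (if \<forall>i. a i \<le> x i then mfact x * mfact y / mfact (\<lambda>i. x i - a i) else 0)"
proof -
  have "(\<Sum>e\<in>Pi\<^sub>E UNIV (\<lambda>i. {..min (a i) (b i)}). (\<Prod>i\<in>UNIV. real (min (a i) (b i) choose e i) * pochhammer (- real (max (a i) (b i))) (min (a i) (b i) - e i))
      * mfact (\<lambda>i. a i - min (a i) (b i) + e i + y i))
    = (\<Sum>e\<in>Pi\<^sub>E UNIV (\<lambda>i. {..min (a i) (b i)}). \<Prod>i\<in>UNIV. real (min (a i) (b i) choose e i) * pochhammer (- real (max (a i) (b i))) (min (a i) (b i) - e i)
      * fact (a i - min (a i) (b i) + y i + e i))"
    by (simp add: mfact_def prod.distrib add_ac)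
  also have "\<dots> = (\<Prod>i\<in>UNIV. \<Sum>e\<le>min (a i) (b i). real (min (a i) (b i) choose e) * pochhammer (- real (max (a i) (b i))) (min (a i) (b i) - e)
      * fact (a i - min (a i) (b i) + y i + e))"
    by (subst prod_sum_PiE) auto
  also have "\<dots> = (\<Prod>i\<in>UNIV. if a i \<le> x i then fact (x i) * fact (y i) / fact (x i - a i) else 0)"
    by (intro prod.cong refl fact_pochhammer_sum ab)
  also have "\<dots> = (if \<forall>i. a i \<le> x i then mfact x * mfact y / mfact (\<lambda>i. x i - a i) else 0)"
    by (auto simp: mfact_def prod.distrib prod_dividef)
  finally show ?thesis .
qed

text \<open>The ansatz comes from differentiation: away from the origin \<open>u\<close> has the
  shape (-1)^(A+B) d_z^b d_zbar^a F(|z|^2), where F(t) on (0,1) has Mellin transform (s-1)! s! /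
  ((s+A)! (s+B)!). The product rule gives the monomials (a', b') with the coefficients
  \<open>c e\<close> up to sign and derivatives of F of order |M| + |e|. The proof itself only
  checks the moments of the explicit sum. Borel measurability is recorded because composition with
  \<open>phi w\<close> will rely on it.\<close>

lemma zzmonom_in_range:
  fixes a b :: "'n::finite \<Rightarrow> nat"
  assumes good: "mdeg a = 0 \<or> mdeg b = 0 \<or> mdeg a + mdeg b \<le> 2 * CARD('n) + 1"
  shows "\<exists>u. u \<in> borel_measurable borel \<and> ball_integrable u \<and> (\<forall>z\<in>unit_ball. zzmonom (a, b) z = berezin u z)"
proof -
  define N where "N = CARD('n)"
  have N: "N \<ge> 1" by (simp add: N_def Suc_le_eq card_gt_0_iff)
  define \<mu> where "\<mu> i = min (a i) (b i)" for i
  define M where "M i = max (a i) (b i)" for i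
  define A where "A = mdeg a"
  define B where "B = mdeg b"
  have MAB: "mdeg M + mdeg \<mu> = A + B"
    unfolding mdeg_def A_def B_def sum.distrib[symmetric] by (intro sum.cong refl) (simp add: M_def \<mu>_def)
  have AM: "A \<le> mdeg M" "B \<le> mdeg M" by (auto simp: A_def B_def mdeg_def M_def intro!: sum_mono)
  \<comment> \<open>Guarantees that the subtraction in \<open>X\<close> below is not
    truncated.\<close>
  have mAB: "min A B \<le> N" using good by (auto simp: A_def B_def N_def min_def simp del: mdeg_eq_0_iff)
  have N0: "real CARD('n) \<ge> 1" using N by (simp add: N_def)
  define k where "k = range_exponent A B"
  \<comment> \<open>Integrability at the origin: the summands \<open>T e\<close> have order -(A + B)
    there, improved by 2k through \<open>w\<close>. With k = 1 the condition reads A + B < 2N +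
    2.\<close>
  have k: "real (A + B) / 2 < real N + k"
  proof (cases "A = 0 \<or> B = 0")
    case True
    then have "k = real (A + B)" by (simp add: k_def range_exponent_def)
    moreover have "t / 2 < s + t" if "t \<ge> 0" "s \<ge> 1" for s t :: real using that by linarith
    ultimately show ?thesis using N0 unfolding N_def by (simp only: of_nat_0_le_iff)
  next
    case False
    then have "k = 1" by (simp add: k_def range_exponent_def)
    moreover have "A + B \<le> 2 * N + 1" using good False by (simp add: A_def B_def N_def del: mdeg_eq_0_iff)
    then have "real (A + B) \<le> real (2 * N + 1)" by (simp only: of_nat_le_iff)
    ultimately show ?thesis by simp
  qed
  have "\<forall>e\<in>{..mdeg \<mu>}. \<exists>w r. mellin_pair k w r \<and>
    (\<forall>x. N \<le> x + A \<and> N \<le> x + B \<longrightarrow> - k < real x \<and>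
       r (real x) = fact x * fact (x + (mdeg M + e) - 1) / (fact (x + A) * fact (x + B)))"
    unfolding k_def using N AM MAB by (intro ballI mellin_pair_factorials) auto
  then obtain w r where wr: "\<And>e. e \<le> mdeg \<mu> \<Longrightarrow> mellin_pair k (w e) (r e)"
    and r: "\<And>e x. e \<le> mdeg \<mu> \<Longrightarrow> N \<le> x + A \<Longrightarrow> N \<le> x + B \<Longrightarrow> - k < real x \<and>
       r e (real x) = fact x * fact (x + (mdeg M + e) - 1) / (fact (x + A) * fact (x + B))"
    by (metis atMost_iff)
  define E where "E = Pi\<^sub>E UNIV (\<lambda>i. {..min (a i) (b i)})"
  have finE: "finite E" by (simp add: E_def finite_PiE)
  have Ele: "e i \<le> \<mu> i" if "e \<in> E" for e i using that by (auto simp: E_def \<mu>_def PiE_def Pi_def)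
  have Edeg: "mdeg e \<le> mdeg \<mu>" if "e \<in> E" for e using Ele[OF that] by (auto simp: mdeg_def intro!: sum_mono)
  define a' where "a' e i = a i - \<mu> i + e i" for e i
  define b' where "b' e i = b i - \<mu> i + e i" for e i
  have da: "mdeg (a' e) + mdeg \<mu> = A + mdeg e" for e
    unfolding mdeg_def A_def sum.distrib[symmetric] by (intro sum.cong refl) (simp add: a'_def \<mu>_def)
  have db: "mdeg (b' e) + mdeg \<mu> = B + mdeg e" for e
    unfolding mdeg_def B_def sum.distrib[symmetric] by (intro sum.cong refl) (simp add: b'_def \<mu>_def)
  \<comment> \<open>The exponential is |x|^(-2(|M| + |e|)), written in the logarithmic
    radius.\<close>
  define T where "T e x = zzmonom (a' e, b' e) x * of_real (exp (real (mdeg M + mdeg e) * logr x) * w (mdeg e) (logr x))" for e x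
  have Ti: "ball_integrable (T e)" and Tm: "T e \<in> borel_measurable borel" if e: "e \<in> E" for e
  proof -
    have "mdeg (a' e) + mdeg (b' e) + 2 * mdeg \<mu> = A + B + 2 * mdeg e" using da[of e] db[of e] by simp
    then have q: "real (mdeg (a' e) + mdeg (b' e)) / 2 - real (mdeg M + mdeg e) = - (real (A + B) / 2)"
      using MAB by (simp add: field_simps)
    have "real (CARD('n)) + (real (mdeg (a' e) + mdeg (b' e)) / 2 - real (mdeg M + mdeg e)) > - k"
      unfolding q using k unfolding N_def by linarith
    from set_integrable_monom_radial[OF wr[OF Edeg[OF e]] this]
    show "ball_integrable (T e)" "T e \<in> borel_measurable borel"
      unfolding T_def[abs_def] by blast+
  qed
  define c where "c e = (\<Prod>i\<in>UNIV. real (min (a i) (b i) choose e i) * pochhammer (- real (max (a i) (b i))) (min (a i) (b i) - e i))" for e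
  define u where "u x = (\<Sum>e\<in>E. of_real (c e) * T e x)" for x
  have ui: "ball_integrable u" unfolding u_def[abs_def] by (rule set_integrable_sum_mult[OF Ti])
  have um: "u \<in> borel_measurable borel" unfolding u_def[abs_def]
    by (intro borel_measurable_sum borel_measurable_times borel_measurable_const Tm)
  have "hcoef u m = of_real (measure lebesgue (unit_ball :: (complex^'n) set)) * rcoef (monopoly a b) m" for m
  proof -
    obtain x y where m: "m = (x, y)" by (cases m)
    have mu: "moment u m = (\<Sum>e\<in>E. of_real (c e) * moment (T e) m)"
      unfolding u_def[abs_def] by (rule moment_sum[OF Ti])
    have res: "(\<lambda>j. a' e j + y j) = (\<lambda>j. b' e j + x j) \<longleftrightarrow> (\<forall>i. a i + y i = b i + x i)" for e
    proof -
      have "a' e i + y i = b' e i + x i \<longleftrightarrow> a i + y i = b i + x i" for i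
        unfolding a'_def b'_def \<mu>_def by linarith
      then show ?thesis by (auto simp: fun_eq_iff)
    qed
    show ?thesis
    proof (cases "\<forall>i. a i + y i = b i + x i")
      case False
      have "moment (T e) m = 0" if e: "e \<in> E" for e
        unfolding T_def[abs_def] m using False res[of e] by (subst moment_monom_radial[OF wr[OF Edeg[OF e]]]) auto
      then have "hcoef u m = 0" by (simp add: hcoef_def mu)
      moreover have "\<nexists>g. m = (\<lambda>j. a j + g j, \<lambda>j. b j + g j)" using False by (auto simp: m)
      ultimately show ?thesis by (simp add: rcoef_monopoly_0)
    next
      case True
      have dxy: "A + mdeg y = B + mdeg x" unfolding A_def B_def mdeg_def sum.distrib[symmetric] using True by simp
      \<comment> \<open>The argument at which the transform of \<open>w\<close> is evaluated, rate
        minus shift. It is the same for all \<open>e\<close>, because the degree of a' e and the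
        shift both grow by |e|.\<close>
      define X where "X = N + mdeg y - B"
      have XB: "X + B = N + mdeg y" and XA: "X + A = N + mdeg x" using mAB dxy by (auto simp: X_def)
      \<comment> \<open>Independent of \<open>e\<close>: the factor (X + m - 1)! of the transform,
        with m = |M| + |e|, cancels (N + |delta| - 1)! from the diagonal integral. This cancellation
        dictates the factorial quotient in \<open>mellin_pair_factorials\<close> and leaves only
        \<open>mfact\<close> for the Chu-Vandermonde sum.\<close>
      define K where "K = pi ^ N * (fact X / (fact (N + mdeg x) * fact (N + mdeg y)))"
      have Te: "moment (T e) m = of_real (K * mfact (\<lambda>i. a' e i + y i))" if e: "e \<in> E" for e
      proof -
        define \<delta> where "\<delta> = (\<lambda>i. a' e i + y i)"
        have dd: "mdeg \<delta> = mdeg (a' e) + mdeg y" by (simp add: \<delta>_def mdeg_def sum.distrib)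
        have XM: "X + (mdeg M + mdeg e) = N + mdeg \<delta>" using dd da[of e] MAB XB dxy by linarith
        have rx: "real (CARD('n) + mdeg \<delta>) - real (mdeg M + mdeg e) = real X" using XM by (simp add: N_def)
        note rr = r[OF Edeg[OF e], of X, unfolded XM XA XB]
        have "moment (T e) m = of_real (pi ^ N * mfact \<delta> / fact (N + mdeg \<delta> - 1) * r (mdeg e) (real X))"
          unfolding T_def[abs_def] m using True res[of e] rr rx
          by (subst moment_monom_radial[OF wr[OF Edeg[OF e]]]) (auto simp: \<delta>_def[symmetric] N_def[symmetric])
        also have "pi ^ N * mfact \<delta> / fact (N + mdeg \<delta> - 1) * r (mdeg e) (real X) = K * mfact \<delta>"
          using rr by (simp add: K_def)
        finally show ?thesis by (simp add: \<delta>_def)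
      qed
      have "moment u m = of_real (K * (\<Sum>e\<in>E. c e * mfact (\<lambda>i. a' e i + y i)))"
        unfolding mu sum_distrib_left of_real_sum by (intro sum.cong refl) (simp add: Te)
      also have "(\<Sum>e\<in>E. c e * mfact (\<lambda>i. a' e i + y i)) = (if \<forall>i. a i \<le> x i then mfact x * mfact y / mfact (\<lambda>i. x i - a i) else 0)"
        unfolding E_def c_def a'_def \<mu>_def using mfact_pochhammer_sum[of a y b x] True by simp
      finally have mom: "moment u m = of_real (K * (if \<forall>i. a i \<le> x i then mfact x * mfact y / mfact (\<lambda>i. x i - a i) else 0))" .
      show ?thesis
      proof (cases "\<forall>i. a i \<le> x i")
        case le: True
        define g where "g i = x i - a i" for i
        have "x i = a i + g i" "y i = b i + g i" for i
          using le[rule_format, of i] True[rule_format, of i] unfolding g_def by linarith+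
        then have xg: "x = (\<lambda>i. a i + g i)" "y = (\<lambda>i. b i + g i)" by (simp_all add: fun_eq_iff)
        have Xg: "X = N + mdeg g" using XB xg by (simp add: mdeg_def sum.distrib B_def)
        have pos: "mfact x > 0" "mfact y > 0" "mfact g > 0" by (rule mfact_pos)+
        have "hcoef u m = of_real (fact (N + mdeg x) * fact (N + mdeg y) / ((fact N)\<^sup>2 * (mfact x * mfact y)) * (K * (mfact x * mfact y / mfact g)))"
        proof -
          have "g = (\<lambda>i. x i - a i)" by (simp add: fun_eq_iff g_def)
          then have mom': "moment u m = of_real (K * (mfact x * mfact y / mfact g))" using mom le by simp
          show ?thesis unfolding hcoef_def mom' by (simp only: m fst_conv snd_conv N_def of_real_mult)
        qed
        also have "fact (N + mdeg x) * fact (N + mdeg y) / ((fact N)\<^sup>2 * (mfact x * mfact y)) * (K * (mfact x * mfact y / mfact g))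
           = pi ^ N / fact N * (fact (N + mdeg g) / (fact N * mfact g))"
          using pos by (simp add: K_def Xg power2_eq_square)
        finally show ?thesis unfolding m xg rcoef_monopoly measure_unit_ball N_def by simp
      next
        case False
        then have "hcoef u m = 0" by (auto simp: hcoef_def mom)
        moreover have "\<nexists>g. m = (\<lambda>j. a j + g j, \<lambda>j. b j + g j)" using False by (auto simp: m)
        ultimately show ?thesis by (simp add: rcoef_monopoly_0)
      qed
    qed
  qed
  then have "\<forall>z\<in>unit_ball. zzeval (monopoly a b) z = berezin u z"
    using berezin_moment_iff[OF ui is_zzpoly_monopoly] by blast
  then show ?thesis using ui um by (auto simp: zzeval_monopoly)
qed

section \<open>Invariance under ball automorphisms\<close>

lemma cinner_add_left: "cinner (x + y) w = cinner x w + cinner y w"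
  by (simp add: cinner_def distrib_right sum.distrib)

lemma cinner_diff_left: "cinner (x - y) w = cinner x w - cinner y w"
  by (simp add: cinner_def left_diff_distrib sum_subtractf)

lemma cinner_smult_left: "cinner (c *s x) w = c * cinner x w"
  by (simp add: cinner_def sum_distrib_left mult.assoc)

lemma cinner_cnj: "cinner w z = cnj (cinner z w)"
  by (simp add: cinner_def mult.commute)

lemma cinner_diff_right: "cinner w (x - y) = cinner w x - cinner w y"
  by (simp add: cinner_def right_diff_distrib sum_subtractf)

lemma cinner_smult_right: "cinner w (c *s x) = cnj c * cinner w x"
  by (simp add: cinner_def sum_distrib_left mult_ac)

lemma cinner_self: "cinner z z = of_real ((norm z)\<^sup>2)"
  unfolding cinner_def by (rule cnj_inner_self)

lemma norm_smult_vec: "norm (c *s x) = cmod c * norm x" for x :: "complex^'n"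
  by (simp add: norm_vec_def norm_mult L2_set_right_distrib)

lemma scaleR_eq_smult_vec: "r *\<^sub>R x = of_real r *s x" for x :: "complex^'n"
  unfolding vec_eq_iff vector_scaleR_component vector_smult_component by (simp add: scaleR_conv_of_real)

definition cosw :: "complex^'n \<Rightarrow> real" where "cosw w = sqrt (1 - (norm w)\<^sup>2)"

lemma cosw:
  assumes "w \<in> unit_ball"
  shows "cosw w > 0" "(cosw w)\<^sup>2 = 1 - (norm w)\<^sup>2" "cinner w w = of_real ((1 - cosw w) * (1 + cosw w))"
proof -
  have "(norm w)\<^sup>2 < 1" using assms by (simp add: abs_square_less_1)
  then show "cosw w > 0" and *: "(cosw w)\<^sup>2 = 1 - (norm w)\<^sup>2" by (simp_all add: cosw_def)
  show "cinner w w = of_real ((1 - cosw w) * (1 + cosw w))"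
  proof -
    have "(norm w)\<^sup>2 = (1 - cosw w) * (1 + cosw w)" using * by (simp add: algebra_simps power2_eq_square)
    then show ?thesis unfolding cinner_self by (simp only:)
  qed
qed

text \<open>With c = sqrt(1 - |w|^2) one has (1 - c) / |w|^2 = 1 / (1 + c). This removes the
  projection and the singular denominator, so that w = 0 is no longer exceptional.\<close>

lemma phi_eq:
  fixes w z :: "complex^'n"
  assumes w: "w \<in> unit_ball"
  shows "phi w z = (1 / (1 - cinner z w)) *s ((1 - cinner z w / of_real (1 + cosw w)) *s w - of_real (cosw w) *s z)"
proof (cases "w = 0")
  case True
  then show ?thesis by (simp add: phi_def cosw_def cinner_def vec_eq_iff)
next
  case False
  have nz: "(norm w)\<^sup>2 \<noteq> 0" using False by simp
  have "(norm w)\<^sup>2 = (1 - cosw w) * (1 + cosw w)" using cosw(2)[OF w] by (simp add: algebra_simps power2_eq_square)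
  then have r: "(1 - cosw w) / (norm w)\<^sup>2 = 1 / (1 + cosw w)" using nz cosw(1)[OF w] by (simp add: field_simps)
  have r': "cinner z w / of_real (1 + cosw w) = cinner z w / of_real ((norm w)\<^sup>2) * (1 - of_real (cosw w))"
  proof -
    have "of_real ((1 - cosw w) / (norm w)\<^sup>2) = (of_real (1 / (1 + cosw w)) :: complex)" using r by simp
    then show ?thesis by (simp add: divide_inverse mult_ac)
  qed
  define p where "p = cinner z w / of_real ((norm w)\<^sup>2)"
  have "phi w z = (1 / (1 - cinner z w)) *s (w - p *s w - of_real (cosw w) *s (z - p *s w))"
    using False by (simp add: phi_def Let_def p_def cosw_def scaleR_eq_smult_vec)
  also have "w - p *s w - of_real (cosw w) *s (z - p *s w) = (1 - p * (1 - of_real (cosw w))) *s w - of_real (cosw w) *s z"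
    by (simp add: vec_eq_iff algebra_simps)
  finally show ?thesis unfolding r' p_def .
qed

text \<open>\<open>\<phi>_w\<close> in homogeneous coordinates.\<close>

definition mlift :: "complex^'n \<Rightarrow> complex \<times> (complex^'n) \<Rightarrow> complex \<times> (complex^'n)" where
  "mlift w = (\<lambda>(a, z). ((a - cinner z w) / of_real (cosw w),
      ((a - cinner z w / of_real (1 + cosw w)) / of_real (cosw w)) *s w - z))"

lemma mlift_scale: "mlift w (t * a, t *s z) = (t * fst (mlift w (a, z)), t *s snd (mlift w (a, z)))"
  by (simp add: mlift_def cinner_smult_left vec_eq_iff) (simp add: algebra_simps diff_divide_distrib)

lemma mlift_linear: "linear (mlift w)"
proof (rule linearI)
  show "mlift w (p + q) = mlift w p + mlift w q" for p q
    by (cases p, cases q)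
       (simp add: mlift_def cinner_add_left vec_eq_iff add_divide_distrib diff_divide_distrib algebra_simps)
  show "mlift w (r *\<^sub>R p) = r *\<^sub>R mlift w p" for r p
  proof (cases p)
    case (Pair a z)
    have "r *\<^sub>R p = (of_real r * a, of_real r *s z)"
      unfolding Pair scaleR_Pair scaleR_eq_smult_vec by (simp add: scaleR_conv_of_real)
    then have "mlift w (r *\<^sub>R p) = (of_real r * fst (mlift w p), of_real r *s snd (mlift w p))"
      by (simp only: mlift_scale Pair)
    also have "\<dots> = (r *\<^sub>R fst (mlift w p), r *\<^sub>R snd (mlift w p))"
      by (simp only: scaleR_eq_smult_vec) (simp add: scaleR_conv_of_real)
    finally show ?thesis by (simp only: scaleR_prod_def)
  qed
qed

lemma mlift_involution:
  assumes w: "w \<in> unit_ball" shows "mlift w (mlift w p) = p"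
proof -
  obtain a z where p: "p = (a, z)" by (cases p)
  define c where "c = (of_real (cosw w) :: complex)"
  have c: "c \<noteq> 0" "1 + c \<noteq> 0" using cosw(1)[OF w] by (auto simp: c_def complex_eq_iff)
  have ww: "cinner w w = (1 - c) * (1 + c)" using cosw(3)[OF w] by (simp add: c_def)
  define k where "k = cinner z w"
  define a' where "a' = (a - k) / c"
  define d where "d = (a - k / (1 + c)) / c"
  define z' where "z' = d *s w - z"
  have mp: "mlift w (a, z) = (a', z')" by (simp add: mlift_def a'_def z'_def d_def k_def c_def)
  have k': "cinner z' w = d * ((1 - c) * (1 + c)) - k" by (simp add: z'_def cinner_diff_left cinner_smult_left ww k_def)
  define K where "K = k / (1 + c)"
  have K: "k = (1 + c) * K" using c by (simp add: K_def)
  have dK: "d = (a - K) / c" by (simp add: d_def K_def)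
  have 1: "(a' - cinner z' w) / c = a" unfolding k' a'_def dK unfolding K using c(1) by (simp add: field_simps)
  have q: "cinner z' w / (1 + c) = d * (1 - c) - K" unfolding k' unfolding K using c(2)
    by (simp add: diff_divide_distrib mult.assoc[symmetric])
  have 2: "(a' - cinner z' w / (1 + c)) / c = d" unfolding q a'_def dK unfolding K using c(1)
    by (simp add: field_simps)
  have "mlift w (a', z') = (a, d *s w - z')"
    using 1 2 by (simp add: mlift_def c_def)
  then show ?thesis using mp p by (simp add: z'_def)
qed

lemma mlift_form:
  assumes w: "w \<in> unit_ball"
  shows "fst (mlift w (a, z)) * cnj (fst (mlift w (b, y))) - cinner (snd (mlift w (a, z))) (snd (mlift w (b, y)))
    = a * cnj b - cinner z y"
proof -
  define c where "c = (of_real (cosw w) :: complex)"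
  have c: "c \<noteq> 0" "1 + c \<noteq> 0" using cosw(1)[OF w] by (auto simp: c_def complex_eq_iff)
  have cc: "cnj c = c" by (simp add: c_def)
  have ww: "cinner w w = (1 - c) * (1 + c)" using cosw(3)[OF w] by (simp add: c_def)
  define k where "k = cinner z w"
  define t where "t = cinner w y"
  have t': "cinner y w = cnj t" unfolding t_def by (rule cinner_cnj)
  define d where "d = (a - k / (1 + c)) / c"
  define e where "e = (cnj b - t / (1 + c)) / c"
  have e': "cnj ((b - cinner y w / (1 + c)) / c) = e" by (simp add: e_def t' cc)
  have f1: "fst (mlift w (a, z)) * cnj (fst (mlift w (b, y))) = (a - k) / c * ((cnj b - t) / c)"
    by (simp add: mlift_def k_def t' cc flip: c_def)
  have f2: "cinner (snd (mlift w (a, z))) (snd (mlift w (b, y)))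
     = d * e * ((1 - c) * (1 + c)) - d * t - e * k + cinner z y"
    unfolding mlift_def prod.case snd_conv cinner_diff_left cinner_diff_right cinner_smult_left cinner_smult_right
      c_def[symmetric] of_real_add of_real_1 e' ww
    by (simp add: d_def k_def t_def algebra_simps flip: c_def)
  have f3: "(a - k) / c * ((cnj b - t) / c) - (d * e * ((1 - c) * (1 + c)) - d * t - e * k) = a * cnj b"
  proof -
    define K where "K = k / (1 + c)"
    define T where "T = t / (1 + c)"
    have kt: "k = (1 + c) * K" "t = (1 + c) * T" using c by (simp_all add: K_def T_def)
    have de: "d = (a - K) / c" "e = (cnj b - T) / c" by (simp_all add: d_def e_def K_def T_def)
    show ?thesis unfolding de unfolding kt using c(1) by (simp add: field_simps)
  qed
  show ?thesis unfolding f1 f2 f3[symmetric] by (simp only: diff_diff_eq)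
qed

lemma mlift_phi:
  assumes w: "w \<in> unit_ball" and z: "z \<in> unit_ball"
  shows "snd (mlift w (1, z)) = fst (mlift w (1, z)) *s phi w z" "fst (mlift w (1, z)) \<noteq> 0"
proof -
  define c where "c = (of_real (cosw w) :: complex)"
  have c: "c \<noteq> 0" "1 + c \<noteq> 0" using cosw(1)[OF w] by (auto simp: c_def complex_eq_iff)
  have "cmod (cinner z w) \<le> norm z * norm w" by (rule norm_cinner_le)
  also have "\<dots> \<le> norm z * 1" using w by (intro mult_left_mono) auto
  also have "\<dots> < 1" using z by simp
  finally have k: "1 - cinner z w \<noteq> 0" by auto
  then show "fst (mlift w (1, z)) \<noteq> 0" using c by (simp add: mlift_def flip: c_def)
  show "snd (mlift w (1, z)) = fst (mlift w (1, z)) *s phi w z"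
    unfolding phi_eq[OF w] mlift_def prod.case fst_conv snd_conv vector_smult_assoc using c k
    by (simp add: vec_eq_iff field_simps flip: c_def)
qed

text \<open>The preserved Hermitian form evaluated at the lifts (1, z) and (1, y), whose images are
  multiples of (1, phi w z) and (1, phi w y). The automorphy factor is (1 - <z,w>) / sqrt(1 -
  |w|^2).\<close>

lemma phi_form:
  assumes w: "w \<in> unit_ball" and z: "z \<in> unit_ball" and y: "y \<in> unit_ball"
  defines "a \<equiv> fst (mlift w (1, z))" and "b \<equiv> fst (mlift w (1, y))"
  shows "a * cnj b * (1 - cinner (phi w z) (phi w y)) = 1 - cinner z y"
  using mlift_form[OF w, of 1 z 1 y] unfolding mlift_phi(1)[OF w z] mlift_phi(1)[OF w y] cinner_smult_left cinner_smult_right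
  by (simp add: a_def b_def algebra_simps)

lemma phi_norm:
  assumes w: "w \<in> unit_ball" and z: "z \<in> unit_ball"
  shows "(cmod (fst (mlift w (1, z))))\<^sup>2 * (1 - (norm (phi w z))\<^sup>2) = 1 - (norm z)\<^sup>2"
proof -
  have "of_real ((cmod (fst (mlift w (1, z))))\<^sup>2 * (1 - (norm (phi w z))\<^sup>2)) = (of_real (1 - (norm z)\<^sup>2) :: complex)"
    using phi_form[OF w z z] unfolding cinner_self complex_norm_square[symmetric] by simp
  then show ?thesis by (simp only: of_real_eq_iff)
qed

lemma phi_in_ball:
  assumes w: "w \<in> unit_ball" and z: "z \<in> unit_ball" shows "phi w z \<in> unit_ball"
proof -
  have "(norm z)\<^sup>2 < 1" using z by (simp add: abs_square_less_1)
  then have "(cmod (fst (mlift w (1, z))))\<^sup>2 * (1 - (norm (phi w z))\<^sup>2) > 0" unfolding phi_norm[OF w z] by simp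
  then have "1 - (norm (phi w z))\<^sup>2 > 0" by (simp add: zero_less_mult_iff)
  then show ?thesis by (simp add: abs_square_less_1)
qed

text \<open>The Berezin kernel with respect to the invariant measure: the factor (1 - |x|^2)^(N+1)
  compensates the density of that measure and makes the kernel symmetric and invariant in both
  arguments.\<close>

definition hypkernel :: "complex^'n \<Rightarrow> complex^'n \<Rightarrow> real" where
  "hypkernel z x = ((1 - (norm z)\<^sup>2) * (1 - (norm x)\<^sup>2) / (cmod (1 - cinner z x))\<^sup>2) ^ (CARD('n) + 1)"

lemma hypkernel_phi:
  assumes w: "w \<in> unit_ball" and z: "z \<in> unit_ball" and y: "y \<in> unit_ball"
  shows "hypkernel (phi w z) (phi w y) = hypkernel z y"
proof -
  define a where "a = fst (mlift w (1, z))"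
  define b where "b = fst (mlift w (1, y))"
  have nz: "cmod a > 0" "cmod b > 0" using mlift_phi(2)[OF w z] mlift_phi(2)[OF w y] by (simp_all add: a_def b_def)
  have "cmod a * cmod b * cmod (1 - cinner (phi w z) (phi w y)) = cmod (1 - cinner z y)"
    using arg_cong[OF phi_form[OF w z y], of cmod] by (simp add: norm_mult a_def b_def)
  then have e: "(cmod (1 - cinner z y))\<^sup>2 = (cmod a)\<^sup>2 * (cmod b)\<^sup>2 * (cmod (1 - cinner (phi w z) (phi w y)))\<^sup>2"
    by (metis power_mult_distrib)
  have gen: "(A * p) * (B * q) / (A * B * r) = p * q / r" if "A \<noteq> 0" "B \<noteq> 0" for A B p q r :: real
    using that by (simp add: field_simps)
  show ?thesis
    unfolding hypkernel_def e phi_norm[OF w z, symmetric] phi_norm[OF w y, symmetric] a_def[symmetric] b_def[symmetric]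
    using nz by (subst gen) simp_all
qed

lemma borel_measurable_vecI:
  fixes f :: "'a \<Rightarrow> 'c::euclidean_space^'n::finite"
  assumes "\<And>i. (\<lambda>x. f x $ i) \<in> borel_measurable M" shows "f \<in> borel_measurable M"
  using assms by (subst borel_measurable_euclidean_space) (auto simp: Basis_vec_def inner_axis)

lemma cinner_measurable_left [measurable]: "(\<lambda>z. cinner z w) \<in> borel_measurable borel"
  unfolding cinner_def by (intro borel_measurable_continuous_onI continuous_intros)

lemma phi_measurable:
  assumes w: "w \<in> unit_ball" shows "phi w \<in> borel_measurable borel"
proof (rule borel_measurable_vecI)
  fix i
  show "(\<lambda>z. phi w z $ i) \<in> borel_measurable borel"
    unfolding phi_eq[OF w] vector_smult_component vector_minus_component by measurable
qed

text \<open>The extension of \<open>G\<close> to a homogeneous function of degree 0 on the cone \<open>|z| < |a|\<close>, cut off by a condition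
that \<open>mlift w\<close> preserves. Integrating out \<open>a\<close> turns Lebesgue measure into the invariant measure of the ball.\<close>

definition cone_fun :: "(complex^'n \<Rightarrow> ennreal) \<Rightarrow> complex \<times> (complex^'n) \<Rightarrow> ennreal" where
  "cone_fun G p = (if norm (snd p) < norm (fst p) \<and> (norm (fst p))\<^sup>2 - (norm (snd p))\<^sup>2 < 1 then G ((1 / fst p) *s snd p) else 0)"

lemma cone_fun_measurable:
  assumes [measurable]: "G \<in> borel_measurable borel"
  shows "cone_fun G \<in> borel_measurable borel"
proof -
  have [measurable]: "(\<lambda>p::complex \<times> (complex^'n). snd p $ i) \<in> borel_measurable borel"
    "(\<lambda>p::complex \<times> (complex^'n). fst p) \<in> borel_measurable borel"
    "(\<lambda>p::complex \<times> (complex^'n). snd p) \<in> borel_measurable borel" for i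
    by (intro borel_measurable_continuous_onI continuous_intros)+
  have [measurable]: "(\<lambda>p::complex \<times> (complex^'n). (1 / fst p) *s snd p) \<in> borel_measurable borel"
    by (rule borel_measurable_vecI) (simp only: vector_smult_component, measurable)
  show ?thesis unfolding cone_fun_def[abs_def] by measurable
qed

text \<open>The substitution z = a x in the inner integral contributes |a|^(2N) and decouples
  \<open>G\<close> from a. By the cut-off, a then ranges over the disc of radius (1 - |x|^2)^(-1/2),
  and the integral of |a|^(2N) over it is pi / (N + 1) times the invariant density.\<close>

lemma nn_integral_cone_fun:
  fixes G :: "complex^'n \<Rightarrow> ennreal"
  assumes G[measurable]: "G \<in> borel_measurable borel"
  shows "(\<integral>\<^sup>+p. cone_fun G p \<partial>lborel)
    = ennreal (pi / (CARD('n) + 1)) * (\<integral>\<^sup>+x. ennreal (indicator unit_ball x / (1 - (norm x)\<^sup>2) ^ (CARD('n) + 1)) * G x \<partial>lborel)"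
proof -
  let ?N = "CARD('n)"
  interpret h: homogeneous "\<lambda>z::complex. norm z ^ (2 * ?N)" "2 * ?N" by (rule homogeneous_norm_power)
  have hm: "h.mass = pi / (?N + 1)" by (rule mass_norm_power)
  have cm: "cone_fun G \<in> borel_measurable (lborel \<Otimes>\<^sub>M lborel)"
    using cone_fun_measurable[OF G] by (simp add: lborel_prod)
  define F where "F a x = ennreal (norm a ^ (2 * ?N)) * (if norm x < 1 \<and> (norm a)\<^sup>2 * (1 - (norm x)\<^sup>2) < 1 then G x else 0)" for a :: complex and x
  have "(\<integral>\<^sup>+p. cone_fun G p \<partial>lborel) = (\<integral>\<^sup>+a. \<integral>\<^sup>+z. cone_fun G (a, z) \<partial>lborel \<partial>lborel)"
    using lborel.nn_integral_fst[OF cm] by (simp add: lborel_prod)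
  also have "\<dots> = (\<integral>\<^sup>+a. \<integral>\<^sup>+x. F a x \<partial>lborel \<partial>lborel)"
  proof (rule nn_integral_cong_AE, use AE_lborel_neq[of "0::complex"] in eventually_elim)
    fix a :: complex assume a: "a \<noteq> 0"
    have gm: "(\<lambda>z. cone_fun G (a, z)) \<in> borel_measurable borel"
      using measurable_compose[OF _ cone_fun_measurable[OF G], of "\<lambda>z. (a, z)" borel]
      by (simp add: borel_measurable_continuous_onI continuous_intros)
    have "(\<integral>\<^sup>+z. cone_fun G (a, z) \<partial>lborel) = ennreal (norm a ^ DIM(complex^'n)) * (\<integral>\<^sup>+x. cone_fun G (a, a *s x) \<partial>lborel)"
      by (rule nn_integral_similarity[OF _ _ _ gm])
         (use a in \<open>auto simp: norm_smult_vec linear_iff vec_eq_iff algebra_simps\<close>)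
    also have "\<dots> = (\<integral>\<^sup>+x. F a x \<partial>lborel)"
    proof (subst nn_integral_cmult[symmetric])
      have "(\<lambda>x. a *s x) \<in> borel_measurable borel"
        by (rule borel_measurable_vecI) (simp only: vector_smult_component, measurable)
      from measurable_compose[OF this gm] show "(\<lambda>x. cone_fun G (a, a *s x)) \<in> borel_measurable lborel" by simp
      show "(\<integral>\<^sup>+x. ennreal (norm a ^ DIM(complex^'n)) * cone_fun G (a, a *s x) \<partial>lborel) = (\<integral>\<^sup>+x. F a x \<partial>lborel)"
      proof (rule nn_integral_cong)
        fix x :: "complex^'n"
        have "cmod a * norm x < cmod a \<longleftrightarrow> norm x < 1" using a by simp
        moreover have "(cmod a)\<^sup>2 - (cmod a * norm x)\<^sup>2 = (cmod a)\<^sup>2 * (1 - (norm x)\<^sup>2)"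
          by (simp add: power_mult_distrib algebra_simps)
        moreover have "(1 / a) *s (a *s x) = x" using a by (simp add: vector_smult_assoc)
        ultimately show "ennreal (norm a ^ DIM(complex^'n)) * cone_fun G (a, a *s x) = F a x"
          by (simp add: cone_fun_def F_def norm_smult_vec mult.commute)
      qed
    qed
    finally show "(\<integral>\<^sup>+z. cone_fun G (a, z) \<partial>lborel) = (\<integral>\<^sup>+x. F a x \<partial>lborel)" .
  qed
  also have "\<dots> = (\<integral>\<^sup>+x. \<integral>\<^sup>+a. F a x \<partial>lborel \<partial>lborel)"
    unfolding F_def by (rule lborel_pair.Fubini'[symmetric]) measurable
  also have "\<dots> = (\<integral>\<^sup>+x. ennreal (pi / (?N + 1)) * (ennreal (indicator unit_ball x / (1 - (norm x)\<^sup>2) ^ (?N + 1)) * G x) \<partial>lborel)"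
  proof (rule nn_integral_cong)
    fix x :: "complex^'n"
    show "(\<integral>\<^sup>+a. F a x \<partial>lborel) = ennreal (pi / (?N + 1)) * (ennreal (indicator unit_ball x / (1 - (norm x)\<^sup>2) ^ (?N + 1)) * G x)"
    proof (cases "x \<in> unit_ball")
      case True
      define q where "q = 1 - (norm x)\<^sup>2"
      have q: "q > 0" using True by (simp add: q_def abs_square_less_1)
      have iff: "(cmod a)\<^sup>2 * q < 1 \<longleftrightarrow> a \<in> ball 0 (1 / sqrt q)" for a
      proof -
        have "(cmod a)\<^sup>2 * q < 1 \<longleftrightarrow> (cmod a * sqrt q)\<^sup>2 < 1" using q by (simp add: power_mult_distrib)
        also have "\<dots> \<longleftrightarrow> cmod a * sqrt q < 1" using q by (simp add: abs_square_less_1)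
        finally show ?thesis using q by (simp add: field_simps)
      qed
      have "(\<integral>\<^sup>+a. F a x \<partial>lborel) = (\<integral>\<^sup>+a. G x * (ennreal (norm (a::complex) ^ (2 * ?N)) * indicator (ball 0 (1 / sqrt q)) a) \<partial>lborel)"
        unfolding F_def q_def[symmetric] iff using True
        by (intro nn_integral_cong) (auto simp: indicator_def mult.commute)
      also have "\<dots> = G x * ennreal ((1 / sqrt q) ^ (DIM(complex) + 2 * ?N) * h.mass)"
        using q by (subst nn_integral_cmult) (auto simp: h.nn_integral_ball)
      also have "(1 / sqrt q) ^ (DIM(complex) + 2 * ?N) = 1 / q ^ (?N + 1)"
      proof -
        have "(1 / sqrt q) ^ (2 * (?N + 1)) = 1 / q ^ (?N + 1)" using q by (simp add: power_one_over power_mult del: power_Suc mult_Suc_right)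
        then show ?thesis by simp
      qed
      finally show ?thesis using True q unfolding hm
        by (simp add: q_def[symmetric] mult_ac ennreal_mult' flip: ennreal_mult')
    qed (simp add: F_def)
  qed
  also have "\<dots> = ennreal (pi / (?N + 1)) * (\<integral>\<^sup>+x. ennreal (indicator unit_ball x / (1 - (norm x)\<^sup>2) ^ (?N + 1)) * G x \<partial>lborel)"
    by (rule nn_integral_cmult) measurable
  finally show ?thesis .
qed

lemma cone_fun_mlift:
  assumes w: "w \<in> unit_ball"
  shows "cone_fun G (mlift w p) = cone_fun (\<lambda>x. G (phi w x)) p"
proof -
  obtain a z where p: "p = (a, z)" by (cases p)
  define a' where "a' = fst (mlift w (a, z))"
  define z' where "z' = snd (mlift w (a, z))"
  have "of_real ((cmod a')\<^sup>2 - (norm z')\<^sup>2) = (of_real ((cmod a)\<^sup>2 - (norm z)\<^sup>2) :: complex)"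
    using mlift_form[OF w, of a z a z] by (simp add: a'_def z'_def cinner_self flip: complex_norm_square)
  then have form: "(cmod a')\<^sup>2 - (norm z')\<^sup>2 = (cmod a)\<^sup>2 - (norm z)\<^sup>2" by (simp only: of_real_eq_iff)
  have less: "norm y < norm b \<longleftrightarrow> 0 < (cmod b)\<^sup>2 - (norm y)\<^sup>2" for y :: "complex^'a" and b :: complex
  proof -
    have "(norm b)\<^sup>2 \<le> (norm y)\<^sup>2 \<longleftrightarrow> norm b \<le> norm y" by (rule power_mono_iff) simp_all
    then show ?thesis by linarith
  qed
  have G: "G ((1 / a') *s z') = G (phi w ((1 / a) *s z))" if nz: "norm z < norm a"
  proof -
    have a: "a \<noteq> 0" using nz by auto
    define y where "y = (1 / a) *s z"
    have y: "y \<in> unit_ball" using nz a by (simp add: y_def norm_smult_vec norm_divide)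
    have "(a, z) = (a * 1, a *s y)" using a by (simp add: y_def vector_smult_assoc)
    then have m: "mlift w (a, z) = (a * fst (mlift w (1, y)), a *s (fst (mlift w (1, y)) *s phi w y))"
      using mlift_scale[of w a 1 y] mlift_phi(1)[OF w y] by simp
    have "(1 / a') *s z' = phi w y"
      using mlift_phi(2)[OF w y] a by (simp add: a'_def z'_def m vector_smult_assoc)
    then show ?thesis by (simp add: y_def)
  qed
  have "cone_fun G (mlift w p) = (if norm z' < norm a' \<and> (norm a')\<^sup>2 - (norm z')\<^sup>2 < 1 then G ((1 / a') *s z') else 0)"
    by (simp add: cone_fun_def p a'_def z'_def)
  also have "\<dots> = (if norm z < norm a \<and> (norm a)\<^sup>2 - (norm z)\<^sup>2 < 1 then G (phi w ((1 / a) *s z)) else 0)"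
    using G unfolding less form by auto
  finally show ?thesis by (simp add: cone_fun_def p)
qed

section \<open>The invariant measure and the Berezin transform\<close>

definition hyp_density :: "complex^'n \<Rightarrow> real" where
  "hyp_density x = indicator unit_ball x / (1 - (norm x)\<^sup>2) ^ (CARD('n) + 1)"

lemma hyp_density_measurable [measurable]: "hyp_density \<in> borel_measurable borel"
  unfolding hyp_density_def[abs_def] by measurable

lemma hyp_density_nonneg: "0 \<le> hyp_density x"
  by (auto simp: hyp_density_def indicator_def abs_square_le_1)

definition hyp :: "(complex^'n) measure" where
  "hyp = density lborel hyp_density"

lemma sets_hyp [measurable_cong, simp]: "sets hyp = sets borel"
  by (simp add: hyp_def)

text \<open>On the cone \<open>phi w\<close> becomes the linear involution \<open>mlift w\<close>,
  which preserves Lebesgue measure, so no Jacobian of \<open>phi w\<close> is computed. The constant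
  from the fibre integral is positive and finite and cancels.\<close>

lemma nn_integral_hyp_phi:
  fixes G :: "complex^'n \<Rightarrow> ennreal"
  assumes w: "w \<in> unit_ball" and G[measurable]: "G \<in> borel_measurable borel"
  shows "(\<integral>\<^sup>+x. ennreal (hyp_density x) * G (phi w x) \<partial>lborel) = (\<integral>\<^sup>+x. ennreal (hyp_density x) * G x \<partial>lborel)"
proof -
  define c where "c = ennreal (pi / (CARD('n) + 1))"
  have c: "c \<noteq> 0" "c \<noteq> \<top>" by (auto simp: c_def ennreal_eq_0_iff not_le)
  have Gp: "(\<lambda>x. G (phi w x)) \<in> borel_measurable borel"
    by (rule measurable_compose[OF phi_measurable[OF w] G])
  have "c * (\<integral>\<^sup>+x. ennreal (hyp_density x) * G (phi w x) \<partial>lborel) = (\<integral>\<^sup>+p. cone_fun G (mlift w p) \<partial>lborel)"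
    unfolding cone_fun_mlift[OF w] nn_integral_cone_fun[OF Gp] c_def hyp_density_def ..
  also have "\<dots> = (\<integral>\<^sup>+p. cone_fun G p \<partial>lborel)"
    by (rule nn_integral_linear_involution[OF mlift_linear mlift_involution[OF w] cone_fun_measurable[OF G]])
  also have "\<dots> = c * (\<integral>\<^sup>+x. ennreal (hyp_density x) * G x \<partial>lborel)"
    unfolding nn_integral_cone_fun[OF G] c_def hyp_density_def ..
  finally show ?thesis using c by (simp add: ennreal_mult_cancel_left)
qed

lemma distr_hyp_phi:
  assumes w: "w \<in> unit_ball" shows "distr hyp borel (phi w) = hyp"
proof (rule measure_eqI)
  note [measurable] = phi_measurable[OF w]
  fix A assume "A \<in> sets (distr hyp borel (phi w))"
  then have A[measurable]: "A \<in> sets borel" by simp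
  have i: "indicator A \<in> borel_measurable borel" by (rule borel_measurable_indicator) simp
  have "emeasure (distr hyp borel (phi w)) A = (\<integral>\<^sup>+x. indicator A x \<partial>distr hyp borel (phi w))" by simp
  also have "\<dots> = (\<integral>\<^sup>+x. indicator A (phi w x) \<partial>hyp)" by (rule nn_integral_distr) measurable
  also have "\<dots> = (\<integral>\<^sup>+x. ennreal (hyp_density x) * indicator A (phi w x) \<partial>lborel)"
    unfolding hyp_def by (rule nn_integral_density) measurable
  also have "\<dots> = (\<integral>\<^sup>+x. ennreal (hyp_density x) * indicator A x \<partial>lborel)"
    by (rule nn_integral_hyp_phi[OF w i])
  also have "\<dots> = (\<integral>\<^sup>+x. indicator A x \<partial>hyp)"
    unfolding hyp_def by (rule nn_integral_density[symmetric]) measurable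
  finally show "emeasure (distr hyp borel (phi w)) A = emeasure hyp A" by simp
qed simp

lemma AE_hyp_ball: "AE x in hyp. x \<in> unit_ball"
  unfolding hyp_def by (subst AE_density) (auto simp: hyp_density_def indicator_def)

lemma hypkernel_measurable [measurable]: "hypkernel z \<in> borel_measurable borel"
  unfolding hypkernel_def[abs_def] by measurable

lemma cmod_1_minus_cinner:
  assumes "z \<in> unit_ball" "x \<in> unit_ball" shows "1 - norm z \<le> cmod (1 - cinner z x)" "cmod (1 - cinner z x) > 0"
proof -
  have "cmod (cinner z x) \<le> norm z * norm x" by (rule norm_cinner_le)
  also have "\<dots> \<le> norm z * 1" using assms by (intro mult_left_mono) auto
  finally show *: "1 - norm z \<le> cmod (1 - cinner z x)"
    using norm_triangle_ineq2[of 1 "cinner z x"] by simp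
  show "cmod (1 - cinner z x) > 0" using * assms(1) by auto
qed

lemma hyp_integrand:
  fixes z x :: "complex^'n" and c :: complex
  shows "hyp_density x *\<^sub>R (of_real (hypkernel z x) * c)
    = indicator unit_ball x *\<^sub>R (c * of_real ((1 - (norm z)\<^sup>2) ^ (CARD('n) + 1) / cmod (1 - cinner z x) ^ (2 * (CARD('n) + 1))))"
proof (cases "x \<in> unit_ball")
  case True
  define n where "n = CARD('n) + 1"
  have "1 - (norm x)\<^sup>2 > 0" using True by (simp add: abs_square_less_1)
  then have "hyp_density x * hypkernel z x = (1 - (norm z)\<^sup>2) ^ n / cmod (1 - cinner z x) ^ (2 * n)"
    using True unfolding hyp_density_def hypkernel_def n_def[symmetric]
    by (simp add: power_mult_distrib power_divide power_mult)
  then have "of_real (hyp_density x) * of_real (hypkernel z x) = (of_real ((1 - (norm z)\<^sup>2) ^ n / cmod (1 - cinner z x) ^ (2 * n)) :: complex)"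
    by (simp only: of_real_mult[symmetric])
  then show ?thesis using True unfolding n_def[symmetric] scaleR_conv_of_real mult.assoc[symmetric]
    by (simp only: indicator_simps if_True of_real_1 mult_1_left mult.commute)
qed (simp add: hyp_density_def)

lemma set_integrable_kernel:
  fixes u :: "complex^'n \<Rightarrow> complex"
  assumes u: "ball_integrable u" and z: "z \<in> unit_ball"
  shows "ball_integrable (\<lambda>x. u x * of_real (t / cmod (1 - cinner z x) ^ k))"
proof (rule set_integrable_mult_bounded[OF u])
  show "(\<lambda>x. of_real (t / cmod (1 - cinner z x) ^ k) :: complex) \<in> borel_measurable borel" by measurable
  fix x :: "complex^'n" assume x: "x \<in> unit_ball"
  have "\<bar>t\<bar> / cmod (1 - cinner z x) ^ k \<le> \<bar>t\<bar> / (1 - norm z) ^ k"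
    using cmod_1_minus_cinner[OF z x] z by (intro divide_left_mono power_mono mult_pos_pos zero_less_power) auto
  then show "norm (of_real (t / cmod (1 - cinner z x) ^ k) :: complex) \<le> \<bar>t\<bar> / (1 - norm z) ^ k"
    by (simp add: norm_divide norm_power)
qed

lemma integrable_hyp_iff:
  fixes u :: "complex^'n \<Rightarrow> complex"
  assumes [measurable]: "u \<in> borel_measurable borel"
  shows "integrable hyp (\<lambda>x. of_real (hypkernel z x) * u x) \<longleftrightarrow>
    ball_integrable (\<lambda>x. u x * of_real ((1 - (norm z)\<^sup>2) ^ (CARD('n) + 1) / cmod (1 - cinner z x) ^ (2 * (CARD('n) + 1))))"
proof -
  have "integrable hyp (\<lambda>x. of_real (hypkernel z x) * u x) \<longleftrightarrow> integrable lborel (\<lambda>x. hyp_density x *\<^sub>R (of_real (hypkernel z x) * u x))"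
    unfolding hyp_def using hyp_density_nonneg by (intro integrable_density) auto
  also have "\<dots> \<longleftrightarrow> integrable lebesgue (\<lambda>x. hyp_density x *\<^sub>R (of_real (hypkernel z x) * u x))"
    by (rule integrable_completion[symmetric]) measurable
  finally show ?thesis unfolding hyp_integrand set_integrable_def .
qed

lemma berezin_hyp:
  fixes u :: "complex^'n \<Rightarrow> complex"
  assumes [measurable]: "u \<in> borel_measurable borel"
  shows "berezin u z = of_real (1 / measure lebesgue (unit_ball :: (complex^'n) set)) * (\<integral>x. of_real (hypkernel z x) * u x \<partial>hyp)"
proof -
  let ?n = "CARD('n) + 1"
  define V where "V = measure lebesgue (unit_ball :: (complex^'n) set)"
  have "(\<integral>x. of_real (hypkernel z x) * u x \<partial>hyp) = (\<integral>x. hyp_density x *\<^sub>R (of_real (hypkernel z x) * u x) \<partial>lborel)"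
    unfolding hyp_def using hyp_density_nonneg by (intro integral_density) auto
  also have "\<dots> = (\<integral>x. hyp_density x *\<^sub>R (of_real (hypkernel z x) * u x) \<partial>lebesgue)"
    by (rule integral_lebesgue_lborel[symmetric]) measurable
  also have "\<dots> = (\<integral>x. of_real ((1 - (norm z)\<^sup>2) ^ ?n) * (indicator unit_ball x *\<^sub>R (u x / of_real (cmod (1 - cinner z x) ^ (2 * ?n)))) \<partial>lebesgue)"
    unfolding hyp_integrand by (intro Bochner_Integration.integral_cong refl) (simp only: of_real_divide mult_scaleR_right times_divide_eq_right mult.commute)
  also have "\<dots> = of_real ((1 - (norm z)\<^sup>2) ^ ?n) * (\<integral>x. indicator unit_ball x *\<^sub>R (u x / of_real (cmod (1 - cinner z x) ^ (2 * ?n))) \<partial>lebesgue)"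
    by (rule integral_mult_right_zero)
  finally show ?thesis unfolding berezin_def V_def[symmetric] set_lebesgue_integral_def
    by (simp only: of_real_divide of_real_1 times_divide_eq_left mult_1_left)
qed

text \<open>Written with \<open>hypkernel\<close> and \<open>hyp\<close>, the transform is built
  from invariant ingredients only, so the claim is the change of variables x -> phi w x.\<close>

lemma berezin_phi:
  fixes u :: "complex^'n \<Rightarrow> complex"
  assumes w: "w \<in> unit_ball" and um[measurable]: "u \<in> borel_measurable borel" and u: "ball_integrable u"
  shows "ball_integrable (\<lambda>x. u (phi w x))"
    and "\<And>z. z \<in> unit_ball \<Longrightarrow> berezin (\<lambda>x. u (phi w x)) z = berezin u (phi w z)"
proof -
  note [measurable] = phi_measurable[OF w]
  have upm[measurable]: "(\<lambda>x. u (phi w x)) \<in> borel_measurable borel"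
    by (rule measurable_compose[OF phi_measurable[OF w] um])
  have km: "(\<lambda>y. of_real (hypkernel a y) * u y) \<in> borel_measurable borel" for a by measurable
  have AEk: "AE x in hyp. of_real (hypkernel z x) * u (phi w x) = of_real (hypkernel (phi w z) (phi w x)) * u (phi w x)"
    if "z \<in> unit_ball" for z
    using AE_hyp_ball by eventually_elim (simp add: hypkernel_phi[OF w that])
  have pm: "phi w \<in> measurable hyp borel" by measurable
  have km1: "(\<lambda>x. of_real (hypkernel z x) * u (phi w x)) \<in> borel_measurable hyp" for z by measurable
  have km2: "(\<lambda>x. of_real (hypkernel (phi w z) (phi w x)) * u (phi w x)) \<in> borel_measurable hyp" for z
    using measurable_compose[OF pm km] .
  \<comment> \<open>Integrability is transported at z = 0. There kernel times density is the
    indicator of the ball, so integrability against \<open>hyp\<close> is the desired one for the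
    composition; for \<open>u\<close> itself the kernel at \<open>phi w 0\<close> times the density
    is bounded.\<close>
  have 0: "(0 :: complex^'n) \<in> unit_ball" by simp
  have "integrable hyp (\<lambda>x. of_real (hypkernel (phi w 0) x) * u x)"
    unfolding integrable_hyp_iff[OF um] by (rule set_integrable_kernel[OF u phi_in_ball[OF w 0]])
  then have "integrable (distr hyp borel (phi w)) (\<lambda>x. of_real (hypkernel (phi w 0) x) * u x)"
    unfolding distr_hyp_phi[OF w] .
  then have "integrable hyp (\<lambda>x. of_real (hypkernel (phi w 0) (phi w x)) * u (phi w x))"
    unfolding integrable_distr_eq[OF pm km] .
  then have "integrable hyp (\<lambda>x. of_real (hypkernel 0 x) * u (phi w x))"
    using integrable_cong_AE[OF km1 km2 AEk[OF 0]] by simp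
  then show "ball_integrable (\<lambda>x. u (phi w x))"
    unfolding integrable_hyp_iff[OF upm] by (simp add: cinner_def)
  fix z :: "complex^'n" assume z: "z \<in> unit_ball"
  have "(\<integral>x. of_real (hypkernel z x) * u (phi w x) \<partial>hyp) = (\<integral>x. of_real (hypkernel (phi w z) (phi w x)) * u (phi w x) \<partial>hyp)"
    by (rule integral_cong_AE[OF km1 km2 AEk[OF z]])
  also have "\<dots> = (\<integral>x. of_real (hypkernel (phi w z) x) * u x \<partial>distr hyp borel (phi w))"
    by (rule integral_distr[OF pm km, symmetric])
  finally show "berezin (\<lambda>x. u (phi w x)) z = berezin u (phi w z)"
    unfolding berezin_hyp[OF upm] berezin_hyp[OF um] distr_hyp_phi[OF w] by simp
qed

section \<open>Linear combinations, the degree condition and the theorem\<close>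

lemma berezin_sum:
  fixes u :: "'i \<Rightarrow> complex^'n \<Rightarrow> complex"
  assumes u: "\<And>i. i \<in> I \<Longrightarrow> ball_integrable (u i)" and z: "z \<in> unit_ball"
  shows "berezin (\<lambda>x. \<Sum>i\<in>I. c i * u i x) z = (\<Sum>i\<in>I. c i * berezin (u i) z)"
proof -
  let ?d = "\<lambda>x. of_real (cmod (1 - cinner z x) ^ (2 * (CARD('n) + 1))) :: complex"
  have ui: "ball_integrable (\<lambda>x. u i x / ?d x)" if "i \<in> I" for i
    using set_integrable_kernel[OF u[OF that] z, of 1 "2 * (CARD('n) + 1)"] by simp
  have "ball_integral (\<lambda>x. (\<Sum>i\<in>I. c i * u i x) / ?d x)
    = ball_integral (\<lambda>x. \<Sum>i\<in>I. c i * (u i x / ?d x))"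
    by (simp only: sum_divide_distrib times_divide_eq_right)
  also have "\<dots> = (\<Sum>i\<in>I. ball_integral (\<lambda>x. c i * (u i x / ?d x)))"
    unfolding set_lebesgue_integral_def scaleR_sum_right
    by (rule Bochner_Integration.integral_sum, unfold set_integrable_def[symmetric])
       (intro set_integrable_mult_right ui)
  also have "\<dots> = (\<Sum>i\<in>I. c i * ball_integral (\<lambda>x. u i x / ?d x))"
    by (simp only: set_integral_mult_right)
  finally show ?thesis unfolding berezin_def by (simp only: sum_distrib_left mult.left_commute)
qed

lemma zzpoly_in_range:
  fixes f :: "'n::finite zzpoly"
  assumes f: "is_zzpoly f"
    and good: "\<And>a b. f (a, b) \<noteq> 0 \<Longrightarrow> mdeg a = 0 \<or> mdeg b = 0 \<or> mdeg a + mdeg b \<le> 2 * CARD('n) + 1"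
  shows "\<exists>u. u \<in> borel_measurable borel \<and> ball_integrable u \<and> (\<forall>z\<in>unit_ball. zzeval f z = berezin u z)"
proof -
  let ?S = "{m. f m \<noteq> 0}"
  have "\<forall>m\<in>?S. \<exists>u. u \<in> borel_measurable borel \<and> ball_integrable u \<and> (\<forall>z\<in>unit_ball. zzmonom m z = berezin u z)"
  proof
    fix m assume m: "m \<in> ?S"
    obtain a b where ab: "m = (a, b)" by (cases m)
    then have "f (a, b) \<noteq> 0" using m by simp
    then show "\<exists>u. u \<in> borel_measurable borel \<and> ball_integrable u \<and> (\<forall>z\<in>unit_ball. zzmonom m z = berezin u z)"
      unfolding ab by (intro zzmonom_in_range good)
  qed
  then obtain u where u: "\<And>m. m \<in> ?S \<Longrightarrow> u m \<in> borel_measurable borel" "\<And>m. m \<in> ?S \<Longrightarrow> ball_integrable (u m)"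
    "\<And>m z. m \<in> ?S \<Longrightarrow> z \<in> unit_ball \<Longrightarrow> zzmonom m z = berezin (u m) z" by metis
  have "zzeval f z = berezin (\<lambda>x. \<Sum>m\<in>?S. f m * u m x) z" if z: "z \<in> unit_ball" for z
  proof -
    have "berezin (\<lambda>x. \<Sum>m\<in>?S. f m * u m x) z = (\<Sum>m\<in>?S. f m * berezin (u m) z)"
      by (rule berezin_sum[OF u(2) z])
    also have "\<dots> = zzeval f z" unfolding zzeval_def
    proof (rule sum.cong[OF refl])
      fix m assume m: "m \<in> ?S"
      show "f m * berezin (u m) z = f m * zzmonom m z" by (simp only: u(3)[OF m z])
    qed
    finally show ?thesis by (rule sym)
  qed
  moreover have "ball_integrable (\<lambda>x. \<Sum>m\<in>?S. f m * u m x)"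
    by (rule set_integrable_sum_mult[OF u(2)])
  moreover have "(\<lambda>x. \<Sum>m\<in>?S. f m * u m x) \<in> borel_measurable borel"
    by (intro borel_measurable_sum borel_measurable_times borel_measurable_const u(1))
  ultimately show ?thesis by blast
qed

text \<open>The coefficients of a mixed derivative are nonzero multiples of shifted coefficients of
  \<open>f\<close>, so nothing cancels. The derivatives kill exactly the monomials with |a| = 0 or
  |b| = 0 and lower the degree of the others by 2; since N >= 1, the subtraction in 2N - 1 is not
  truncated.\<close>

lemma tdeg_dz_dzbar:
  fixes f :: "'n::finite zzpoly"
  shows "(\<forall>j l. tdeg_le (dz j (dzbar l f)) (2 * CARD('n) - 1)) \<longleftrightarrow>
    (\<forall>a b. f (a, b) \<noteq> 0 \<longrightarrow> mdeg a = 0 \<or> mdeg b = 0 \<or> mdeg a + mdeg b \<le> 2 * CARD('n) + 1)"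
proof -
  have N: "CARD('n) \<ge> 1" by (simp add: Suc_le_eq card_gt_0_iff)
  have d: "dz j (dzbar l f) (a, b) = of_nat (a j + 1) * (of_nat (b l + 1) * f (up j a, up l b))" for j l a b
    by (simp add: dz_def dzbar_def)
  have nz: "dz j (dzbar l f) (a, b) \<noteq> 0 \<longleftrightarrow> f (up j a, up l b) \<noteq> 0" for j l a b
    unfolding d by (simp del: of_nat_add of_nat_Suc)
  show ?thesis
  proof (intro iffI allI impI)
    fix a b assume t: "\<forall>j l. tdeg_le (dz j (dzbar l f)) (2 * CARD('n) - 1)" and fab: "f (a, b) \<noteq> 0"
    show "mdeg a = 0 \<or> mdeg b = 0 \<or> mdeg a + mdeg b \<le> 2 * CARD('n) + 1"
    proof (rule ccontr)
      assume c: "\<not> ?thesis"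
      then obtain j l where jl: "0 < a j" "0 < b l" by auto
      have "dz j (dzbar l f) (down j a, down l b) \<noteq> 0"
        unfolding nz up_down[of a j, OF jl(1)] up_down[of b l, OF jl(2)] by (rule fab)
      then have "mdeg (down j a) + mdeg (down l b) \<le> 2 * CARD('n) - 1"
        using t unfolding tdeg_le_def mdeg_def by blast
      then show False using c mdeg_down[of a j, OF jl(1)] mdeg_down[of b l, OF jl(2)] N by linarith
    qed
  next
    fix j l assume g: "\<forall>a b. f (a, b) \<noteq> 0 \<longrightarrow> mdeg a = 0 \<or> mdeg b = 0 \<or> mdeg a + mdeg b \<le> 2 * CARD('n) + 1"
    show "tdeg_le (dz j (dzbar l f)) (2 * CARD('n) - 1)"
      unfolding tdeg_le_def mdeg_def[symmetric] nz
    proof (intro allI impI)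
      fix a b assume "f (up j a, up l b) \<noteq> 0"
      then have "mdeg (up j a) = 0 \<or> mdeg (up l b) = 0 \<or> mdeg (up j a) + mdeg (up l b) \<le> 2 * CARD('n) + 1" using g by blast
      then show "mdeg a + mdeg b \<le> 2 * CARD('n) - 1" unfolding mdeg_up using N by linarith
    qed
  qed
qed

theorem theorem5p1:
  shows
  "(\<forall>f :: 'n::finite zzpoly. is_zzpoly f \<longrightarrow>
      ((\<exists>u :: complex^'n \<Rightarrow> complex. set_integrable lebesgue unit_ball u \<and>
          (\<forall>z\<in>unit_ball. zzeval f z = berezin u z))
       \<longleftrightarrow> (\<forall>j l. tdeg_le (dz j (dzbar l f)) (2 * CARD('n) - 1)))) \<and>
   (\<forall>(s::nat) (w :: nat \<Rightarrow> complex^'n) (Q :: nat \<Rightarrow> 'n zzpoly).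
      (\<forall>j\<in>{1..s}. w j \<in> unit_ball \<and> is_zzpoly (Q j) \<and> tdeg_le (Q j) (2 * CARD('n) + 1)) \<longrightarrow>
      (\<exists>u :: complex^'n \<Rightarrow> complex. set_integrable lebesgue unit_ball u \<and>
          (\<forall>z\<in>unit_ball. berezin u z = (\<Sum>j=1..s. zzeval (Q j) (phi (w j) z)))))"
proof (intro conjI allI impI)
  fix f :: "'n zzpoly" assume f: "is_zzpoly f"
  show "(\<exists>u :: complex^'n \<Rightarrow> complex. set_integrable lebesgue unit_ball u \<and> (\<forall>z\<in>unit_ball. zzeval f z = berezin u z))
    \<longleftrightarrow> (\<forall>j l. tdeg_le (dz j (dzbar l f)) (2 * CARD('n) - 1))"
    unfolding tdeg_dz_dzbar
  proof (intro iffI allI impI)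
    fix a b assume "\<exists>u :: complex^'n \<Rightarrow> complex. set_integrable lebesgue unit_ball u \<and> (\<forall>z\<in>unit_ball. zzeval f z = berezin u z)"
    then obtain u :: "complex^'n \<Rightarrow> complex" where u: "set_integrable lebesgue unit_ball u" "\<forall>z\<in>unit_ball. zzeval f z = berezin u z" by blast
    assume "f (a, b) \<noteq> 0"
    then show "mdeg a = 0 \<or> mdeg b = 0 \<or> mdeg a + mdeg b \<le> 2 * CARD('n) + 1"
      using berezin_range_degree[OF u(1) f u(2), of "(a, b)"] by (simp del: mdeg_eq_0_iff) linarith
  next
    assume "\<forall>a b. f (a, b) \<noteq> 0 \<longrightarrow> mdeg a = 0 \<or> mdeg b = 0 \<or> mdeg a + mdeg b \<le> 2 * CARD('n) + 1"
    then show "\<exists>u :: complex^'n \<Rightarrow> complex. set_integrable lebesgue unit_ball u \<and> (\<forall>z\<in>unit_ball. zzeval f z = berezin u z)"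
      using zzpoly_in_range[OF f] by blast
  qed
next
  fix s :: nat and w :: "nat \<Rightarrow> complex^'n" and Q :: "nat \<Rightarrow> 'n zzpoly"
  assume Q: "\<forall>j\<in>{1..s}. w j \<in> unit_ball \<and> is_zzpoly (Q j) \<and> tdeg_le (Q j) (2 * CARD('n) + 1)"
  have "\<exists>v :: complex^'n \<Rightarrow> complex. set_integrable lebesgue unit_ball v \<and> (\<forall>z\<in>unit_ball. berezin v z = zzeval (Q j) (phi (w j) z))"
    if j: "j \<in> {1..s}" for j
  proof -
    have "mdeg a = 0 \<or> mdeg b = 0 \<or> mdeg a + mdeg b \<le> 2 * CARD('n) + 1" if "Q j (a, b) \<noteq> 0" for a b
      using Q j that by (auto simp: tdeg_le_def mdeg_def)
    then obtain u where u: "u \<in> borel_measurable borel" "set_integrable lebesgue unit_ball u" "\<forall>z\<in>unit_ball. zzeval (Q j) z = berezin u z"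
      using zzpoly_in_range[of "Q j"] Q j by blast
    have w: "w j \<in> unit_ball" using Q j by blast
    show ?thesis using berezin_phi[OF w u(1,2)] u(3) phi_in_ball[OF w]
      by (intro exI[of _ "\<lambda>x. u (phi (w j) x)"]) simp
  qed
  then obtain v :: "nat \<Rightarrow> complex^'n \<Rightarrow> complex" where v: "\<And>j. j \<in> {1..s} \<Longrightarrow> set_integrable lebesgue unit_ball (v j)"
    "\<And>j z. j \<in> {1..s} \<Longrightarrow> z \<in> unit_ball \<Longrightarrow> berezin (v j) z = zzeval (Q j) (phi (w j) z)" by metis
  have "berezin (\<lambda>x. \<Sum>j=1..s. 1 * v j x) z = (\<Sum>j=1..s. zzeval (Q j) (phi (w j) z))" if z: "z \<in> unit_ball" for z
  proof -
    have "berezin (\<lambda>x. \<Sum>j=1..s. 1 * v j x) z = (\<Sum>j=1..s. 1 * berezin (v j) z)"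
      by (rule berezin_sum[OF v(1) z])
    then show ?thesis using v(2) z by simp
  qed
  moreover have "set_integrable lebesgue unit_ball (\<lambda>x. \<Sum>j=1..s. 1 * v j x)" by (rule set_integrable_sum_mult[OF v(1)])
  ultimately show "\<exists>u :: complex^'n \<Rightarrow> complex. set_integrable lebesgue unit_ball u \<and>
          (\<forall>z\<in>unit_ball. berezin u z = (\<Sum>j=1..s. zzeval (Q j) (phi (w j) z)))" by blast
qed

end
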